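(* Let $Q\in C^\infty(\mathbb R^2)$ be a background potential and let $\Omega\subset\mathbb R^2$ be a bounded convex open domain with smooth boundary. Suppose that $\partial\Omega$ is strictly convex with respect to $Q$ at $p\in\partial\Omega$. Then there exist an open neighborhood $\widetilde\Omega$ of $\overline\Omega$ and an open neighborhood $W\subset U$ of $p$ with $W\setminus\overline{\widetilde\Omega}\neq\emptyset$ such that, if $Q$ is known in $\mathbb R^2\setminus\widetilde\Omega$, the measurement map $\mathcal S=\mathcal S_Q$ restricted to $W\setminus\Omega$ determines $\partial^\alpha Q(p)$ for all multi-indices $\alpha$ with $|\alpha|\ge 1$. Precisely: whenever $Q'\in C^\infty(\mathbb R^2)$ is another background potential such that $\partial\Omega$ is strictly convex with respect to $Q'$ at $p$, $Q'=Q$ on $\mathbb R^2\setminus\widetilde\Omega$, and $\mathcal S_{Q'}(x,y)=\mathcal S_Q(x,y)$ for all $(x,y)\in (W\cap\partial\Omega)\times(W\setminus\Omega)$ with $x\neq y$, then $\partial^\alpha Q'(p)=\partial^\alpha Q(p)$ for all multi-indices $\alpha$ with $|\alpha|\ge1$.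
   Context: For $w:\mathbb R^2\to\mathbb R$ and $u=(u_1,u_2)\in\mathbb R^2$ write $\nabla^\perp w=(\partial_2 w,-\partial_1 w)$ and $u^\perp=(u_2,-u_1)$. Dipole dynamics. For a background potential $Q$, the vortex dipole $\{a_+,a_-\}$ evolves by $$\dot a_+(s)=\frac1\pi\frac{(a_+-a_-)^\perp}{|a_+-a_-|^2}+\nabla^\perp Q(a_+),\qquad \dot a_-(s)=\frac1\pi\frac{(a_+-a_-)^\perp}{|a_+-a_-|^2}-\nabla^\perp Q(a_-),$$ where $\dot{}=d/ds$. For $x\ne y$, $a_\pm(s,x,y)$ denotes the solution with $a_+(0,x,y)=x$, $a_-(0,x,y)=y$. Measurement map. $U$ is a fixed open set with $\Omega\subset\subset U$, such that $U\setminus\Omega$ is a tubular neighborhood around $\Omega$, and $\Delta=\{(x,x):x\in\partial\Omega\}$. For $(x,y)\in(\partial\Omega\times(U\setminus\Omega))\setminus\Delta$, $\tau_+(x,y)\in[0,\infty]$ is the first nonnegative time at which $a_+(\cdot,x,y)$ exits $\Omega$, i.e. $\tau_+(x,y)=\inf\{s\ge0:a_+(s,x,y)\notin\overline\Omega\}$ (and $\tau_+(x,y)=\infty$ if $a_+(s,x,y)\in\overline\Omega$ for all $s\ge0$). Define $$\mathcal S_Q(x,y)=\begin{cases}\big(\tau_+(x,y),\,a_+(\tau_+(x,y),x,y),\,a_-(\tau_+(x,y),x,y)\big) & \text{if } a_-(\tau_+(x,y),x,y)\notin\Omega,\\ \big(\tau_+(x,y),\,a_+(\tau_+(x,y),x,y)\big)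 & \text{if } a_-(\tau_+(x,y),x,y)\in\Omega.\end{cases}$$ Standing assumption on every potential considered: $\tau_+(x,y)<\infty$ for all $(x,y)\in(\partial\Omega\times(U\setminus\Omega))\setminus\Delta$, and the dipole never collides in $\Omega$ (so that $\mathcal S_Q$ is well defined). Strict convexity. For $p\in\partial\Omega$, $\partial\Omega$ is strictly convex at $p$ with respect to $Q$ if there is a small open neighborhood $V_p$ of $p$ such that, whenever $q\in V_p\setminus\Omega$, $q\ne p$, and $\dot a_+(0,p,q)$ is tangent to $\partial\Omega$, there is $\delta>0$ with $a_+(s,p,q)\notin\overline\Omega$ for all $s\in(-\delta,\delta)\setminus\{0\}$. *)

theory Defs
  imports "HOL-Analysis.Analysis"
begin

section \<open>Smooth functions and partial derivatives\<close>

definition dir_deriv ::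
  "'a::real_normed_vector \<Rightarrow> ('a \<Rightarrow> 'b::real_normed_vector) \<Rightarrow> 'a \<Rightarrow> 'b" where
  "dir_deriv v f = (\<lambda>x. frechet_derivative f (at x) v)"

text \<open>\<open>C\<^sup>\<infinity>\<close> on \<open>S\<close>, meant for open \<open>S\<close>: all iterated partial derivatives exist and are
  Frechet differentiable (in particular continuous) at every point of \<open>S\<close>.\<close>

definition smooth_on ::
  "'a::euclidean_space set \<Rightarrow> ('a \<Rightarrow> 'b::real_normed_vector) \<Rightarrow> bool" where
  "smooth_on S f \<longleftrightarrow>
    (\<forall>bs. set bs \<subseteq> Basis \<longrightarrow> (\<forall>x\<in>S. fold dir_deriv bs f differentiable (at x)))"

abbreviation partial :: "2 \<Rightarrow> (real^2 \<Rightarrow> real) \<Rightarrow> real^2 \<Rightarrow> real" where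
  "partial i \<equiv> dir_deriv (axis i 1)"

definition multi_partial :: "nat^2 \<Rightarrow> (real^2 \<Rightarrow> real) \<Rightarrow> real^2 \<Rightarrow> real" where
  "multi_partial \<alpha> f = (partial 1 ^^ (\<alpha> $ 1)) ((partial 2 ^^ (\<alpha> $ 2)) f)"

definition multi_order :: "nat^2 \<Rightarrow> nat" where
  "multi_order \<alpha> = \<alpha> $ 1 + \<alpha> $ 2"

definition grad :: "(real^2 \<Rightarrow> real) \<Rightarrow> real^2 \<Rightarrow> real^2" where
  "grad w x = vector [partial 1 w x, partial 2 w x]"

definition perp :: "real^2 \<Rightarrow> real^2" where
  "perp u = vector [u $ 2, - (u $ 1)]"

definition perp_grad :: "(real^2 \<Rightarrow> real) \<Rightarrow> real^2 \<Rightarrow> real^2" where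
  "perp_grad w x = vector [partial 2 w x, - partial 1 w x]"

section \<open>Domains with smooth boundary\<close>

text \<open>\<open>\<rho>\<close> is a defining function of \<open>\<Omega>\<close> on the open neighbourhood \<open>V\<close> of the boundary point
  \<open>x\<close>; it follows that the boundary of \<open>\<Omega>\<close> in \<open>V\<close> is the zero set of \<open>\<rho>\<close>.\<close>

definition defining_function ::
  "(real^2) set \<Rightarrow> real^2 \<Rightarrow> (real^2) set \<Rightarrow> (real^2 \<Rightarrow> real) \<Rightarrow> bool" where
  "defining_function \<Omega> x V \<rho> \<longleftrightarrow>
    open V \<and> x \<in> V \<and> smooth_on V \<rho> \<and> (\<forall>z\<in>V. grad \<rho> z \<noteq> 0) \<and> \<Omega> \<inter> V = {z \<in> V. \<rho> z < 0}"

definition smooth_boundary :: "(real^2) set \<Rightarrow> bool" where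
  "smooth_boundary \<Omega> \<longleftrightarrow> (\<forall>x\<in>frontier \<Omega>. \<exists>V \<rho>. defining_function \<Omega> x V \<rho>)"

definition tangent_to_boundary :: "(real^2) set \<Rightarrow> real^2 \<Rightarrow> real^2 \<Rightarrow> bool" where
  "tangent_to_boundary \<Omega> x v \<longleftrightarrow> (\<exists>V \<rho>. defining_function \<Omega> x V \<rho> \<and> grad \<rho> x \<bullet> v = 0)"

definition outward_unit_normal :: "(real^2) set \<Rightarrow> real^2 \<Rightarrow> real^2 \<Rightarrow> bool" where
  "outward_unit_normal \<Omega> x n \<longleftrightarrow>
    (\<exists>V \<rho>. defining_function \<Omega> x V \<rho> \<and> n = grad \<rho> x /\<^sub>R norm (grad \<rho> x))"

text \<open>Exterior tubular neighbourhood of \<open>\<Omega>\<close>: the normal map \<open>(x, t) \<mapsto> x + t \<nu>(x)\<close> is a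
  diffeomorphism from \<open>{(x, t). x \<in> \<partial>\<Omega>, 0 \<le> t < \<delta>(x)}\<close> onto \<open>N\<close>, for some continuous width
  \<open>\<delta> > 0\<close>. The map is smooth because the normal field of a smooth boundary is; its inverse is
  required to extend smoothly to an open set, as \<open>N\<close> is not open.\<close>

definition tubular_neighborhood :: "(real^2) set \<Rightarrow> (real^2) set \<Rightarrow> bool" where
  "tubular_neighborhood \<Omega> N \<longleftrightarrow>
    (\<exists>\<nu> \<delta>. (\<forall>x\<in>frontier \<Omega>. outward_unit_normal \<Omega> x (\<nu> x)) \<and>
      continuous_on (frontier \<Omega>) \<delta> \<and> (\<forall>x\<in>frontier \<Omega>. (0::real) < \<delta> x) \<and>
      bij_betw (\<lambda>(x, t). x + t *\<^sub>R \<nu> x) (SIGMA x:frontier \<Omega>. {0..<\<delta> x}) N \<and>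
      (\<exists>M G. open M \<and> N \<subseteq> M \<and> smooth_on M G \<and>
        (\<forall>x\<in>frontier \<Omega>. \<forall>t\<in>{0..<\<delta> x}. G (x + t *\<^sub>R \<nu> x) = (x, t))))"

section \<open>Dipole dynamics\<close>

definition dipole_solution ::
  "(real^2 \<Rightarrow> real) \<Rightarrow> real^2 \<Rightarrow> real^2 \<Rightarrow> real set \<Rightarrow> (real \<Rightarrow> real^2) \<Rightarrow> (real \<Rightarrow> real^2) \<Rightarrow> bool" where
  "dipole_solution Q x y J ap am \<longleftrightarrow>
    open J \<and> is_interval J \<and> 0 \<in> J \<and> ap 0 = x \<and> am 0 = y \<and>
    (\<forall>s\<in>J. ap s \<noteq> am s \<and>
      (ap has_vector_derivative
        ((1 / pi) *\<^sub>R (perp (ap s - am s) /\<^sub>R (norm (ap s - am s))\<^sup>2) + perp_grad Q (ap s))) (at s) \<and>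
      (am has_vector_derivative
        ((1 / pi) *\<^sub>R (perp (ap s - am s) /\<^sub>R (norm (ap s - am s))\<^sup>2) - perp_grad Q (am s))) (at s))"

text \<open>The maximal interval of existence. Global existence is not automatic, since the gradient
  of \<open>Q\<close> may be unbounded.\<close>

definition dipole_domain :: "(real^2 \<Rightarrow> real) \<Rightarrow> real^2 \<Rightarrow> real^2 \<Rightarrow> real set" where
  "dipole_domain Q x y = \<Union> {J. \<exists>ap am. dipole_solution Q x y J ap am}"

text \<open>The maximal solution \<open>(a\<^sub>+, a\<^sub>-)\<close>, meaningful for times in the maximal interval.\<close>

definition dipole_flow ::
  "(real^2 \<Rightarrow> real) \<Rightarrow> real \<Rightarrow> real^2 \<Rightarrow> real^2 \<Rightarrow> (real^2) \<times> (real^2)" where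
  "dipole_flow Q s x y =
    (THE z. \<exists>J ap am. dipole_solution Q x y J ap am \<and> s \<in> J \<and> z = (ap s, am s))"

definition a_plus :: "(real^2 \<Rightarrow> real) \<Rightarrow> real \<Rightarrow> real^2 \<Rightarrow> real^2 \<Rightarrow> real^2" where
  "a_plus Q s x y = fst (dipole_flow Q s x y)"

definition a_minus :: "(real^2 \<Rightarrow> real) \<Rightarrow> real \<Rightarrow> real^2 \<Rightarrow> real^2 \<Rightarrow> real^2" where
  "a_minus Q s x y = snd (dipole_flow Q s x y)"

section \<open>Measurement map\<close>

text \<open>The infimum of the empty set is \<open>\<infinity>\<close>.\<close>

definition exit_time :: "(real^2 \<Rightarrow> real) \<Rightarrow> (real^2) set \<Rightarrow> real^2 \<Rightarrow> real^2 \<Rightarrow> ereal" where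
  "exit_time Q \<Omega> x y =
    Inf (ereal ` {s. 0 \<le> s \<and> s \<in> dipole_domain Q x y \<and> a_plus Q s x y \<notin> closure \<Omega>})"

text \<open>The value is a triple or a pair, hence the sum type.\<close>

definition measurement ::
  "(real^2 \<Rightarrow> real) \<Rightarrow> (real^2) set \<Rightarrow> real^2 \<Rightarrow> real^2 \<Rightarrow>
    (ereal \<times> (real^2) \<times> (real^2)) + (ereal \<times> (real^2))" where
  "measurement Q \<Omega> x y =
    (let \<tau> = exit_time Q \<Omega> x y; s = real_of_ereal \<tau> in
      if a_minus Q s x y \<notin> \<Omega> then Inl (\<tau>, a_plus Q s x y, a_minus Q s x y)
      else Inr (\<tau>, a_plus Q s x y))"

text \<open>Solutions are collision-free on their interval of existence, so a collision is a common
  limit of \<open>a\<^sub>+\<close> and \<open>a\<^sub>-\<close> at a finite end of that interval.\<close>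

definition collides_in :: "(real^2 \<Rightarrow> real) \<Rightarrow> (real^2) set \<Rightarrow> real^2 \<Rightarrow> real^2 \<Rightarrow> bool" where
  "collides_in Q \<Omega> x y \<longleftrightarrow>
    (\<exists>T>0. \<exists>z\<in>\<Omega>. {0..<T} \<subseteq> dipole_domain Q x y \<and>
      ((\<lambda>s. a_plus Q s x y) \<longlongrightarrow> z) (at_left T) \<and>
      ((\<lambda>s. a_minus Q s x y) \<longlongrightarrow> z) (at_left T))"

definition admissible_potential ::
  "(real^2) set \<Rightarrow> (real^2) set \<Rightarrow> (real^2 \<Rightarrow> real) \<Rightarrow> bool" where
  "admissible_potential \<Omega> U Q \<longleftrightarrow>
    (\<forall>x\<in>frontier \<Omega>. \<forall>y\<in>U - \<Omega>. x \<noteq> y \<longrightarrow>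
      exit_time Q \<Omega> x y < \<infinity> \<and> \<not> collides_in Q \<Omega> x y)"

definition strictly_convex_at ::
  "(real^2) set \<Rightarrow> (real^2 \<Rightarrow> real) \<Rightarrow> real^2 \<Rightarrow> bool" where
  "strictly_convex_at \<Omega> Q p \<longleftrightarrow>
    (\<exists>V. open V \<and> p \<in> V \<and>
      (\<forall>q\<in>V - \<Omega>. q \<noteq> p \<and>
        tangent_to_boundary \<Omega> p (vector_derivative (\<lambda>s. a_plus Q s p q) (at 0)) \<longrightarrow>
        (\<exists>\<delta>>0. \<forall>s\<in>{-\<delta><..<\<delta>} - {0}.
          s \<in> dipole_domain Q p q \<and> a_plus Q s p q \<notin> closure \<Omega>)))"

end

theory Submission
  imports Defs
begin

text \<open>Take \<open>q\<close> close to \<open>p\<close>, outside \<open>\<Omega>\<close>, such that \<open>a\<^sub>+\<close> starts at \<open>p\<close> tangentially to the boundary.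
  By strict convexity the trajectory leaves \<open>\<Omega>\<close> after touching it, and a second-order differential
  inequality for the defining function along it yields boundary points arbitrarily close to \<open>p\<close>
  at which some tangential trajectory has strictly positive normal acceleration. This condition is
  open, so near such a point every boundary point is the start of arbitrarily short
  trajectories of \<open>a\<^sub>+\<close> through \<open>\<Omega>\<close>, while \<open>a\<^sub>-\<close> stays near \<open>q\<close>, where the potentials agree.
  Suppose \<open>D = Q' - Q\<close> has a non-vanishing jet there. At the least order of
  non-vanishing, \<open>\<nabla> D\<close> keeps to one side of a line on short chords, and then the
  trajectories for \<open>Q\<close> and \<open>Q'\<close>, which start together, cannot meet again at the exit
  time. Hence all derivatives of \<open>D\<close> vanish at these points, and by continuity at \<open>p\<close>.\<close>

section \<open>Two facts on ordinary differential inequalities\<close>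

text \<open>Strict convexity gives no order of contact: after the tangential start at p the
  trajectory leaves, but no power of time bounds how fast. Hence the detour through nearby boundary
  points, where positive acceleration yields chords of controlled shape. The data compare only end
  points, while D acts along the whole chord. The comparison is decisive because a_- stays where Q
  and Q' coincide, so that the forcing by D acts on a_+ alone, and because a_- ends outside
  \<Omega>, so that the measurement contains both end positions. The difference of the two
  trajectories then vanishes at both ends; on a short chord its Lipschitz part is small compared
  with the integral of the forcing, and a forcing of one sign must vanish. The sign comes from
  Taylor expansion in a coordinate direction transversal to the boundary, based at boundary points.
  Derivatives in the other direction follow since the vanishing holds at all boundary points of a
  small disc. All estimates run in one product of two disjoint balls with uniform constants, in
  place of regularity of the flow in its initial data.\<close>

text \<open>Were \<open>g2\<close> bounded above by this multiple, the maximum of \<open>g1\<close>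
  on a short interval would be at most half of itself: it is gained at rate at most
  \<open>2 * B * g1 m\<close> over a time at most \<open>1 / (4 * B)\<close>.\<close>

lemma one_sided_second_order_ineq_fails:
  fixes g g1 g2 :: "real \<Rightarrow> real"
  assumes d0: "0 < d"
    and g: "\<And>s. 0 \<le> s \<Longrightarrow> s \<le> d \<Longrightarrow> (g has_real_derivative g1 s) (at s)"
    and g1: "\<And>s. 0 \<le> s \<Longrightarrow> s \<le> d \<Longrightarrow> (g1 has_real_derivative g2 s) (at s)"
    and init: "g 0 = 0" "g1 0 = 0"
    and pos: "\<And>s. 0 < s \<Longrightarrow> s \<le> d \<Longrightarrow> 0 < g s"
  shows "\<exists>s. 0 < s \<and> s \<le> d \<and> C * (\<bar>g1 s\<bar> + \<bar>g s\<bar>) < g2 s"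
proof (rule ccontr)
  assume "\<not> ?thesis"
  then have ub: "g2 s \<le> C * (\<bar>g1 s\<bar> + \<bar>g s\<bar>)" if "0 < s" "s \<le> d" for s
    using that by (meson not_le)
  define B where "B = max C 1"
  have B: "B \<ge> 1" "C \<le> B" by (auto simp: B_def)
  have ubB: "g2 s \<le> B * (\<bar>g1 s\<bar> + \<bar>g s\<bar>)" if "0 < s" "s \<le> d" for s
    using ub[OF that] mult_right_mono[OF B(2), of "\<bar>g1 s\<bar> + \<bar>g s\<bar>"] by linarith
  define e where "e = min d (1 / (4 * B))"
  have e: "0 < e" "e \<le> d" "e \<le> 1 / (4 * B)"
    using d0 B by (auto simp: e_def)
  have "1 / (4 * B) \<le> 1" using B by (simp add: field_simps)
  then have e1: "e \<le> 1" using e by linarith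
  have cont: "continuous_on {0..e} g1"
    by (rule continuous_at_imp_continuous_on) (use g1 e DERIV_isCont in fastforce)
  obtain m where m: "m \<in> {0..e}" "\<And>s. s \<in> {0..e} \<Longrightarrow> g1 s \<le> g1 m"
    using continuous_attains_sup[of "{0..e}" g1] cont e by auto
  obtain z where z: "0 < z" "z < e" "g e - g 0 = (e - 0) * g1 z"
    using MVT2[of 0 e g g1] g e by force
  have "g1 z > 0"
    using z pos[of e] e init by (simp add: zero_less_mult_iff)
  then have M: "g1 m > 0" using m(2)[of z] z by auto
  then have m0: "m > 0" using init m(1) by (cases "m = 0") auto
  have gub: "\<bar>g s\<bar> \<le> g1 m * e" if s: "0 < s" "s \<le> e" for s
  proof -
    obtain z where z: "0 < z" "z < s" "g s - g 0 = (s - 0) * g1 z"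
      using MVT2[of 0 s g g1] g e s by force
    have "s * g1 z \<le> e * g1 m"
    proof -
      have "s * g1 z \<le> s * g1 m" using m(2)[of z] z s by (intro mult_left_mono) auto
      also have "\<dots> \<le> e * g1 m" using s M by (intro mult_right_mono) auto
      finally show ?thesis .
    qed
    then show ?thesis using z pos[of s] s e init by (simp add: mult.commute)
  qed
  \<comment> \<open>Starting from the last point with \<open>g1\<close> nonpositive keeps
    \<open>g1\<close> positive up to \<open>m\<close>, so that \<open>\<bar>g1 z\<bar>\<close> in
    the assumed bound is at most the maximum \<open>g1 m\<close>.\<close>
  define A where "A = {s \<in> {0..m}. g1 s \<le> 0}"
  have "compact A"
  proof -
    have "closed ({0..m} \<inter> g1 -` {..0})"
      using continuous_on_subset[OF cont, of "{0..m}"] m(1)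
      by (intro continuous_closed_preimage) auto
    moreover have "A = {0..m} \<inter> ({0..m} \<inter> g1 -` {..0})" by (auto simp: A_def)
    ultimately show ?thesis by (metis compact_Icc compact_Int_closed)
  qed
  moreover have "0 \<in> A" using init m(1) by (auto simp: A_def)
  ultimately obtain a where a: "a \<in> A" "\<And>s. s \<in> A \<Longrightarrow> s \<le> a"
    using compact_attains_sup[of A] by auto
  have am: "0 \<le> a" "a < m" "g1 a \<le> 0"
    using a(1) M by (auto simp: A_def less_le)
  obtain z where z: "a < z" "z < m" "g1 m - g1 a = (m - a) * g2 z"
    using MVT2[of a m g1 g2] g1 e am m(1) by force
  have zpos: "g1 z > 0" using a(2)[of z] z am m(1) by (force simp: A_def)
  have "g2 z \<le> B * (\<bar>g1 z\<bar> + \<bar>g z\<bar>)" using ubB z am m(1) e by auto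
  also have "\<dots> \<le> B * (g1 m + g1 m * e)"
    using m z am zpos gub[of z] B by (intro mult_left_mono add_mono) auto
  also have "\<dots> \<le> B * (2 * g1 m)"
    using e1 M B mult_left_mono[of e 1 "g1 m"] by (intro mult_left_mono) auto
  finally have g2z: "g2 z \<le> 2 * B * g1 m" by simp
  have "g1 m \<le> (m - a) * g2 z" using z am by linarith
  also have "\<dots> \<le> (m - a) * (2 * B * g1 m)" using g2z am by (intro mult_left_mono) auto
  also have "\<dots> \<le> e * (2 * B * g1 m)" using m(1) am M B by (intro mult_right_mono) auto
  also have "\<dots> \<le> 1 / (4 * B) * (2 * B * g1 m)" using e M B by (intro mult_right_mono) auto
  also have "\<dots> = g1 m / 2" using B by (simp add: field_simps)
  finally show False using M by linarith
qed

text \<open>Let I be the integral of \<omega> over the whole interval. The forcing moves E by at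
  most \<open>2 * K * I\<close>, so the Lipschitz part contributes at most
  \<open>2 * K * L * \<tau> * I\<close> to the increment of \<open>l (E s)\<close>. That increment
  is zero while the forcing contributes exactly I, and smallness leaves only
  \<open>I = 0\<close>.\<close>

lemma forced_difference_vanishes:
  fixes E :: "real \<Rightarrow> 'a::real_normed_vector" and \<omega> :: "real \<Rightarrow> real"
    and e1 e2 :: "real \<Rightarrow> 'a" and l :: "'a \<Rightarrow> real"
  assumes \<tau>: "0 < \<tau>"
    and E: "\<And>s. s \<in> {0..\<tau>} \<Longrightarrow> (E has_vector_derivative (e1 s + e2 s)) (at s)"
    and e1: "\<And>s. s \<in> {0..\<tau>} \<Longrightarrow> norm (e1 s) \<le> L * norm (E s)"
    and e2: "\<And>s. s \<in> {0..\<tau>} \<Longrightarrow> norm (e2 s) \<le> K * \<omega> s"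
    and w: "continuous_on {0..\<tau>} \<omega>" "\<And>s. s \<in> {0..\<tau>} \<Longrightarrow> 0 \<le> \<omega> s"
    and l: "bounded_linear l" "\<And>x. \<bar>l x\<bar> \<le> norm x" "\<And>s. s \<in> {0..\<tau>} \<Longrightarrow> l (e2 s) = \<omega> s"
    and ends: "E 0 = 0" "E \<tau> = 0"
    and small: "0 \<le> L" "0 \<le> K" "L * \<tau> \<le> 1/2" "2 * K * L * \<tau> < 1"
    and s: "s \<in> {0..\<tau>}"
  shows "E s = 0" "\<omega> s = 0"
proof -
  have contE: "continuous_on {0..\<tau>} E"
    by (rule continuous_at_imp_continuous_on)
       (use E has_vector_derivative_continuous in blast)
  then have "continuous_on {0..\<tau>} (\<lambda>s. norm (E s))" by (rule continuous_on_norm)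
  then obtain m where m: "m \<in> {0..\<tau>}" "\<And>s. s \<in> {0..\<tau>} \<Longrightarrow> norm (E s) \<le> norm (E m)"
    using continuous_attains_sup[of "{0..\<tau>}" "\<lambda>s. norm (E s)"] \<tau> by auto
  define I where "I = (\<lambda>u. integral {0..u} \<omega>)"
  have I: "(I has_vector_derivative \<omega> u) (at u within {0..\<tau>})" if "u \<in> {0..\<tau>}" for u
    unfolding I_def by (rule integral_has_vector_derivative[OF w(1) that])
  have contI: "continuous_on {0..\<tau>} I"
    using I has_vector_derivative_continuous continuous_on_eq_continuous_within by blast
  have I_at: "(I has_vector_derivative \<omega> u) (at u)" if "0 < u" "u < \<tau>" for u
    using I[of u] that by (simp add: at_within_Icc_at)
  have I0: "I 0 = 0" by (simp add: I_def)
  have Imono: "I u \<le> I \<tau>" if "u \<in> {0..\<tau>}" for u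
  proof -
    have "\<omega> integrable_on {0..u}" "\<omega> integrable_on {0..\<tau>}"
      using w(1) that by (auto intro!: integrable_continuous_interval elim: continuous_on_subset)
    then show ?thesis unfolding I_def
      using that w(2) by (intro integral_subset_le) auto
  qed
  have Iint: "\<omega> integrable_on {0..\<tau>}" using w(1) by (rule integrable_continuous_interval)
  have I_nn: "0 \<le> I \<tau>" using Imono[of 0] I0 \<tau> by auto
  \<comment> \<open>Mean value inequality with majorant \<open>L * norm (E m) * s + K * I s\<close>;
    the bound \<open>L * \<tau> \<le> 1/2\<close> absorbs the first term into the left side.\<close>
  have Em: "norm (E m) \<le> 2 * K * I \<tau>"
  proof (cases "m = 0")
    case True then show ?thesis using ends I_nn small by auto
  next
    case False
    then have m0: "0 < m" using m(1) by auto
    have "norm (E m - E 0) \<le> (L * norm (E m) * m + K * I m) - (L * norm (E m) * 0 + K * I 0)"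
    proof (rule differentiable_bound_general[OF m0, where f' = "\<lambda>s. e1 s + e2 s" and \<phi>' = "\<lambda>s. L * norm (E m) + K * \<omega> s"])
      show "continuous_on {0..m} E" using contE m(1) by (auto elim: continuous_on_subset)
      show "continuous_on {0..m} (\<lambda>s. L * norm (E m) * s + K * I s)"
        using contI m(1) by (intro continuous_intros) (auto elim: continuous_on_subset)
      fix u assume u: "0 < u" "u < m"
      then have uI: "u \<in> {0..\<tau>}" "u < \<tau>" using m(1) by auto
      show "(E has_vector_derivative (e1 u + e2 u)) (at u)" using E uI by auto
      have "((\<lambda>s. L * norm (E m) * s + K * I s) has_real_derivative (L * norm (E m) + K * \<omega> u)) (at u)"
        by (rule derivative_eq_intros I_at[unfolded has_real_derivative_iff_has_vector_derivative[symmetric]] refl | (use u uI in simp))+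
      then show "((\<lambda>s. L * norm (E m) * s + K * I s) has_vector_derivative (L * norm (E m) + K * \<omega> u)) (at u)"
        by (simp add: has_real_derivative_iff_has_vector_derivative)
      have "norm (e1 u + e2 u) \<le> L * norm (E u) + K * \<omega> u"
        using norm_triangle_ineq[of "e1 u" "e2 u"] e1[OF uI(1)] e2[OF uI(1)] by linarith
      also have "L * norm (E u) \<le> L * norm (E m)" using m(2) uI small by (intro mult_left_mono) auto
      finally show "norm (e1 u + e2 u) \<le> L * norm (E m) + K * \<omega> u" by simp
    qed
    then have "norm (E m) \<le> L * norm (E m) * m + K * I m" using ends I0 by simp
    also have "L * norm (E m) * m \<le> L * norm (E m) * \<tau>"
      using m(1) small by (intro mult_left_mono) auto
    also have "L * norm (E m) * \<tau> = (L * \<tau>) * norm (E m)" by simp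
    also have "\<dots> \<le> 1/2 * norm (E m)" using small by (intro mult_right_mono) auto
    also have "K * I m \<le> K * I \<tau>" using Imono m(1) small by (intro mult_left_mono) auto
    finally show ?thesis by linarith
  qed
  \<comment> \<open>Subtracting I removes the forcing: the derivative of
    \<open>l (E s) - I s\<close> is \<open>l (e1 s)\<close> alone.\<close>
  have "norm ((l (E \<tau>) - I \<tau>) - (l (E 0) - I 0)) \<le> L * norm (E m) * \<tau> - L * norm (E m) * 0"
  proof (rule differentiable_bound_general[OF \<tau>, where f' = "\<lambda>s. l (e1 s)" and \<phi>' = "\<lambda>s. L * norm (E m)"])
    show "continuous_on {0..\<tau>} (\<lambda>s. l (E s) - I s)"
      using contI bounded_linear.continuous_on[OF l(1) contE] by (intro continuous_intros)
    show "continuous_on {0..\<tau>} (\<lambda>s. L * norm (E m) * s)" by (intro continuous_intros)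
    fix u assume u: "0 < u" "u < \<tau>"
    have "((\<lambda>s. l (E s)) has_vector_derivative l (e1 u + e2 u)) (at u)"
      using bounded_linear.has_vector_derivative[OF l(1) E] u by auto
    then have "((\<lambda>s. l (E s) - I s) has_vector_derivative l (e1 u + e2 u) - \<omega> u) (at u)"
      using I_at[OF u] by (rule has_vector_derivative_diff)
    moreover have "l (e1 u + e2 u) - \<omega> u = l (e1 u)"
      using l(3)[of u] u by (simp add: linear_simps[OF l(1)])
    ultimately show "((\<lambda>s. l (E s) - I s) has_vector_derivative l (e1 u)) (at u)" by simp
    show "((\<lambda>s. L * norm (E m) * s) has_vector_derivative L * norm (E m)) (at u)"
      by (auto intro!: derivative_eq_intros simp: has_real_derivative_iff_has_vector_derivative[symmetric])
    have "norm (l (e1 u)) \<le> norm (e1 u)" using l(2) by simp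
    also have "\<dots> \<le> L * norm (E u)" using e1 u by auto
    also have "\<dots> \<le> L * norm (E m)" using m(2) u small by (intro mult_left_mono) auto
    finally show "norm (l (e1 u)) \<le> L * norm (E m)" .
  qed
  then have "I \<tau> \<le> L * norm (E m) * \<tau>"
    using ends I0 by (simp add: linear_simps[OF l(1)])
  also have "\<dots> \<le> L * (2 * K * I \<tau>) * \<tau>"
    using Em small \<tau> by (intro mult_right_mono mult_left_mono) auto
  also have "\<dots> = (2 * K * L * \<tau>) * I \<tau>" by simp
  finally have le: "(1 - 2 * K * L * \<tau>) * I \<tau> \<le> 0" by (simp add: algebra_simps)
  have It: "I \<tau> = 0"
    using le I_nn small(4) by (smt (verit) mult_pos_pos)
  then show "E s = 0" using Em m(2)[OF s] by simp
  have "(\<omega> has_integral 0) (cbox 0 \<tau>)"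
    using It Iint unfolding I_def by (metis box_real(2) integrable_integral)
  then show "\<omega> s = 0"
    using has_integral_0_cbox_imp_0[of 0 \<tau> \<omega> s] w s \<tau> by auto
qed

text \<open>The speed is bounded only inside the ball, so the argument looks at the first time at
  distance at least r: up to then the bound holds and the path covers at most
  \<open>M * T < r\<close>.\<close>

lemma solution_stays_in_ball:
  fixes Y Y' :: "real \<Rightarrow> 'a::real_normed_vector"
  assumes Y: "\<And>s. s \<in> {0..T} \<Longrightarrow> (Y has_vector_derivative Y' s) (at s)"
    and M: "\<And>s. s \<in> {0..T} \<Longrightarrow> dist (Y s) (Y 0) \<le> r \<Longrightarrow> norm (Y' s) \<le> M"
    and T: "M * T < r" "0 \<le> M" and s: "s \<in> {0..T}"
  shows "dist (Y s) (Y 0) < r"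
proof (rule ccontr)
  assume "\<not> ?thesis"
  then have r: "r \<le> dist (Y s) (Y 0)" by simp
  have cont: "continuous_on {0..T} Y"
    by (rule continuous_at_imp_continuous_on) (use Y has_vector_derivative_continuous in blast)
  define A where "A = {s \<in> {0..T}. r \<le> dist (Y s) (Y 0)}"
  have "compact A"
  proof -
    have "closed ({0..T} \<inter> (\<lambda>s. dist (Y s) (Y 0)) -` {r..})"
      using cont by (intro continuous_closed_preimage continuous_intros) auto
    moreover have "A = {0..T} \<inter> ({0..T} \<inter> (\<lambda>s. dist (Y s) (Y 0)) -` {r..})" by (auto simp: A_def)
    ultimately show ?thesis by (metis compact_Icc compact_Int_closed)
  qed
  moreover have "s \<in> A" using r s by (auto simp: A_def)
  ultimately obtain a where a: "a \<in> A" "\<And>s. s \<in> A \<Longrightarrow> a \<le> s"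
    using compact_attains_inf[of A] by auto
  have aT: "a \<in> {0..T}" "r \<le> dist (Y a) (Y 0)" using a(1) by (auto simp: A_def)
  have r0: "r > 0" using T aT by (smt (verit) atLeastAtMost_iff mult_nonneg_nonneg)
  have "a \<noteq> 0" using aT r0 by auto
  then have a0: "0 < a" using aT by auto
  have "norm (Y a - Y 0) \<le> M * a - M * 0"
  proof (rule differentiable_bound_general[OF a0, where f' = Y' and \<phi>' = "\<lambda>_. M"])
    show "continuous_on {0..a} Y" using cont aT by (auto elim: continuous_on_subset)
    show "continuous_on {0..a} (\<lambda>s. M * s)" by (intro continuous_intros)
    fix u assume u: "0 < u" "u < a"
    show "(Y has_vector_derivative Y' u) (at u)" using Y u aT by auto
    show "((\<lambda>s. M * s) has_vector_derivative M) (at u)"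
      by (auto intro!: derivative_eq_intros simp: has_real_derivative_iff_has_vector_derivative[symmetric])
    have "u \<notin> A" using a(2)[of u] u by auto
    then show "norm (Y' u) \<le> M" using M[of u] u aT by (auto simp: A_def)
  qed
  also have "\<dots> \<le> M * T" using aT T by (auto intro: mult_left_mono)
  finally show False using aT T by (simp add: dist_norm)
qed

section \<open>Smooth functions in the plane\<close>

lemma axis_in_Basis2 [simp]: "axis i (1::real) \<in> (Basis :: (real^2) set)"
  by (simp add: axis_in_Basis_iff)

lemma Basis_real2: "(Basis :: (real^2) set) = {axis 1 1, axis 2 1}"
  by (auto simp: Basis_vec_def UNIV_2)

lemma smooth_on_dir_deriv:
  assumes "smooth_on S f" "b \<in> Basis"
  shows "smooth_on S (dir_deriv b f)"
  unfolding smooth_on_def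
proof (intro allI impI)
  fix bs :: "'a list" assume "set bs \<subseteq> Basis"
  then have "\<forall>x\<in>S. fold dir_deriv (b # bs) f differentiable at x"
    using assms unfolding smooth_on_def by (metis insert_subset list.simps(15))
  then show "\<forall>x\<in>S. fold dir_deriv bs (dir_deriv b f) differentiable at x" by simp
qed

lemma smooth_on_partial: "smooth_on S f \<Longrightarrow> smooth_on S (partial i f)"
  by (rule smooth_on_dir_deriv) auto

lemma smooth_on_partial_funpow: "smooth_on S f \<Longrightarrow> smooth_on S ((partial i ^^ k) f)"
  by (induction k) (auto intro: smooth_on_partial)

lemma smooth_on_differentiable: "smooth_on S f \<Longrightarrow> x \<in> S \<Longrightarrow> f differentiable at x"
  unfolding smooth_on_def by (metis empty_subsetI fold_simps(1) list.set(1))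

lemma smooth_on_isCont: "smooth_on S f \<Longrightarrow> x \<in> S \<Longrightarrow> isCont f x"
  by (simp add: differentiable_imp_continuous_within smooth_on_differentiable)

lemma smooth_on_continuous_on: "smooth_on S f \<Longrightarrow> continuous_on S f"
  by (simp add: continuous_at_imp_continuous_on smooth_on_isCont)

lemma smooth_on_has_derivative:
  fixes f :: "real^2 \<Rightarrow> real"
  assumes "smooth_on S f" "x \<in> S"
  shows "(f has_derivative (\<lambda>h. h$1 * partial 1 f x + h$2 * partial 2 f x)) (at x)"
proof -
  have d: "(f has_derivative frechet_derivative f (at x)) (at x)"
    using smooth_on_differentiable[OF assms] by (simp add: frechet_derivative_works)
  then have lin: "linear (frechet_derivative f (at x))"
    using has_derivative_linear by blast
  have "frechet_derivative f (at x) h = h$1 * partial 1 f x + h$2 * partial 2 f x" for h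
  proof -
    have "h = h$1 *\<^sub>R axis 1 1 + h$2 *\<^sub>R axis 2 1"
      by (simp add: vec_eq_iff forall_2 axis_def)
    then have "frechet_derivative f (at x) h
        = frechet_derivative f (at x) (h$1 *\<^sub>R axis 1 1 + h$2 *\<^sub>R axis 2 1)" by simp
    then show ?thesis
      by (simp add: linear_add[OF lin] linear_scale[OF lin] dir_deriv_def)
  qed
  then have "frechet_derivative f (at x) = (\<lambda>h. h$1 * partial 1 f x + h$2 * partial 2 f x)" by auto
  then show ?thesis using d by simp
qed

lemma smooth_on_curve:
  fixes f :: "real^2 \<Rightarrow> real"
  assumes "smooth_on S f" "c s \<in> S" "(c has_vector_derivative v) (at s)"
  shows "((\<lambda>s. f (c s)) has_real_derivative (v$1 * partial 1 f (c s) + v$2 * partial 2 f (c s))) (at s)"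
proof -
  have "((f \<circ> c) has_derivative
      (\<lambda>h. h$1 * partial 1 f (c s) + h$2 * partial 2 f (c s)) \<circ> (\<lambda>h. h *\<^sub>R v)) (at s)"
    by (rule diff_chain_at)
       (use assms smooth_on_has_derivative[OF assms(1,2)] in \<open>auto simp: has_vector_derivative_def\<close>)
  moreover have "(\<lambda>h. h$1 * partial 1 f (c s) + h$2 * partial 2 f (c s)) \<circ> (\<lambda>h. h *\<^sub>R v)
      = (*) (v$1 * partial 1 f (c s) + v$2 * partial 2 f (c s))"
    by (auto simp: algebra_simps)
  ultimately show ?thesis by (simp add: has_field_derivative_def o_def)
qed

lemma smooth_on_line:
  fixes f :: "real^2 \<Rightarrow> real"
  assumes "smooth_on S f" "b + (c * t) *\<^sub>R axis i 1 \<in> S"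
  shows "((\<lambda>t. f (b + (c * t) *\<^sub>R axis i 1)) has_real_derivative
    c * partial i f (b + (c * t) *\<^sub>R axis i 1)) (at t)"
proof -
  have "((\<lambda>t. b + (c * t) *\<^sub>R axis i 1) has_vector_derivative (c *\<^sub>R axis i 1 :: real^2)) (at t)"
    by (auto intro!: derivative_eq_intros simp: has_vector_derivative_def)
  from smooth_on_curve[OF assms this]
  show ?thesis using exhaust_2[of i] by (auto simp: axis_def)
qed

lemma smooth_on_lipschitz:
  fixes f :: "real^2 \<Rightarrow> real"
  assumes "smooth_on S f" "C \<subseteq> S" "compact C" "convex C"
  shows "\<exists>L. L-lipschitz_on C f"
proof -
  have "\<exists>B. \<forall>x\<in>C. \<bar>partial i f x\<bar> \<le> B" for i
  proof -
    have "continuous_on C (partial i f)"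
      using smooth_on_continuous_on[OF smooth_on_partial[OF assms(1)]] assms(2)
      by (rule continuous_on_subset)
    then have "bounded (partial i f ` C)"
      using assms(3) by (intro compact_imp_bounded compact_continuous_image)
    then show ?thesis by (auto simp: bounded_iff)
  qed
  then obtain B where B: "\<And>i x. x \<in> C \<Longrightarrow> \<bar>partial i f x\<bar> \<le> B i" by metis
  define L where "L = \<bar>B 1\<bar> + \<bar>B 2\<bar>"
  have "L-lipschitz_on C f"
  proof (rule bounded_derivative_imp_lipschitz)
    show "(f has_derivative (\<lambda>h. h$1 * partial 1 f x + h$2 * partial 2 f x)) (at x within C)"
      if "x \<in> C" for x
      using smooth_on_has_derivative[OF assms(1)] assms(2) that has_derivative_at_withinI by blast
    show "convex C" by fact
    show "onorm (\<lambda>h::real^2. h$1 * partial 1 f x + h$2 * partial 2 f x) \<le> L" if x: "x \<in> C" for x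
    proof (rule onorm_le)
      fix h :: "real^2"
      have "norm (h$1 * partial 1 f x + h$2 * partial 2 f x)
          \<le> \<bar>h$1\<bar> * \<bar>partial 1 f x\<bar> + \<bar>h$2\<bar> * \<bar>partial 2 f x\<bar>"
        by (metis abs_mult abs_triangle_ineq real_norm_def)
      also have "\<dots> \<le> norm h * \<bar>B 1\<bar> + norm h * \<bar>B 2\<bar>"
        using B[OF x, of 1] B[OF x, of 2]
        by (intro add_mono mult_mono component_le_norm_cart) auto
      finally show "norm (h$1 * partial 1 f x + h$2 * partial 2 f x) \<le> L * norm h"
        by (simp add: L_def algebra_simps)
    qed
    show "L \<ge> 0" by (simp add: L_def)
  qed
  then show ?thesis ..
qed

lemma partial_diff:
  assumes "smooth_on UNIV f" "smooth_on UNIV g"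
  shows "partial i (\<lambda>x. f x - g x) = (\<lambda>x. partial i f x - partial i g x)"
proof
  fix x
  have "((\<lambda>x. f x - g x) has_derivative
      (\<lambda>h. frechet_derivative f (at x) h - frechet_derivative g (at x) h)) (at x)"
    using smooth_on_differentiable[OF assms(1), of x] smooth_on_differentiable[OF assms(2), of x]
    by (intro has_derivative_diff) (auto simp: frechet_derivative_works)
  from frechet_derivative_at[OF this]
  show "partial i (\<lambda>x. f x - g x) x = partial i f x - partial i g x"
    unfolding dir_deriv_def by metis
qed

lemma fold_dir_deriv_diff:
  fixes f g :: "real^2 \<Rightarrow> real"
  assumes "smooth_on UNIV f" "smooth_on UNIV g" "set bs \<subseteq> Basis"
  shows "fold dir_deriv bs (\<lambda>x. f x - g x) = (\<lambda>x. fold dir_deriv bs f x - fold dir_deriv bs g x)"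
  using assms
proof (induction bs arbitrary: f g)
  case (Cons b bs)
  then obtain i where "b = axis i 1" by (auto simp: Basis_real2)
  then show ?case using Cons partial_diff[OF Cons.prems(1,2)] by (simp add: smooth_on_partial)
qed simp

lemma smooth_on_diff:
  fixes f g :: "real^2 \<Rightarrow> real"
  assumes "smooth_on UNIV f" "smooth_on UNIV g"
  shows "smooth_on UNIV (\<lambda>x. f x - g x)"
  unfolding smooth_on_def
proof (intro allI impI ballI)
  fix bs :: "(real^2) list" and x assume bs: "set bs \<subseteq> Basis"
  have "fold dir_deriv bs f differentiable at x" "fold dir_deriv bs g differentiable at x"
    using assms bs unfolding smooth_on_def by blast+
  then show "fold dir_deriv bs (\<lambda>x. f x - g x) differentiable at x"
    unfolding fold_dir_deriv_diff[OF assms bs] by (rule differentiable_diff)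
qed

text \<open>The second difference on the left is symmetric in \<open>i\<close> and \<open>j\<close>, hence Clairaut's theorem.\<close>

lemma second_difference:
  fixes f :: "real^2 \<Rightarrow> real"
  assumes f: "smooth_on UNIV f" and h: "0 < h"
  shows "\<exists>u v. 0 < u \<and> u < h \<and> 0 < v \<and> v < h \<and>
    f (x + h *\<^sub>R axis i 1 + h *\<^sub>R axis j 1) - f (x + h *\<^sub>R axis i 1) - f (x + h *\<^sub>R axis j 1) + f x
      = h * h * partial j (partial i f) (x + u *\<^sub>R axis i 1 + v *\<^sub>R axis j 1)"
proof -
  define p where "p = (\<lambda>t. f ((x + h *\<^sub>R axis j 1) + t *\<^sub>R axis i 1) - f (x + t *\<^sub>R axis i 1))"
  have line: "((\<lambda>t. g (b + t *\<^sub>R axis i 1)) has_real_derivative partial i g (b + t *\<^sub>R axis i 1)) (at t)"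
    if "smooth_on UNIV g" for g b t i
    using smooth_on_line[OF that, of b 1 t i] by simp
  obtain u where u: "0 < u" "u < h" "p h - p 0 = (h - 0) *
      (partial i f ((x + h *\<^sub>R axis j 1) + u *\<^sub>R axis i 1) - partial i f (x + u *\<^sub>R axis i 1))"
    using MVT2[OF h, of p "\<lambda>t. partial i f ((x + h *\<^sub>R axis j 1) + t *\<^sub>R axis i 1) - partial i f (x + t *\<^sub>R axis i 1)"]
      DERIV_diff[OF line[OF f, of "x + h *\<^sub>R axis j 1" i] line[OF f, of x i]]
    unfolding p_def by blast
  obtain v where v: "0 < v" "v < h"
      "partial i f ((x + u *\<^sub>R axis i 1) + h *\<^sub>R axis j 1) - partial i f ((x + u *\<^sub>R axis i 1) + 0 *\<^sub>R axis j 1)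
       = (h - 0) * partial j (partial i f) ((x + u *\<^sub>R axis i 1) + v *\<^sub>R axis j 1)"
    using MVT2[OF h, of "\<lambda>t. partial i f ((x + u *\<^sub>R axis i 1) + t *\<^sub>R axis j 1)"
        "\<lambda>t. partial j (partial i f) ((x + u *\<^sub>R axis i 1) + t *\<^sub>R axis j 1)"]
      line[OF smooth_on_partial[OF f]] by auto
  have "p h - p 0 = h * h * partial j (partial i f) (x + u *\<^sub>R axis i 1 + v *\<^sub>R axis j 1)"
    using u(3) v(3) by (simp add: algebra_simps)
  moreover have "p h - p 0 = f (x + h *\<^sub>R axis i 1 + h *\<^sub>R axis j 1) - f (x + h *\<^sub>R axis i 1)
      - f (x + h *\<^sub>R axis j 1) + f x"
    by (simp add: p_def algebra_simps)
  ultimately show ?thesis using u v by auto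
qed

text \<open>If the mixed partials differed at x, continuity would keep their values apart on a small
  ball, yet both take there the value of the same second difference divided by
  \<open>h * h\<close>.\<close>

lemma partial_commute:
  fixes f :: "real^2 \<Rightarrow> real"
  assumes f: "smooth_on UNIV f"
  shows "partial j (partial i f) x = partial i (partial j f) x"
proof (rule ccontr)
  let ?A = "partial j (partial i f)" and ?B = "partial i (partial j f)"
  assume "?A x \<noteq> ?B x"
  then have e: "\<bar>?A x - ?B x\<bar> / 2 > 0" by simp
  have "isCont ?A x" "isCont ?B x"
    by (auto intro!: smooth_on_isCont[of UNIV] smooth_on_partial f)
  then obtain d1 d2 where d: "d1 > 0" "d2 > 0"
    "\<And>y. dist y x < d1 \<Longrightarrow> dist (?A y) (?A x) < \<bar>?A x - ?B x\<bar> / 2"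
    "\<And>y. dist y x < d2 \<Longrightarrow> dist (?B y) (?B x) < \<bar>?A x - ?B x\<bar> / 2"
    using e unfolding continuous_at_eps_delta by metis
  define h where "h = min d1 d2 / 2"
  have h: "h > 0" "2 * h \<le> d1" "2 * h \<le> d2" using d by (auto simp: h_def)
  have close: "dist (x + u *\<^sub>R axis i 1 + v *\<^sub>R axis j 1) x < 2 * h"
    if "0 < u" "u < h" "0 < v" "v < h" for u v and i j :: 2
  proof -
    have "norm (u *\<^sub>R axis i 1 + v *\<^sub>R axis j (1::real) :: real^2) \<le> u + v"
      using norm_triangle_ineq[of "u *\<^sub>R axis i (1::real) :: real^2" "v *\<^sub>R axis j 1"] that by (simp add: norm_axis_1)
    then show ?thesis using that by (simp add: dist_norm add.assoc)
  qed
  obtain u v where uv: "0 < u" "u < h" "0 < v" "v < h"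
    "f (x + h *\<^sub>R axis i 1 + h *\<^sub>R axis j 1) - f (x + h *\<^sub>R axis i 1) - f (x + h *\<^sub>R axis j 1) + f x
      = h * h * ?A (x + u *\<^sub>R axis i 1 + v *\<^sub>R axis j 1)"
    using second_difference[OF f h(1), of x i j] by metis
  obtain u' v' where uv': "0 < u'" "u' < h" "0 < v'" "v' < h"
    "f (x + h *\<^sub>R axis j 1 + h *\<^sub>R axis i 1) - f (x + h *\<^sub>R axis j 1) - f (x + h *\<^sub>R axis i 1) + f x
      = h * h * ?B (x + u' *\<^sub>R axis j 1 + v' *\<^sub>R axis i 1)"
    using second_difference[OF f h(1), of x j i] by metis
  have "x + h *\<^sub>R axis j 1 + h *\<^sub>R axis i 1 = x + h *\<^sub>R axis i 1 + h *\<^sub>R axis j 1" by simp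
  then have "h * h * ?A (x + u *\<^sub>R axis i 1 + v *\<^sub>R axis j 1) = h * h * ?B (x + u' *\<^sub>R axis j 1 + v' *\<^sub>R axis i 1)"
    using uv(5) uv'(5) by (simp only:)
  then have "?A (x + u *\<^sub>R axis i 1 + v *\<^sub>R axis j 1) = ?B (x + u' *\<^sub>R axis j 1 + v' *\<^sub>R axis i 1)"
    using h by simp
  moreover have "dist (?A (x + u *\<^sub>R axis i 1 + v *\<^sub>R axis j 1)) (?A x) < \<bar>?A x - ?B x\<bar> / 2"
    using close[OF uv(1-4), of i j] h by (intro d) linarith
  moreover have "dist (?B (x + u' *\<^sub>R axis j 1 + v' *\<^sub>R axis i 1)) (?B x) < \<bar>?A x - ?B x\<bar> / 2"
    using close[OF uv'(1-4), of j i] h by (intro d) linarith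
  moreover have False if "y = z" "dist y a < \<bar>a - b\<bar> / 2" "dist z b < \<bar>a - b\<bar> / 2" for y z a b :: real
    using that unfolding dist_real_def by argo
  ultimately show False by blast
qed

lemma partial_funpow_commute:
  fixes f :: "real^2 \<Rightarrow> real"
  assumes "smooth_on UNIV f"
  shows "(partial i ^^ k) (partial j f) = partial j ((partial i ^^ k) f)"
proof (induction k)
  case (Suc k)
  then show ?case
    using partial_commute[OF smooth_on_partial_funpow[OF assms]] by auto
qed simp

text \<open>Lagrange remainder along one coordinate line. With the lower terms gone, size and sign
  of f come from its n-th derivative: this is applied with general n to the gradient of D and with
  \<open>n = 1\<close> in the flatness argument.\<close>

lemma partial_taylor:
  fixes f :: "real^2 \<Rightarrow> real"
  assumes f: "smooth_on UNIV f" and z: "\<And>m. m < n \<Longrightarrow> (partial i ^^ m) f b = 0"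
  shows "\<exists>t. \<bar>t\<bar> \<le> \<bar>h\<bar> \<and> f (b + h *\<^sub>R axis i 1) = (partial i ^^ n) f (b + t *\<^sub>R axis i 1) / fact n * h ^ n"
proof -
  define diff where "diff = (\<lambda>m t. (partial i ^^ m) f (b + t *\<^sub>R axis i 1))"
  have "\<forall>m x. DERIV (diff m) x :> diff (Suc m) x"
  proof (intro allI)
    fix m x
    have "smooth_on UNIV ((partial i ^^ m) f)" by (rule smooth_on_partial_funpow[OF f])
    from smooth_on_line[OF this, of b 1 x i]
    show "DERIV (diff m) x :> diff (Suc m) x" by (simp add: diff_def)
  qed
  then obtain t where "\<bar>t\<bar> \<le> \<bar>h\<bar>"
    "diff 0 h = (\<Sum>m<n. diff m 0 / fact m * h ^ m) + diff n t / fact n * h ^ n"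
    using Maclaurin_all_le[of diff "diff 0" h n] by auto
  moreover have "(\<Sum>m<n. diff m 0 / fact m * h ^ m) = 0"
    by (intro sum.neutral) (auto simp: diff_def z)
  ultimately show ?thesis by (auto simp: diff_def)
qed

section \<open>Dipole solutions and exit times\<close>

text \<open>The constant is hidden by an existential quantifier so that this and the following rules
  chain by introduction on explicit coordinate formulas; compactness supplies the bounds of the
  factors.\<close>

lemma lipschitz_mult_exists:
  fixes f g :: "'a::metric_space \<Rightarrow> real"
  assumes C: "compact C" and f: "\<exists>L. L-lipschitz_on C f" and g: "\<exists>L. L-lipschitz_on C g"
  shows "\<exists>L. L-lipschitz_on C (\<lambda>x. f x * g x)"
proof -
  obtain L M where L: "L-lipschitz_on C f" and M: "M-lipschitz_on C g" using f g by auto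
  have "bounded (f ` C)" "bounded (g ` C)"
    using C L M by (auto intro!: compact_imp_bounded compact_continuous_image lipschitz_on_continuous_on)
  then obtain A B where A: "\<And>x. x \<in> C \<Longrightarrow> \<bar>f x\<bar> \<le> A" and B: "\<And>x. x \<in> C \<Longrightarrow> \<bar>g x\<bar> \<le> B"
    by (auto simp: bounded_iff)
  have "(\<bar>A\<bar> * M + L * \<bar>B\<bar>)-lipschitz_on C (\<lambda>x. f x * g x)"
  proof (rule lipschitz_onI)
    fix x y assume xy: "x \<in> C" "y \<in> C"
    have "f x * g x - f y * g y = f x * (g x - g y) + (f x - f y) * g y" by (simp add: algebra_simps)
    then have "dist (f x * g x) (f y * g y) \<le> \<bar>f x\<bar> * dist (g x) (g y) + dist (f x) (f y) * \<bar>g y\<bar>"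
      unfolding dist_real_def by (metis abs_mult abs_triangle_ineq)
    also have "\<dots> \<le> \<bar>A\<bar> * (M * dist x y) + (L * dist x y) * \<bar>B\<bar>"
      using A[OF xy(1)] B[OF xy(2)] lipschitz_onD[OF L xy] lipschitz_onD[OF M xy] lipschitz_on_nonneg[OF L]
      by (intro add_mono mult_mono) auto
    finally show "dist (f x * g x) (f y * g y) \<le> (\<bar>A\<bar> * M + L * \<bar>B\<bar>) * dist x y"
      by (simp add: algebra_simps)
  qed (use lipschitz_on_nonneg[OF L] lipschitz_on_nonneg[OF M] in auto)
  then show ?thesis ..
qed

lemma lipschitz_inverse_exists:
  fixes f :: "'a::metric_space \<Rightarrow> real"
  assumes C: "compact C" and f: "\<exists>L. L-lipschitz_on C f" and nz: "\<And>x. x \<in> C \<Longrightarrow> f x \<noteq> 0"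
  shows "\<exists>L. L-lipschitz_on C (\<lambda>x. inverse (f x))"
proof -
  obtain L where L: "L-lipschitz_on C f" using f by auto
  have "continuous_on C (\<lambda>x. inverse (f x))"
    using nz by (intro continuous_on_inverse lipschitz_on_continuous_on[OF L]) auto
  then have "bounded ((\<lambda>x. inverse (f x)) ` C)"
    using C by (auto intro!: compact_imp_bounded compact_continuous_image)
  then obtain A where A: "\<And>x. x \<in> C \<Longrightarrow> \<bar>inverse (f x)\<bar> \<le> A"
    by (auto simp: bounded_iff)
  have "(\<bar>A\<bar> * \<bar>A\<bar> * L)-lipschitz_on C (\<lambda>x. inverse (f x))"
  proof (rule lipschitz_onI)
    fix x y assume xy: "x \<in> C" "y \<in> C"
    have "inverse (f x) - inverse (f y) = inverse (f x) * inverse (f y) * (f y - f x)"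
      using nz xy by (simp add: field_simps)
    then have "dist (inverse (f x)) (inverse (f y)) = \<bar>inverse (f x)\<bar> * \<bar>inverse (f y)\<bar> * dist (f x) (f y)"
      unfolding dist_real_def by (simp add: abs_mult abs_minus_commute)
    also have "\<dots> \<le> \<bar>A\<bar> * \<bar>A\<bar> * (L * dist x y)"
      using A[OF xy(1)] A[OF xy(2)] lipschitz_onD[OF L xy]
      by (intro mult_mono) auto
    finally show "dist (inverse (f x)) (inverse (f y)) \<le> \<bar>A\<bar> * \<bar>A\<bar> * L * dist x y"
      by (simp add: mult.assoc)
  qed (use lipschitz_on_nonneg[OF L] in auto)
  then show ?thesis ..
qed

lemma lipschitz_add_exists:
  fixes f g :: "'a::metric_space \<Rightarrow> real"
  assumes "\<exists>L. L-lipschitz_on C f" "\<exists>L. L-lipschitz_on C g"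
  shows "\<exists>L. L-lipschitz_on C (\<lambda>x. f x + g x)"
  using assms lipschitz_on_add by blast

lemma lipschitz_diff_exists:
  fixes f g :: "'a::metric_space \<Rightarrow> real"
  assumes "\<exists>L. L-lipschitz_on C f" "\<exists>L. L-lipschitz_on C g"
  shows "\<exists>L. L-lipschitz_on C (\<lambda>x. f x - g x)"
  using assms lipschitz_on_diff by blast

lemma lipschitz_const_exists: "\<exists>L. L-lipschitz_on C (\<lambda>x. c)"
  using lipschitz_on_constant by blast

lemma lipschitz_nth_exists:
  fixes f :: "'a::metric_space \<Rightarrow> real^2"
  assumes "L-lipschitz_on C f"
  shows "\<exists>L. L-lipschitz_on C (\<lambda>x. f x $ i)"
proof -
  have "L-lipschitz_on C (\<lambda>x. f x $ i)"
    by (rule lipschitz_onI)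
       (use dist_vec_nth_le lipschitz_onD[OF assms] lipschitz_on_nonneg[OF assms] order_trans in blast)+
  then show ?thesis ..
qed

lemma lipschitz_fst: "1-lipschitz_on C fst" and lipschitz_snd: "1-lipschitz_on C snd"
  by (rule lipschitz_onI; simp only: mult_1 dist_fst_le dist_snd_le zero_le_one)+

lemma lipschitz_smooth_fst:
  assumes "smooth_on S f" "compact C" "convex C" "fst ` C \<subseteq> S"
  shows "\<exists>L. L-lipschitz_on C (\<lambda>z. f (fst z :: real^2) :: real)"
proof -
  have "compact (fst ` C)" "convex (fst ` C)"
    using assms by (auto intro!: compact_continuous_image continuous_intros convex_linear_image linear_fst)
  then obtain L where "L-lipschitz_on (fst ` C) f" using smooth_on_lipschitz assms by metis
  then show ?thesis using lipschitz_on_compose2[OF lipschitz_fst] by blast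
qed

lemma lipschitz_smooth_snd:
  assumes "smooth_on S f" "compact C" "convex C" "snd ` C \<subseteq> S"
  shows "\<exists>L. L-lipschitz_on C (\<lambda>z. f (snd z :: real^2) :: real)"
proof -
  have "compact (snd ` C)" "convex (snd ` C)"
    using assms by (auto intro!: compact_continuous_image continuous_intros convex_linear_image linear_snd)
  then obtain L where "L-lipschitz_on (snd ` C) f" using smooth_on_lipschitz assms by metis
  then show ?thesis using lipschitz_on_compose2[OF lipschitz_snd] by blast
qed

definition vel_plus :: "(real^2 \<Rightarrow> real) \<Rightarrow> real^2 \<Rightarrow> real^2 \<Rightarrow> real^2" where
  "vel_plus Q a b = (1 / pi) *\<^sub>R (perp (a - b) /\<^sub>R (norm (a - b))\<^sup>2) + perp_grad Q a"

definition vel_minus :: "(real^2 \<Rightarrow> real) \<Rightarrow> real^2 \<Rightarrow> real^2 \<Rightarrow> real^2" where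
  "vel_minus Q a b = (1 / pi) *\<^sub>R (perp (a - b) /\<^sub>R (norm (a - b))\<^sup>2) - perp_grad Q b"

definition dipole_field :: "(real^2 \<Rightarrow> real) \<Rightarrow> (real^2) \<times> (real^2) \<Rightarrow> (real^2) \<times> (real^2)" where
  "dipole_field Q z = (vel_plus Q (fst z) (snd z), vel_minus Q (fst z) (snd z))"

lemma norm2_sq: "(norm (u :: real^2))\<^sup>2 = u$1 * u$1 + u$2 * u$2"
  by (simp add: power2_norm_eq_inner inner_vec_def sum_2)

lemma perp_nth [simp]: "perp u $ 1 = u $ 2" "perp u $ 2 = - (u $ 1)"
  by (simp_all add: perp_def)

lemma perp_grad_nth [simp]: "perp_grad w x $ 1 = partial 2 w x" "perp_grad w x $ 2 = - partial 1 w x"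
  by (simp_all add: perp_grad_def)

lemma grad_nth [simp]: "grad w x $ 1 = partial 1 w x" "grad w x $ 2 = partial 2 w x"
  by (simp_all add: grad_def)

text \<open>The components are written with \<open>inverse\<close>, products, sums and differences
  only, with \<open>b$1 - a$1\<close> in place of a negated difference, so that the Lipschitz rules
  match them term by term.\<close>

lemma vel_nth:
  "vel_plus Q a b $ 1 = 1 / pi * ((a$2 - b$2) * inverse ((norm (a - b))\<^sup>2)) + partial 2 Q a"
  "vel_plus Q a b $ 2 = 1 / pi * ((b$1 - a$1) * inverse ((norm (a - b))\<^sup>2)) - partial 1 Q a"
  "vel_minus Q a b $ 1 = 1 / pi * ((a$2 - b$2) * inverse ((norm (a - b))\<^sup>2)) - partial 2 Q b"
  "vel_minus Q a b $ 2 = 1 / pi * ((b$1 - a$1) * inverse ((norm (a - b))\<^sup>2)) + partial 1 Q b"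
  by (simp_all add: vel_plus_def vel_minus_def divide_inverse algebra_simps)

lemma lipschitz_coord:
  "\<exists>L. L-lipschitz_on C (\<lambda>z :: (real^2) \<times> (real^2). fst z $ i)"
  "\<exists>L. L-lipschitz_on C (\<lambda>z :: (real^2) \<times> (real^2). snd z $ i)"
  using lipschitz_nth_exists[OF lipschitz_fst] lipschitz_nth_exists[OF lipschitz_snd] by blast+

lemma lipschitz_inverse_dist_sq:
  assumes "compact C" "\<And>z. z \<in> C \<Longrightarrow> fst z \<noteq> snd z"
  shows "\<exists>L. L-lipschitz_on C (\<lambda>z :: (real^2) \<times> (real^2). inverse ((norm (fst z - snd z))\<^sup>2))"
proof (rule lipschitz_inverse_exists[OF assms(1)])
  show "\<exists>L. L-lipschitz_on C (\<lambda>z. (norm (fst z - snd z))\<^sup>2)"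
    unfolding norm2_sq vector_minus_component
    by (intro lipschitz_add_exists lipschitz_mult_exists lipschitz_diff_exists lipschitz_coord assms(1))
qed (use assms in simp)

lemma lipschitz_vel:
  assumes Q: "smooth_on UNIV Q" and C: "compact C" "convex C" "\<And>z. z \<in> C \<Longrightarrow> fst z \<noteq> snd z"
  shows "\<exists>L. L-lipschitz_on C (\<lambda>z. vel_plus Q (fst z) (snd z) $ i)"
    and "\<exists>L. L-lipschitz_on C (\<lambda>z. vel_minus Q (fst z) (snd z) $ i)"
proof -
  have part: "\<exists>L. L-lipschitz_on C (\<lambda>z. partial i Q (fst z))" "\<exists>L. L-lipschitz_on C (\<lambda>z. partial i Q (snd z))" for i
    using lipschitz_smooth_fst[OF smooth_on_partial[OF Q] C(1,2)]
      lipschitz_smooth_snd[OF smooth_on_partial[OF Q] C(1,2)] by auto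
  note lip = lipschitz_add_exists lipschitz_mult_exists[OF C(1)] lipschitz_diff_exists
    lipschitz_coord lipschitz_const_exists lipschitz_inverse_dist_sq[OF C(1,3)] part
  consider "i = 1" | "i = 2" using exhaust_2[of i] by blast
  then show "\<exists>L. L-lipschitz_on C (\<lambda>z. vel_plus Q (fst z) (snd z) $ i)"
    by cases (simp_all only: vel_nth, (intro lip; assumption)+)
  consider "i = 1" | "i = 2" using exhaust_2[of i] by blast
  then show "\<exists>L. L-lipschitz_on C (\<lambda>z. vel_minus Q (fst z) (snd z) $ i)"
    by cases (simp_all only: vel_nth, (intro lip; assumption)+)
qed

lemma lipschitz_vec2_exists:
  fixes f :: "'a::metric_space \<Rightarrow> real^2"
  assumes "\<And>i. \<exists>L. L-lipschitz_on C (\<lambda>x. f x $ i)"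
  shows "\<exists>L. L-lipschitz_on C f"
proof -
  obtain L M where L: "L-lipschitz_on C (\<lambda>x. f x $ 1)" and M: "M-lipschitz_on C (\<lambda>x. f x $ 2)"
    using assms by metis
  have "(L + M)-lipschitz_on C f"
  proof (rule lipschitz_onI)
    fix x y assume xy: "x \<in> C" "y \<in> C"
    have "dist (f x) (f y) \<le> dist (f x $ 1) (f y $ 1) + dist (f x $ 2) (f y $ 2)"
      using norm_le_l1_cart[of "f x - f y"] by (simp add: dist_norm sum_2)
    then show "dist (f x) (f y) \<le> (L + M) * dist x y"
      using lipschitz_onD[OF L xy] lipschitz_onD[OF M xy] by (simp add: algebra_simps)
  qed (use lipschitz_on_nonneg[OF L] lipschitz_on_nonneg[OF M] in auto)
  then show ?thesis ..
qed

lemma lipschitz_dipole_field: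
  assumes "smooth_on UNIV Q" "compact C" "convex C" "\<And>z. z \<in> C \<Longrightarrow> fst z \<noteq> snd z"
  shows "\<exists>L. L-lipschitz_on C (dipole_field Q)"
proof -
  have "\<exists>L. L-lipschitz_on C (\<lambda>z. vel_plus Q (fst z) (snd z))" "\<exists>L. L-lipschitz_on C (\<lambda>z. vel_minus Q (fst z) (snd z))"
    using lipschitz_vel[OF assms] by (auto intro!: lipschitz_vec2_exists)
  then show ?thesis unfolding dipole_field_def using lipschitz_on_Pair by blast
qed

lemma lipschitz_dipole_field_local:
  assumes "smooth_on UNIV Q" "fst z \<noteq> snd z"
  shows "\<exists>r>0. \<exists>L. L-lipschitz_on (cball z r) (dipole_field Q)"
proof -
  \<comment> \<open>One third of the separation: if each of the two points moves by at most r, a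
    distance of at least r remains between them.\<close>
  define r where "r = dist (fst z) (snd z) / 3"
  have "\<exists>L. L-lipschitz_on (cball z r) (dipole_field Q)"
  proof (rule lipschitz_dipole_field[OF assms(1)])
    fix w assume "w \<in> cball z r"
    then have le: "dist (fst z) (fst w) \<le> r" "dist (snd z) (snd w) \<le> r"
      using dist_fst_le[of z w] dist_snd_le[of z w] by auto
    show "fst w \<noteq> snd w"
    proof
      assume "fst w = snd w"
      then have "dist (fst z) (snd w) \<le> r" using le by metis
      then have "dist (fst z) (snd z) \<le> 2 * r"
        using dist_triangle2[of "fst z" "snd z" "snd w"] le(2) by linarith
      moreover have "dist (fst z) (snd z) > 0" using assms(2) by simp
      ultimately show False unfolding r_def by linarith
    qed
  qed auto
  moreover have "r > 0" using assms by (simp add: r_def)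
  ultimately show ?thesis by blast
qed

section \<open>Uniqueness, the maximal flow and exit times\<close>

text \<open>The set of times of agreement is closed in I. It is open because on a radius e with
  \<open>L * e < 1\<close> the mean value inequality bounds the maximal difference by
  \<open>L * e\<close> times itself. Connectedness of I does the rest.\<close>

lemma lipschitz_ode_unique:
  fixes Y Z :: "real \<Rightarrow> 'a::real_normed_vector"
  assumes I: "open I" "is_interval I" "t0 \<in> I" "Y t0 = Z t0"
    and Y: "\<And>s. s \<in> I \<Longrightarrow> (Y has_vector_derivative F (Y s)) (at s)"
    and Z: "\<And>s. s \<in> I \<Longrightarrow> (Z has_vector_derivative F (Z s)) (at s)"
    and F: "\<And>s. s \<in> I \<Longrightarrow> \<exists>r>0. \<exists>L. L-lipschitz_on (cball (Y s) r) F"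
    and s: "s \<in> I"
  shows "Y s = Z s"
proof -
  define T where "T = {s \<in> I. Y s - Z s = 0}"
  have isY: "isCont Y s" and isZ: "isCont Z s" if "s \<in> I" for s
    using Y[OF that] Z[OF that] has_vector_derivative_continuous by blast+
  have contE: "continuous_on I (\<lambda>s. Y s - Z s)"
    by (intro continuous_on_diff continuous_at_imp_continuous_on ballI isY isZ)
  have "closedin (top_of_set I) T"
    unfolding T_def by (rule continuous_closedin_preimage_constant[OF contE])
  moreover have "open T"
    unfolding open_contains_ball
  proof
    fix c assume "c \<in> T"
    then have c: "c \<in> I" "Y c = Z c" by (auto simp: T_def)
    obtain r L where r: "r > 0" and L: "L-lipschitz_on (cball (Y c) r) F" using F[OF c(1)] by auto
    obtain d1 where d1: "d1 > 0" "ball c d1 \<subseteq> I" using I(1) c(1) by (auto simp: open_contains_ball)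
    obtain d2 where d2: "d2 > 0" "\<And>t. dist t c < d2 \<Longrightarrow> dist (Y t) (Y c) < r"
      using isY[OF c(1)] r unfolding continuous_at_eps_delta by metis
    obtain d3 where d3: "d3 > 0" "\<And>t. dist t c < d3 \<Longrightarrow> dist (Z t) (Z c) < r"
      using isZ[OF c(1)] r unfolding continuous_at_eps_delta by metis
    have L0: "L \<ge> 0" using lipschitz_on_nonneg[OF L] .
    \<comment> \<open>Dividing by \<open>L + 1\<close> instead of L covers
      \<open>L = 0\<close>.\<close>
    define q where "q = 1 / (L + 1)"
    have "q > 0" using L0 by (simp add: q_def)
    define e where "e = min (min d1 d2) (min d3 q) / 2"
    have e: "e > 0" "e < d1" "e < d2" "e < d3" "e < q"
      using d1 d2 d3 \<open>q > 0\<close> by (auto simp: e_def min_def)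
    have eI: "cball c e \<subseteq> I" using d1 e by (auto simp: subset_iff)
    have eL: "L * e < 1"
    proof -
      have "(L + 1) * e < 1" using e(5) L0 by (simp add: q_def field_simps)
      then show ?thesis using e(1) by (simp add: algebra_simps)
    qed
    have "continuous_on (cball c e) (\<lambda>s. norm (Y s - Z s))"
      using continuous_on_subset[OF contE eI] by (rule continuous_on_norm)
    then obtain m where m: "m \<in> cball c e"
      "\<And>t. t \<in> cball c e \<Longrightarrow> norm (Y t - Z t) \<le> norm (Y m - Z m)"
      using continuous_attains_sup[of "cball c e" "\<lambda>s. norm (Y s - Z s)"] e(1) by auto
    have "norm ((Y m - Z m) - (Y c - Z c)) \<le> (L * norm (Y m - Z m)) * norm (m - c)"
    proof (rule differentiable_bound[of "cball c e" "\<lambda>t. Y t - Z t" "\<lambda>t h. h *\<^sub>R (F (Y t) - F (Z t))"])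
      fix t assume t: "t \<in> cball c e"
      then have tI: "t \<in> I" using eI by auto
      show "((\<lambda>t. Y t - Z t) has_derivative (\<lambda>h. h *\<^sub>R (F (Y t) - F (Z t)))) (at t within cball c e)"
        using has_vector_derivative_diff[OF Y[OF tI] Z[OF tI]] has_derivative_at_withinI
        unfolding has_vector_derivative_def by blast
      have "dist t c < d2" "dist t c < d3" using t e by (auto simp: dist_commute)
      then have "Y t \<in> cball (Y c) r" "Z t \<in> cball (Y c) r"
        using d2(2)[of t] d3(2)[of t] c(2) by (auto simp: dist_commute)
      then have "norm (F (Y t) - F (Z t)) \<le> L * norm (Y t - Z t)"
        using lipschitz_onD[OF L] by (simp add: dist_norm)
      also have "\<dots> \<le> L * norm (Y m - Z m)" using m(2)[OF t] L0 by (rule mult_left_mono)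
      finally show "onorm (\<lambda>h::real. h *\<^sub>R (F (Y t) - F (Z t))) \<le> L * norm (Y m - Z m)"
        by (intro onorm_le) (metis mult.commute mult_right_mono norm_ge_zero norm_scaleR real_norm_def)
    qed (use m e in auto)
    also have "\<dots> \<le> (L * norm (Y m - Z m)) * e"
      using m(1) L0 by (intro mult_left_mono) (auto simp: dist_norm norm_minus_commute)
    finally have "norm (Y m - Z m) * (1 - L * e) \<le> 0" using c(2) by (simp add: algebra_simps)
    then have "norm (Y m - Z m) = 0" using eL
      by (smt (verit) mult_pos_pos norm_ge_zero)
    then have "Y t = Z t" if "t \<in> cball c e" for t using m(2)[OF that] by simp
    then have "ball c e \<subseteq> T" using eI by (auto simp: T_def subset_iff)
    then show "\<exists>e>0. ball c e \<subseteq> T" using e(1) by blast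
  qed
  then have "openin (top_of_set I) T"
    using open_openin_trans I(1) T_def by (metis (no_types, lifting) mem_Collect_eq open_subset subsetI)
  moreover have "connected I" using I(2) by (simp add: is_interval_connected)
  ultimately have "T = {} \<or> T = I" unfolding connected_clopen by blast
  moreover have "t0 \<in> T" using I(3,4) by (simp add: T_def)
  ultimately have "s \<in> T" using s by blast
  then show ?thesis by (simp add: T_def)
qed

lemma dipole_solution_pair:
  assumes "dipole_solution Q x y J ap am" "s \<in> J"
  shows "((\<lambda>s. (ap s, am s)) has_vector_derivative dipole_field Q (ap s, am s)) (at s)"
  using assms unfolding dipole_solution_def dipole_field_def vel_plus_def vel_minus_def
  by (auto intro!: has_vector_derivative_Pair)

lemma dipole_solution_unique:
  assumes Q: "smooth_on UNIV Q"
    and S: "dipole_solution Q x y J ap am" and S': "dipole_solution Q x y J' ap' am'"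
    and s: "s \<in> J" "s \<in> J'"
  shows "ap s = ap' s \<and> am s = am' s"
proof -
  have "(ap s, am s) = (ap' s, am' s)"
  proof (rule lipschitz_ode_unique[of "J \<inter> J'" 0 "\<lambda>s. (ap s, am s)" "\<lambda>s. (ap' s, am' s)" "dipole_field Q"])
    show "open (J \<inter> J')" "is_interval (J \<inter> J')" "0 \<in> J \<inter> J'" "(ap 0, am 0) = (ap' 0, am' 0)"
      using S S' by (auto simp: dipole_solution_def is_interval_Int)
    fix t assume t: "t \<in> J \<inter> J'"
    show "\<exists>r>0. \<exists>L. L-lipschitz_on (cball (ap t, am t) r) (dipole_field Q)"
      by (rule lipschitz_dipole_field_local[OF Q]) (use S t in \<open>auto simp: dipole_solution_def\<close>)
  qed (use s dipole_solution_pair[OF S] dipole_solution_pair[OF S'] in auto)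
  then show ?thesis by simp
qed

text \<open>Uniqueness makes the definite description in \<open>dipole_flow\<close> well defined.
  This lemma is the passage from the maximal flow to a concrete solution.\<close>

lemma dipole_flow_eq:
  assumes "smooth_on UNIV Q" "dipole_solution Q x y J ap am" "s \<in> J"
  shows "a_plus Q s x y = ap s" "a_minus Q s x y = am s" "s \<in> dipole_domain Q x y"
proof -
  have "dipole_flow Q s x y = (ap s, am s)"
    unfolding dipole_flow_def
    by (rule the_equality) (use assms dipole_solution_unique[OF assms(1)] in blast)+
  then show "a_plus Q s x y = ap s" "a_minus Q s x y = am s"
    by (simp_all add: a_plus_def a_minus_def)
  show "s \<in> dipole_domain Q x y" using assms unfolding dipole_domain_def by blast
qed

text \<open>A finite exit time seen on one concrete solution whose interval contains
  \<open>{0..\<tau>}\<close>. The last clause makes \<tau> the infimum: exterior times accumulate at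
  \<tau> from the right or include it. Membership of \<open>ap \<tau>\<close> in the closure is left
  out, since for \<open>\<tau> = 0\<close> it concerns the starting point.\<close>

definition exit_solution ::
  "(real^2 \<Rightarrow> real) \<Rightarrow> (real^2) set \<Rightarrow> real^2 \<Rightarrow> real^2 \<Rightarrow> real set \<Rightarrow>
    (real \<Rightarrow> real^2) \<Rightarrow> (real \<Rightarrow> real^2) \<Rightarrow> real \<Rightarrow> bool" where
  "exit_solution Q \<Omega> x y J ap am \<tau> \<longleftrightarrow>
    dipole_solution Q x y J ap am \<and> 0 \<le> \<tau> \<and> {0..\<tau>} \<subseteq> J \<and>
    (\<forall>s\<in>{0..<\<tau>}. ap s \<in> closure \<Omega>) \<and>
    (\<forall>e>\<tau>. \<exists>s\<in>J. \<tau> \<le> s \<and> s < e \<and> ap s \<notin> closure \<Omega>)"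

text \<open>A finite infimum forces some exterior time \<open>s1\<close> in the maximal interval; a
  solution defined up to \<open>s1\<close> is defined on all of \<open>{0..\<tau>}\<close>.\<close>

lemma exit_time_solution:
  assumes Q: "smooth_on UNIV Q" and fin: "exit_time Q \<Omega> x y < \<infinity>"
  obtains J ap am \<tau> where "exit_solution Q \<Omega> x y J ap am \<tau>" "exit_time Q \<Omega> x y = ereal \<tau>"
proof -
  define S where "S = {s. 0 \<le> s \<and> s \<in> dipole_domain Q x y \<and> a_plus Q s x y \<notin> closure \<Omega>}"
  have "S \<noteq> {}" using fin by (intro notI) (simp add: exit_time_def S_def[symmetric] top_ereal_def)
  then obtain s1 where s1: "s1 \<in> S" by auto
  then obtain J ap am where sol: "dipole_solution Q x y J ap am" "s1 \<in> J"
    by (auto simp: S_def dipole_domain_def)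
  note flow = dipole_flow_eq[OF Q sol(1)]
  have bdd: "bdd_below S" by (auto simp: S_def bdd_below_def)
  define \<tau> where "\<tau> = Inf S"
  have \<tau>0: "0 \<le> \<tau>" unfolding \<tau>_def by (rule cInf_greatest) (use s1 in \<open>auto simp: S_def\<close>)
  have \<tau>1: "\<tau> \<le> s1" unfolding \<tau>_def by (rule cInf_lower[OF s1 bdd])
  have "is_interval J" "0 \<in> J" using sol by (auto simp: dipole_solution_def)
  then have "{0..s1} \<subseteq> J" using sol(2) unfolding is_interval_1 by (meson atLeastAtMost_iff subsetI)
  then have J: "{0..\<tau>} \<subseteq> J" using \<tau>1 by auto
  have ext: "exit_time Q \<Omega> x y = ereal \<tau>"
    unfolding exit_time_def S_def[symmetric] \<tau>_def
    by (rule ereal_Inf'[OF bdd \<open>S \<noteq> {}\<close>, symmetric])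
  have "ap s \<in> closure \<Omega>" if s: "s \<in> {0..<\<tau>}" for s
  proof (rule ccontr)
    assume "ap s \<notin> closure \<Omega>"
    moreover have "s \<in> J" using s J by auto
    ultimately have "s \<in> S" using s flow[of s] by (auto simp: S_def)
    then show False using cInf_lower[OF _ bdd] s by (force simp: \<tau>_def)
  qed
  moreover have "\<exists>s\<in>J. \<tau> \<le> s \<and> s < e \<and> ap s \<notin> closure \<Omega>" if "\<tau> < e" for e
  proof -
    have "open J" "\<tau> \<in> J" using sol J \<tau>0 by (auto simp: dipole_solution_def)
    then obtain d where d: "d > 0" "ball \<tau> d \<subseteq> J" by (auto simp: open_contains_ball)
    have "Inf S < min e (\<tau> + d)" using that d(1) by (simp add: \<tau>_def)
    then obtain s where s: "s \<in> S" "s < min e (\<tau> + d)" using cInf_lessD[OF \<open>S \<noteq> {}\<close>] by blast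
    have "\<tau> \<le> s" unfolding \<tau>_def by (rule cInf_lower[OF s(1) bdd])
    then have "s \<in> J" using s(2) d(2) by (auto simp: subset_iff dist_real_def)
    then show ?thesis using s \<open>\<tau> \<le> s\<close> flow[of s] by (auto simp: S_def)
  qed
  ultimately have "exit_solution Q \<Omega> x y J ap am \<tau>"
    using sol(1) \<tau>0 J unfolding exit_solution_def by blast
  then show thesis using ext that by blast
qed

lemma dipole_solution_isCont:
  assumes "dipole_solution Q x y J ap am" "s \<in> J"
  shows "isCont ap s" "isCont am s"
  using assms has_vector_derivative_continuous unfolding dipole_solution_def by blast+

lemma exit_solution_closure:
  assumes e: "exit_solution Q \<Omega> x y J ap am \<tau>" and \<tau>: "0 < \<tau>" and s: "s \<in> {0..\<tau>}"
  shows "ap s \<in> closure \<Omega>"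
proof (cases "s = \<tau>")
  case True
  have "\<tau> \<in> J" using e \<tau> unfolding exit_solution_def by auto
  then have "isCont ap \<tau>"
    using e dipole_solution_isCont unfolding exit_solution_def by blast
  then have "(ap \<longlongrightarrow> ap \<tau>) (at_left \<tau>)"
    unfolding isCont_def by (rule tendsto_within_subset) auto
  moreover have "\<forall>\<^sub>F s in at_left \<tau>. ap s \<in> closure \<Omega>"
    using eventually_at_left_real[OF \<tau>]
    by eventually_elim (use e in \<open>auto simp: exit_solution_def\<close>)
  ultimately show ?thesis
    unfolding True by (intro Lim_in_closed_set[OF closed_closure _ trivial_limit_at_left_real])
next
  case False
  then show ?thesis using e s unfolding exit_solution_def by auto
qed

section \<open>Normal velocity and the boundary\<close>

text \<open>The time derivative of \<rho> along a_+, as a function on phase space. For a starting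
  point on the boundary its zeros are the tangential starts.\<close>

definition normal_rate :: "(real^2 \<Rightarrow> real) \<Rightarrow> (real^2 \<Rightarrow> real) \<Rightarrow> (real^2) \<times> (real^2) \<Rightarrow> real" where
  "normal_rate \<rho> Q z =
    vel_plus Q (fst z) (snd z) $ 1 * partial 1 \<rho> (fst z) + vel_plus Q (fst z) (snd z) $ 2 * partial 2 \<rho> (fst z)"

definition vel_diff :: "(real^2 \<Rightarrow> real) \<Rightarrow> (real^2) \<times> (real^2) \<Rightarrow> 2 \<Rightarrow> real" where
  "vel_diff Q z i = vel_plus Q (fst z) (snd z) $ i - vel_minus Q (fst z) (snd z) $ i"

text \<open>The derivative of \<open>normal_rate\<close> along the flow, in coordinates.\<close>

definition normal_accel :: "(real^2 \<Rightarrow> real) \<Rightarrow> (real^2 \<Rightarrow> real) \<Rightarrow> (real^2) \<times> (real^2) \<Rightarrow> real" where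
  "normal_accel \<rho> Q z =
    (1 / pi * (vel_diff Q z 2 * inverse ((norm (fst z - snd z))\<^sup>2)
        - (fst z $ 2 - snd z $ 2) * (2 * ((fst z $ 1 - snd z $ 1) * vel_diff Q z 1 + (fst z $ 2 - snd z $ 2) * vel_diff Q z 2))
          * (inverse ((norm (fst z - snd z))\<^sup>2) * inverse ((norm (fst z - snd z))\<^sup>2)))
      + (vel_plus Q (fst z) (snd z) $ 1 * partial 1 (partial 2 Q) (fst z)
        + vel_plus Q (fst z) (snd z) $ 2 * partial 2 (partial 2 Q) (fst z))) * partial 1 \<rho> (fst z)
    + (1 / pi * ((snd z $ 1 - fst z $ 1) * (2 * ((fst z $ 1 - snd z $ 1) * vel_diff Q z 1 + (fst z $ 2 - snd z $ 2) * vel_diff Q z 2))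
          * (inverse ((norm (fst z - snd z))\<^sup>2) * inverse ((norm (fst z - snd z))\<^sup>2)) * (-1)
        - vel_diff Q z 1 * inverse ((norm (fst z - snd z))\<^sup>2))
      - (vel_plus Q (fst z) (snd z) $ 1 * partial 1 (partial 1 Q) (fst z)
        + vel_plus Q (fst z) (snd z) $ 2 * partial 2 (partial 1 Q) (fst z))) * partial 2 \<rho> (fst z)
    + (vel_plus Q (fst z) (snd z) $ 1 *
        (vel_plus Q (fst z) (snd z) $ 1 * partial 1 (partial 1 \<rho>) (fst z)
          + vel_plus Q (fst z) (snd z) $ 2 * partial 2 (partial 1 \<rho>) (fst z))
      + vel_plus Q (fst z) (snd z) $ 2 *
        (vel_plus Q (fst z) (snd z) $ 1 * partial 1 (partial 2 \<rho>) (fst z)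
          + vel_plus Q (fst z) (snd z) $ 2 * partial 2 (partial 2 \<rho>) (fst z)))"

text \<open>This is what the expanded formula for \<open>normal_accel\<close> serves: it is a
  polynomial in factors already known to be Lipschitz on C, so the closure rules suffice.\<close>

lemma lipschitz_normal:
  assumes Q: "smooth_on UNIV Q" and \<rho>: "smooth_on V \<rho>"
    and C: "compact C" "convex C" "\<And>z. z \<in> C \<Longrightarrow> fst z \<noteq> snd z" "fst ` C \<subseteq> V"
  shows "\<exists>L. L-lipschitz_on C (normal_rate \<rho> Q)" "\<exists>L. L-lipschitz_on C (normal_accel \<rho> Q)"
proof -
  note Q1 = smooth_on_partial[OF Q] and \<rho>1 = smooth_on_partial[OF \<rho>]
  have partQ: "\<exists>L. L-lipschitz_on C (\<lambda>z. partial i (partial j Q) (fst z))" for i j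
    using lipschitz_smooth_fst[OF smooth_on_partial[OF Q1] C(1,2)] by auto
  note part\<rho> = lipschitz_smooth_fst[OF \<rho>1 C(1,2,4)] lipschitz_smooth_fst[OF smooth_on_partial[OF \<rho>1] C(1,2,4)]
  have vd: "\<exists>L. L-lipschitz_on C (\<lambda>z. vel_diff Q z i)" for i
    unfolding vel_diff_def by (intro lipschitz_diff_exists lipschitz_vel[OF Q C(1-3)])
  note lip = lipschitz_add_exists lipschitz_mult_exists[OF C(1)] lipschitz_diff_exists
    lipschitz_coord lipschitz_const_exists lipschitz_inverse_dist_sq[OF C(1,3)] partQ part\<rho> vd
    lipschitz_vel[OF Q C(1-3)]
  show "\<exists>L. L-lipschitz_on C (normal_rate \<rho> Q)"
    unfolding normal_rate_def[abs_def] by (intro lip; assumption)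
  show "\<exists>L. L-lipschitz_on C (normal_accel \<rho> Q)"
    unfolding normal_accel_def[abs_def] by (intro lip; assumption)
qed

lemma normal_derivatives:
  assumes sol: "dipole_solution Q x y J ap am" and s: "s \<in> J" "ap s \<in> V"
    and Q: "smooth_on UNIV Q" and \<rho>: "smooth_on V \<rho>"
  shows "((\<lambda>t. \<rho> (ap t)) has_real_derivative normal_rate \<rho> Q (ap s, am s)) (at s)"
    and "((\<lambda>t. normal_rate \<rho> Q (ap t, am t)) has_real_derivative normal_accel \<rho> Q (ap s, am s)) (at s)"
proof -
  have dp: "(ap has_vector_derivative vel_plus Q (ap s) (am s)) (at s)"
    and dm: "(am has_vector_derivative vel_minus Q (ap s) (am s)) (at s)"
    and ne: "ap s \<noteq> am s"
    using sol s(1) unfolding dipole_solution_def vel_plus_def vel_minus_def by auto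
  show "((\<lambda>t. \<rho> (ap t)) has_real_derivative normal_rate \<rho> Q (ap s, am s)) (at s)"
    using smooth_on_curve[OF \<rho> s(2) dp] by (simp add: normal_rate_def)
  have p: "((\<lambda>t. ap t $ i) has_real_derivative vel_plus Q (ap s) (am s) $ i) (at s)" for i
    using bounded_linear.has_vector_derivative[OF bounded_linear_vec_nth dp]
    by (simp add: has_real_derivative_iff_has_vector_derivative)
  have m: "((\<lambda>t. am t $ i) has_real_derivative vel_minus Q (ap s) (am s) $ i) (at s)" for i
    using bounded_linear.has_vector_derivative[OF bounded_linear_vec_nth dm]
    by (simp add: has_real_derivative_iff_has_vector_derivative)
  have dQ: "((\<lambda>t. partial i Q (ap t)) has_real_derivative
      vel_plus Q (ap s) (am s) $ 1 * partial 1 (partial i Q) (ap s) + vel_plus Q (ap s) (am s) $ 2 * partial 2 (partial i Q) (ap s)) (at s)" for i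
    by (rule smooth_on_curve[OF smooth_on_partial[OF Q] _ dp]) simp
  have d\<rho>: "((\<lambda>t. partial i \<rho> (ap t)) has_real_derivative
      vel_plus Q (ap s) (am s) $ 1 * partial 1 (partial i \<rho>) (ap s) + vel_plus Q (ap s) (am s) $ 2 * partial 2 (partial i \<rho>) (ap s)) (at s)" for i
    by (rule smooth_on_curve[OF smooth_on_partial[OF \<rho>] s(2) dp])
  define w where "w = (\<lambda>i. vel_diff Q (ap s, am s) i)"
  have e: "((\<lambda>t. ap t $ i - am t $ i) has_real_derivative w i) (at s)" for i
    using DERIV_diff[OF p m, of i i] by (simp add: w_def vel_diff_def)
  define R where "R = inverse ((norm (ap s - am s))\<^sup>2)"
  define N where "N = (\<lambda>t. (norm (ap t - am t))\<^sup>2)"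
  have N: "(N has_real_derivative (2 * ((ap s $ 1 - am s $ 1) * w 1 + (ap s $ 2 - am s $ 2) * w 2))) (at s)"
    unfolding N_def norm2_sq vector_minus_component
    by (rule derivative_eq_intros e refl)+ (simp add: algebra_simps)
  have "N s \<noteq> 0" using ne by (simp add: N_def)
  from DERIV_inverse'[OF N this]
  have R: "((\<lambda>t. inverse (N t)) has_real_derivative
      - (2 * ((ap s $ 1 - am s $ 1) * w 1 + (ap s $ 2 - am s $ 2) * w 2) * (R * R))) (at s)"
    by (simp add: R_def N_def algebra_simps)
  have e': "((\<lambda>t. am t $ 1 - ap t $ 1) has_real_derivative - w 1) (at s)"
    using DERIV_minus[OF e[of 1]] by simp
  have v1: "((\<lambda>t. vel_plus Q (ap t) (am t) $ 1) has_real_derivative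
      (1 / pi * (w 2 * R - (ap s $ 2 - am s $ 2) * (2 * ((ap s $ 1 - am s $ 1) * w 1 + (ap s $ 2 - am s $ 2) * w 2)) * (R * R))
      + (vel_plus Q (ap s) (am s) $ 1 * partial 1 (partial 2 Q) (ap s) + vel_plus Q (ap s) (am s) $ 2 * partial 2 (partial 2 Q) (ap s)))) (at s)"
    unfolding vel_nth N_def[symmetric, THEN fun_cong]
    using DERIV_add[OF DERIV_cmult[OF DERIV_mult[OF e[of 2] R], of "1/pi"] dQ[of 2]]
    by (simp add: N_def R_def vel_nth algebra_simps)
  have v2: "((\<lambda>t. vel_plus Q (ap t) (am t) $ 2) has_real_derivative
      (1 / pi * ((am s $ 1 - ap s $ 1) * (2 * ((ap s $ 1 - am s $ 1) * w 1 + (ap s $ 2 - am s $ 2) * w 2)) * (R * R) * (-1) - w 1 * R)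
      - (vel_plus Q (ap s) (am s) $ 1 * partial 1 (partial 1 Q) (ap s) + vel_plus Q (ap s) (am s) $ 2 * partial 2 (partial 1 Q) (ap s)))) (at s)"
    unfolding vel_nth N_def[symmetric, THEN fun_cong]
    using DERIV_diff[OF DERIV_cmult[OF DERIV_mult[OF e' R], of "1/pi"] dQ[of 1]]
    by (simp add: N_def R_def vel_nth algebra_simps)
  have "((\<lambda>t. vel_plus Q (ap t) (am t) $ 1 * partial 1 \<rho> (ap t) + vel_plus Q (ap t) (am t) $ 2 * partial 2 \<rho> (ap t))
      has_real_derivative normal_accel \<rho> Q (ap s, am s)) (at s)"
    by (rule DERIV_cong[OF DERIV_add[OF DERIV_mult[OF v1 d\<rho>[of 1]] DERIV_mult[OF v2 d\<rho>[of 2]]]])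
       (simp add: normal_accel_def w_def R_def)
  then show "((\<lambda>t. normal_rate \<rho> Q (ap t, am t)) has_real_derivative normal_accel \<rho> Q (ap s, am s)) (at s)"
    by (simp add: normal_rate_def)
qed

section \<open>Inversion and the choice of the second vortex\<close>

text \<open>Inversion in the unit circle, with value 0 at 0. Up to the factor \<open>1 / pi\<close>,
  the interaction velocity is \<open>perp\<close> of the inversion of \<open>a - b\<close>.\<close>

definition inversion :: "real^2 \<Rightarrow> real^2" where
  "inversion u = u /\<^sub>R (norm u)\<^sup>2"

lemma norm_inversion: "norm (inversion u) = inverse (norm u)"
  by (cases "u = 0") (simp_all add: inversion_def power2_eq_square field_simps)

lemma inversion_scaleR: "inversion (c *\<^sub>R u) = inverse c *\<^sub>R inversion u"
proof -
  have "(norm (c *\<^sub>R u))\<^sup>2 = c * c * (norm u)\<^sup>2"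
    by (simp add: power_mult_distrib) (simp add: power2_eq_square)
  then show ?thesis
    by (cases "c = 0") (simp_all add: inversion_def del: norm_scaleR)
qed

lemma inversion_involution [simp]: "inversion (inversion u) = u"
  by (cases "u = 0") (simp_all add: inversion_def power2_eq_square field_simps)

lemma inversion_eq_0_iff [simp]: "inversion u = 0 \<longleftrightarrow> u = 0"
  by (simp add: inversion_def)

text \<open>Expand both squared norms by the law of cosines; the inner product of the inverted
  vectors is that of u and v over the product of the squared norms.\<close>

lemma norm_inversion_diff:
  assumes "u \<noteq> 0" "v \<noteq> 0"
  shows "norm (inversion u - inversion v) = norm (u - v) / (norm u * norm v)"
proof -
  have "(norm (inversion u - inversion v))\<^sup>2 = (norm (u - v) / (norm u * norm v))\<^sup>2"
  proof -
    have sq: "(norm (x - y))\<^sup>2 = (norm x)\<^sup>2 - 2 * (x \<bullet> y) + (norm y)\<^sup>2" for x y :: "real^2"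
      by (simp add: power2_norm_eq_inner inner_diff_left inner_diff_right inner_commute[of y x])
    have "(norm (inversion u - inversion v))\<^sup>2
        = (inverse (norm u))\<^sup>2 - 2 * ((u \<bullet> v) / ((norm u)\<^sup>2 * (norm v)\<^sup>2)) + (inverse (norm v))\<^sup>2"
      unfolding sq norm_inversion by (simp add: inversion_def divide_inverse)
    also have "\<dots> = ((norm u)\<^sup>2 - 2 * (u \<bullet> v) + (norm v)\<^sup>2) / ((norm u)\<^sup>2 * (norm v)\<^sup>2)"
      using assms by (simp add: field_simps)
    also have "\<dots> = (norm (u - v) / (norm u * norm v))\<^sup>2"
      unfolding sq[symmetric] by (simp add: power_divide power_mult_distrib)
    finally show ?thesis .
  qed
  then show ?thesis by (subst (asm) power2_eq_iff_nonneg) auto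
qed

lemma perp_scaleR: "perp (c *\<^sub>R u) = c *\<^sub>R perp u" and perp_add: "perp (u + v) = perp u + perp v"
  and perp_perp: "perp (perp u) = - u"
  by (simp_all add: vec_eq_iff forall_2)

lemma perp_grad_eq: "perp_grad Q a = perp (grad Q a)"
  by (simp add: vec_eq_iff forall_2)

lemma vel_plus_inversion: "vel_plus Q a b = perp ((1 / pi) *\<^sub>R inversion (a - b) + grad Q a)"
  by (simp add: vel_plus_def perp_grad_eq perp_add perp_scaleR inversion_def)

lemma normal_rate_eq: "normal_rate \<rho> Q (a, b) = grad \<rho> a \<bullet> vel_plus Q a b"
  by (simp add: normal_rate_def inner_vec_def sum_2 algebra_simps)

text \<open>In the variable \<open>inversion (a - b)\<close> the velocity is affine, so a prescribed normal component
  can be reached explicitly by moving \<open>b\<close>.\<close>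

lemma adjust_normal_rate:
  assumes ab: "a \<noteq> b" "norm (a - b) \<le> R" and c: "0 < c" "c \<le> norm (grad \<rho> a)"
    and t: "\<bar>t - normal_rate \<rho> Q (a, b)\<bar> \<le> c / (2 * pi * R)"
  shows "\<exists>b'. a \<noteq> b' \<and> normal_rate \<rho> Q (a, b') = t \<and>
    dist b' b \<le> 2 * pi * R\<^sup>2 / c * \<bar>t - normal_rate \<rho> Q (a, b)\<bar>"
proof -
  define D where "D = t - normal_rate \<rho> Q (a, b)"
  define N where "N = grad \<rho> a"
  \<comment> \<open>Chosen so that \<open>perp \<theta>\<close> is
    \<open>(D / (norm N)\<^sup>2) *\<^sub>R N\<close>, the shortest vector whose product with N is
    D.\<close>
  define \<theta> where "\<theta> = (- (D / (norm N)\<^sup>2)) *\<^sub>R perp N"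
  define A where "A = inversion (a - b)"
  define B where "B = A + pi *\<^sub>R \<theta>"
  define b' where "b' = a - inversion B"
  have R: "R > 0" using ab by (smt (verit) zero_less_norm_iff right_minus_eq)
  have N: "norm N > 0" "N \<noteq> 0" using c by (auto simp: N_def)
  have normperp: "norm (perp N) = norm N" by (simp add: norm_eq_sqrt_inner inner_vec_def sum_2)
  have "norm \<theta> = \<bar>D\<bar> / norm N"
    using N by (simp add: \<theta>_def normperp power2_eq_square)
  also have "\<dots> \<le> \<bar>D\<bar> / c" using c N by (intro divide_left_mono) (auto simp: N_def)
  finally have th: "norm \<theta> \<le> \<bar>D\<bar> / c" .
  have A: "norm A \<ge> 1 / R" "A \<noteq> 0"
    using ab R by (auto simp: A_def norm_inversion inverse_eq_divide intro!: divide_left_mono)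
  \<comment> \<open>The tolerance \<open>c / (2 * pi * R)\<close> keeps the correction below half of
    \<open>1 / R\<close>, a lower bound for the norm of A. Hence B is bounded away from 0 and its
    inversion \<open>a - b'\<close> stays under control.\<close>
  have "pi * norm \<theta> \<le> pi * (\<bar>D\<bar> / c)" using th by (intro mult_left_mono) auto
  also have "\<dots> \<le> pi * ((c / (2 * pi * R)) / c)"
    using t c by (intro mult_left_mono divide_right_mono) (auto simp: D_def)
  also have "\<dots> = 1 / (2 * R)" using c by (simp add: field_simps)
  finally have pth: "pi * norm \<theta> \<le> 1 / (2 * R)" .
  have "norm B \<ge> norm A - norm (pi *\<^sub>R \<theta>)"
    unfolding B_def by (metis norm_diff_ineq)
  moreover have "1 / (2 * R) = 1 / R - 1 / (2 * R)" by (simp add: field_simps)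
  ultimately have B: "norm B \<ge> 1 / (2 * R)" using A(1) pth by simp
  moreover have "1 / (2 * R) > 0" using R by simp
  ultimately have B0: "B \<noteq> 0" by auto
  have ib: "inversion (a - b') = B" by (simp add: b'_def)
  have "vel_plus Q a b' = perp ((1 / pi) *\<^sub>R A + grad Q a) + perp \<theta>"
    by (simp add: vel_plus_inversion ib B_def perp_add[symmetric] algebra_simps)
  also have "\<dots> = vel_plus Q a b + (D / (norm N)\<^sup>2) *\<^sub>R N"
    by (simp only: vel_plus_inversion A_def \<theta>_def perp_scaleR perp_perp) simp
  finally have "normal_rate \<rho> Q (a, b') = normal_rate \<rho> Q (a, b) + D"
    using N by (simp add: normal_rate_eq N_def[symmetric] inner_add_right dot_square_norm)
  then have 1: "normal_rate \<rho> Q (a, b') = t" by (simp add: D_def)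
  have "b' - b = inversion A - inversion B" by (simp add: b'_def A_def)
  then have "dist b' b = norm (inversion A - inversion B)" by (simp add: dist_norm)
  also have "\<dots> = pi * norm \<theta> / (norm A * norm B)"
    using norm_inversion_diff[OF A(2) B0] by (simp add: B_def)
  also have "\<dots> \<le> pi * (\<bar>D\<bar> / c) / (1 / R * (1 / (2 * R)))"
    using th A(1) B R c by (intro frac_le mult_left_mono mult_mono mult_pos_pos mult_nonneg_nonneg) auto
  also have "\<dots> = 2 * pi * R\<^sup>2 / c * \<bar>D\<bar>" by (simp add: power2_eq_square)
  finally have 2: "dist b' b \<le> 2 * pi * R\<^sup>2 / c * \<bar>D\<bar>" .
  have "a \<noteq> b'" using B0 ib by (auto simp: inversion_def)
  with 1 2 show ?thesis by (auto simp: D_def)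
qed

text \<open>The tangency condition confines \<open>q\<close> to a circle through \<open>p\<close> that meets the boundary
  orthogonally; the points used here run along it towards \<open>p\<close>.\<close>

lemma tangent_start_exists:
  assumes \<rho>: "smooth_on V \<rho>" "open V" "p \<in> V" "\<rho> p = 0" "grad \<rho> p \<noteq> 0" and \<eta>: "0 < \<eta>"
  shows "\<exists>q. dist q p < \<eta> \<and> q \<noteq> p \<and> q \<in> V \<and> 0 < \<rho> q \<and> normal_rate \<rho> Q (p, q) = 0"
proof -
  define N G where "N = grad \<rho> p" and "G = grad Q p"
  have N: "norm N > 0" using \<rho> by (simp add: N_def)
  \<comment> \<open>The vector \<open>(1 / pi) *\<^sub>R inversion (p - q) + G\<close> must be
    parallel to N, its \<open>perp\<close> then being tangent. Prescribing
    \<open>(- 1 / \<epsilon>) *\<^sub>R N\<close> and solving for q by a further inversion gives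
    this family, which tends to p as \<epsilon> decreases to 0.\<close>
  define m where "m = (\<lambda>\<epsilon>::real. N + \<epsilon> *\<^sub>R G)"
  define q where "q = (\<lambda>\<epsilon>. p + (\<epsilon> / pi) *\<^sub>R inversion (m \<epsilon>))"
  have "(\<rho> has_derivative (\<lambda>h. h$1 * partial 1 \<rho> p + h$2 * partial 2 \<rho> p)) (at p)"
    by (rule smooth_on_has_derivative[OF \<rho>(1,3)])
  then have "(\<rho> has_derivative (\<lambda>h. N \<bullet> h)) (at p)"
    by (simp add: N_def inner_vec_def sum_2 mult.commute)
  then obtain d where d: "d > 0"
    "\<And>y. norm (y - p) < d \<Longrightarrow> norm (\<rho> y - \<rho> p - N \<bullet> (y - p)) \<le> norm N / 2 * norm (y - p)"
    using N unfolding has_derivative_at_alt by (metis half_gt_zero)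
  obtain d' where d': "d' > 0" "ball p d' \<subseteq> V" using \<rho>(2,3) by (auto simp: open_contains_ball)
  have m: "(m \<longlongrightarrow> N) (at_right 0)"
    unfolding m_def by (auto intro!: tendsto_eq_intros)
  have "(q \<longlongrightarrow> p + (0 / pi) *\<^sub>R inversion N) (at_right 0)"
    unfolding q_def inversion_def using N by (intro tendsto_intros m) auto
  then have q: "(q \<longlongrightarrow> p) (at_right 0)" by simp
  have ev1: "\<forall>\<^sub>F \<epsilon> in at_right 0. dist (q \<epsilon>) p < min (min d d') \<eta>"
    by (rule tendstoD[OF q]) (use d(1) d'(1) \<eta> in auto)
  \<comment> \<open>\<open>q \<epsilon> - p\<close> is a positive multiple of
    \<open>m \<epsilon>\<close>, hence asymptotically normal. Its normal component then beats the
    error \<open>norm N / 2 * norm (q \<epsilon> - p)\<close> of the linear approximation, which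
    puts \<open>q \<epsilon>\<close> outside.\<close>
  have "((\<lambda>\<epsilon>. N \<bullet> m \<epsilon> - norm N / 2 * norm (m \<epsilon>)) \<longlongrightarrow> N \<bullet> N - norm N / 2 * norm N) (at_right 0)"
    by (intro tendsto_intros m)
  moreover have "N \<bullet> N - norm N / 2 * norm N > 0"
    using N by (simp add: dot_square_norm power2_eq_square)
  ultimately have ev2: "\<forall>\<^sub>F \<epsilon> in at_right 0. N \<bullet> m \<epsilon> - norm N / 2 * norm (m \<epsilon>) > 0"
    by (rule order_tendstoD)
  have ev3: "\<forall>\<^sub>F \<epsilon> in at_right (0::real). \<epsilon> > 0" by (simp add: eventually_at_right_less)
  obtain \<epsilon> where \<epsilon>: "\<epsilon> > 0" "dist (q \<epsilon>) p < min (min d d') \<eta>" "N \<bullet> m \<epsilon> > norm N / 2 * norm (m \<epsilon>)"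
    using eventually_happens[OF eventually_conj[OF ev1 eventually_conj[OF ev2 ev3]]] by auto
  have m0: "m \<epsilon> \<noteq> 0" using \<epsilon>(3) by auto
  have qp: "q \<epsilon> - p = (\<epsilon> / pi) *\<^sub>R inversion (m \<epsilon>)" by (simp add: q_def)
  have ne: "q \<epsilon> \<noteq> p" using qp m0 \<epsilon>(1) by (metis divide_eq_0_iff inversion_eq_0_iff less_irrefl pi_neq_zero right_minus_eq scaleR_eq_0_iff)
  have "N \<bullet> (q \<epsilon> - p) = (\<epsilon> / pi) / (norm (m \<epsilon>))\<^sup>2 * (N \<bullet> m \<epsilon>)"
    by (simp add: qp inversion_def divide_inverse)
  also have "\<dots> > (\<epsilon> / pi) / (norm (m \<epsilon>))\<^sup>2 * (norm N / 2 * norm (m \<epsilon>))"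
    using \<epsilon> m0 by (intro mult_strict_left_mono) auto
  also have "(\<epsilon> / pi) / (norm (m \<epsilon>))\<^sup>2 * (norm N / 2 * norm (m \<epsilon>)) = norm N / 2 * norm (q \<epsilon> - p)"
    using m0 \<epsilon>(1) by (simp add: qp norm_inversion power2_eq_square field_simps)
  finally have lower: "norm N / 2 * norm (q \<epsilon> - p) < N \<bullet> (q \<epsilon> - p)" .
  have "\<bar>\<rho> (q \<epsilon>) - \<rho> p - N \<bullet> (q \<epsilon> - p)\<bar> \<le> norm N / 2 * norm (q \<epsilon> - p)"
    using d(2)[of "q \<epsilon>"] \<epsilon>(2) by (simp add: dist_norm)
  then have "\<rho> (q \<epsilon>) > 0" using lower \<rho>(4) unfolding abs_le_iff by linarith
  moreover have "normal_rate \<rho> Q (p, q \<epsilon>) = 0"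
  proof -
    have "p - q \<epsilon> = (- \<epsilon> / pi) *\<^sub>R inversion (m \<epsilon>)" by (simp add: q_def)
    then have "inversion (p - q \<epsilon>) = (- pi / \<epsilon>) *\<^sub>R m \<epsilon>"
      by (simp only: inversion_scaleR inversion_involution) (simp add: divide_inverse)
    then have "vel_plus Q p (q \<epsilon>) = perp ((- 1 / \<epsilon>) *\<^sub>R m \<epsilon> + G)"
      by (simp add: vel_plus_inversion G_def)
    also have "(- 1 / \<epsilon>) *\<^sub>R m \<epsilon> + G = (- 1 / \<epsilon>) *\<^sub>R N"
      using \<epsilon>(1) by (simp add: m_def algebra_simps)
    finally show ?thesis
      by (simp add: normal_rate_eq N_def[symmetric] perp_scaleR) (simp add: inner_vec_def sum_2)
  qed
  ultimately show ?thesis using \<epsilon>(2) ne d'(2) by (auto simp: dist_commute subset_iff)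
qed

section \<open>Boundary points of a defining function\<close>

text \<open>At a zero of \<rho> a short step against the nonvanishing gradient lands in \<Omega>, so
  zeros are limits of interior points; a positive value persists nearby by continuity.\<close>

lemma defining_function_closure:
  assumes d: "defining_function \<Omega> x V \<rho>" and z: "z \<in> V"
  shows "z \<in> closure \<Omega> \<longleftrightarrow> \<rho> z \<le> 0"
proof
  have V: "open V" "smooth_on V \<rho>" and gr: "grad \<rho> z \<noteq> 0" and \<Omega>: "\<Omega> \<inter> V = {z \<in> V. \<rho> z < 0}"
    using d z by (auto simp: defining_function_def)
  have cont: "isCont \<rho> z" using smooth_on_isCont[OF V(2) z] .
  {
    assume zc: "z \<in> closure \<Omega>"
    show "\<rho> z \<le> 0"
    proof (rule ccontr)
      assume "\<not> \<rho> z \<le> 0"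
      then have "\<forall>\<^sub>F y in at z. \<rho> y > 0" using cont unfolding isCont_def by (intro order_tendstoD) auto
      then have "\<forall>\<^sub>F y in nhds z. \<rho> y > 0" using \<open>\<not> \<rho> z \<le> 0\<close> by (simp add: eventually_at_filter eventually_mono[rotated])
          (auto elim!: eventually_mono)
      moreover have "\<forall>\<^sub>F y in nhds z. y \<in> V" using V(1) z by (rule eventually_nhds_in_open)
      ultimately have "\<forall>\<^sub>F y in nhds z. y \<notin> \<Omega>"
        by eventually_elim (use \<Omega> in force)
      then obtain S where "open S" "z \<in> S" "\<Omega> \<inter> S = {}" unfolding eventually_nhds by auto
      then show False using zc open_Int_closure_eq_empty[of S \<Omega>] by auto
    qed
  }
  assume le: "\<rho> z \<le> 0"
  show "z \<in> closure \<Omega>"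
  proof (cases "\<rho> z < 0")
    case True then show ?thesis using \<Omega> z closure_subset by blast
  next
    case False
    then have z0: "\<rho> z = 0" using le by simp
    have "((\<lambda>t. z - t *\<^sub>R grad \<rho> z) has_vector_derivative - grad \<rho> z) (at 0)"
      by (auto intro!: derivative_eq_intros simp: has_vector_derivative_def)
    from smooth_on_curve[OF V(2) _ this] z
    have "((\<lambda>t. \<rho> (z - t *\<^sub>R grad \<rho> z)) has_real_derivative - (grad \<rho> z \<bullet> grad \<rho> z)) (at 0)"
      by (simp add: inner_vec_def sum_2)
    moreover have "- (grad \<rho> z \<bullet> grad \<rho> z) < 0" using gr by simp
    ultimately have "\<exists>d>0. \<forall>h>0. h < d \<longrightarrow> \<rho> (z - (0 + h) *\<^sub>R grad \<rho> z) < \<rho> (z - 0 *\<^sub>R grad \<rho> z)"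
      by (rule DERIV_neg_dec_right)
    then obtain d where d: "d > 0" "\<And>h. 0 < h \<Longrightarrow> h < d \<Longrightarrow> \<rho> (z - h *\<^sub>R grad \<rho> z) < 0"
      using z0 by auto
    have "((\<lambda>h. z - h *\<^sub>R grad \<rho> z) \<longlongrightarrow> z - 0 *\<^sub>R grad \<rho> z) (at_right 0)" by (intro tendsto_intros)
    then have lim: "((\<lambda>h. z - h *\<^sub>R grad \<rho> z) \<longlongrightarrow> z) (at_right 0)" by simp
    have "\<forall>\<^sub>F h in at_right 0. z - h *\<^sub>R grad \<rho> z \<in> V"
      using lim V(1) z by (rule topological_tendstoD)
    moreover have "\<forall>\<^sub>F h in at_right 0. h < d" using d(1) by (rule eventually_at_right_real[THEN eventually_mono]) auto
    moreover have "\<forall>\<^sub>F h in at_right (0::real). h > 0" by (simp add: eventually_at_right_less)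
    ultimately have "\<forall>\<^sub>F h in at_right 0. z - h *\<^sub>R grad \<rho> z \<in> closure \<Omega>"
    proof eventually_elim
      case (elim h)
      then have "z - h *\<^sub>R grad \<rho> z \<in> \<Omega>" using d(2)[of h] \<Omega> by auto
      then show ?case using closure_subset by blast
    qed
    then show ?thesis by (rule Lim_in_closed_set[OF closed_closure _ trivial_limit_at_right_real lim])
  qed
qed

lemma defining_function_frontier:
  assumes d: "defining_function \<Omega> x V \<rho>" and z: "z \<in> V" and \<Omega>: "open \<Omega>"
  shows "z \<in> frontier \<Omega> \<longleftrightarrow> \<rho> z = 0"
proof -
  have "z \<in> \<Omega> \<longleftrightarrow> \<rho> z < 0" using d z unfolding defining_function_def by blast
  then show ?thesis
    using defining_function_closure[OF d z] interior_open[OF \<Omega>] by (auto simp: frontier_def)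
qed

text \<open>In the direction \<open>\<sigma> *\<^sub>R axis i 1\<close> the function \<rho> grows at
  rate at least c, so it changes sign within distance \<open>\<bar>\<rho> a\<bar> / c\<close>.
  Monotonicity fixes the side: from \<Omega> the boundary is met at positive h.\<close>

lemma foot_point_exists:
  assumes \<rho>: "smooth_on V \<rho>" "cball p r \<subseteq> V"
    and c: "0 < c" "\<And>x. x \<in> cball p r \<Longrightarrow> c \<le> \<sigma> * partial i \<rho> x"
    and \<sigma>: "\<bar>\<sigma>\<bar> = 1" and a: "dist a p + \<bar>\<rho> a\<bar> / c \<le> r"
  shows "\<exists>h. \<bar>h\<bar> \<le> \<bar>\<rho> a\<bar> / c \<and> \<rho> (a + (\<sigma> * h) *\<^sub>R axis i 1) = 0 \<and>
    (\<rho> a \<le> 0 \<longrightarrow> 0 \<le> h) \<and> (\<rho> a < 0 \<longrightarrow> 0 < h)"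
proof -
  define H where "H = \<bar>\<rho> a\<bar> / c"
  have H: "0 \<le> H" "c * H = \<bar>\<rho> a\<bar>" using c by (auto simp: H_def)
  define \<phi> where "\<phi> = (\<lambda>t. \<rho> (a + (\<sigma> * t) *\<^sub>R axis i 1))"
  have inb: "a + (\<sigma> * t) *\<^sub>R axis i 1 \<in> cball p r" if "\<bar>t\<bar> \<le> H" for t
  proof -
    have "dist p (a + (\<sigma> * t) *\<^sub>R axis i 1) \<le> dist p a + norm ((\<sigma> * t) *\<^sub>R (axis i 1 :: real^2))"
      by (metis dist_norm dist_triangle_le add_diff_cancel_left' dist_commute order_refl)
    also have "\<dots> \<le> dist a p + H" using \<sigma> that by (simp add: norm_axis_1 abs_mult dist_commute)
    finally show ?thesis using a by (simp add: H_def)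
  qed
  have der: "(\<phi> has_real_derivative \<sigma> * partial i \<rho> (a + (\<sigma> * t) *\<^sub>R axis i 1)) (at t)" if "\<bar>t\<bar> \<le> H" for t
    unfolding \<phi>_def by (rule smooth_on_line[OF \<rho>(1)]) (use inb[OF that] \<rho>(2) in auto)
  have grow: "\<phi> u + c * (t - u) \<le> \<phi> t" if "- H \<le> u" "u \<le> t" "t \<le> H" for u t
  proof (cases "u = t")
    case False
    then have ut: "u < t" using that by simp
    have d: "(\<phi> has_real_derivative \<sigma> * partial i \<rho> (a + (\<sigma> * z) *\<^sub>R axis i 1)) (at z)"
      if "u \<le> z" "z \<le> t" for z
      by (rule der) (use that \<open>- H \<le> u\<close> \<open>t \<le> H\<close> in auto)
    obtain z where z: "u < z" "z < t"
      "\<phi> t - \<phi> u = (t - u) * (\<sigma> * partial i \<rho> (a + (\<sigma> * z) *\<^sub>R axis i 1))"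
      using MVT2[OF ut d] by blast
    have "(t - u) * c \<le> \<phi> t - \<phi> u"
      unfolding z(3) using c(2)[OF inb[of z]] z that by (intro mult_left_mono) auto
    then show ?thesis by (simp add: algebra_simps)
  qed simp
  have \<phi>0: "\<phi> 0 = \<rho> a" by (simp add: \<phi>_def)
  have "\<phi> (- H) \<le> 0" "0 \<le> \<phi> H"
    using grow[of "-H" 0] grow[of 0 H] H \<phi>0 by auto
  then obtain h where h: "- H \<le> h" "h \<le> H" "\<phi> h = 0"
    using IVT[of \<phi> "-H" 0 H] DERIV_isCont[OF der] H(1) by (auto simp: abs_le_iff)
  have "0 \<le> h" if "\<rho> a \<le> 0"
  proof (rule ccontr)
    assume "\<not> 0 \<le> h"
    then have "c * (0 - h) > 0" using c by (simp add: mult_pos_neg)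
    then show False using grow[of h 0] h H that \<phi>0 \<open>\<not> 0 \<le> h\<close> by auto
  qed
  moreover have "h \<noteq> 0" if "\<rho> a < 0" using h \<phi>0 that by auto
  ultimately show ?thesis using h by (intro exI[of _ h]) (auto simp: H_def \<phi>_def)
qed

section \<open>Short chords\<close>

text \<open>The setting of all estimates. The product of the two disjoint closed balls is a compact
  convex part of phase space without collisions. The index i and the sign \<sigma> single out a
  coordinate direction that crosses the boundary outwards at rate at least c.\<close>

locale dipole_chart =
  fixes Q \<rho> :: "real^2 \<Rightarrow> real" and \<Omega> V :: "(real^2) set" and p q :: "real^2"
    and r c \<sigma> :: real and i :: 2
  assumes smooth_Q: "smooth_on UNIV Q" and smooth_\<rho>: "smooth_on V \<rho>"
    and r: "0 < r" and ball_V: "cball p r \<subseteq> V"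
    and disj: "cball p r \<inter> cball q r = {}"
    and c: "0 < c" and \<sigma>: "\<bar>\<sigma>\<bar> = 1"
    and transversal: "\<And>x. x \<in> cball p r \<Longrightarrow> c \<le> \<sigma> * partial i \<rho> x"
    and in_closure: "\<And>z. z \<in> V \<Longrightarrow> z \<in> closure \<Omega> \<longleftrightarrow> \<rho> z \<le> 0"
    and in_\<Omega>: "\<And>z. z \<in> V \<Longrightarrow> z \<in> \<Omega> \<longleftrightarrow> \<rho> z < 0"
    and q_away: "cball q r \<inter> closure \<Omega> = {}"
begin

definition box :: "((real^2) \<times> (real^2)) set" where
  "box = cball p r \<times> cball q r"

lemma box: "compact box" "convex box" "z \<in> box \<Longrightarrow> fst z \<noteq> snd z" "fst ` box \<subseteq> V"
  using disj ball_V unfolding box_def by (auto intro: compact_Times convex_Times)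

lemma box_bound: "\<exists>R>0. \<forall>z\<in>box. norm (fst z - snd z) \<le> R"
proof -
  have "bounded ((\<lambda>z. fst z - snd z) ` box)"
    using box(1) by (intro compact_imp_bounded compact_continuous_image continuous_intros)
  then obtain B where "\<forall>z\<in>box. norm (fst z - snd z) \<le> B" by (auto simp: bounded_iff)
  then show ?thesis by (intro exI[of _ "max B 1"]) auto
qed

lemma grad_lower: "x \<in> cball p r \<Longrightarrow> c \<le> norm (grad \<rho> x)"
proof -
  assume x: "x \<in> cball p r"
  have "c \<le> \<bar>partial i \<rho> x\<bar>"
    using transversal[OF x] abs_ge_self[of "\<sigma> * partial i \<rho> x"] \<sigma> by (simp add: abs_mult)
  also have "\<dots> = \<bar>grad \<rho> x $ i\<bar>" using exhaust_2[of i] by auto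
  finally show ?thesis using component_le_norm_cart[of "grad \<rho> x" i] by linarith
qed

lemma \<rho>_lipschitz: "\<exists>B\<ge>0. \<forall>x\<in>cball p r. \<forall>y\<in>cball p r. \<bar>\<rho> x - \<rho> y\<bar> \<le> B * dist x y"
proof -
  obtain L where "L-lipschitz_on (cball p r) \<rho>"
    using smooth_on_lipschitz[OF smooth_\<rho> ball_V] by auto
  then show ?thesis using lipschitz_on_nonneg lipschitz_onD
    by (metis dist_real_def)
qed

text \<open>K and e are uniform over the box. The new point \<open>b'\<close> may leave the box and
  is located only through its distance to b.\<close>

lemma adjust_in_box:
  "\<exists>K>0. \<exists>e>0. \<forall>a b t. (a, b) \<in> box \<longrightarrow> \<bar>t - normal_rate \<rho> Q (a, b)\<bar> \<le> e \<longrightarrow>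
    (\<exists>b'. normal_rate \<rho> Q (a, b') = t \<and> dist b' b \<le> K * \<bar>t - normal_rate \<rho> Q (a, b)\<bar>)"
proof -
  obtain R where R: "R > 0" "\<forall>z\<in>box. norm (fst z - snd z) \<le> R" using box_bound by auto
  show ?thesis
  proof (rule exI[of _ "2 * pi * R\<^sup>2 / c"], intro conjI, use R c in simp,
      rule exI[of _ "c / (2 * pi * R)"], intro conjI allI impI, use R c in simp)
    fix a b t assume ab: "(a, b) \<in> box" and t: "\<bar>t - normal_rate \<rho> Q (a, b)\<bar> \<le> c / (2 * pi * R)"
    show "\<exists>b'. normal_rate \<rho> Q (a, b') = t \<and>
        dist b' b \<le> 2 * pi * R\<^sup>2 / c * \<bar>t - normal_rate \<rho> Q (a, b)\<bar>"
      using adjust_normal_rate[of a b R c \<rho> t Q] box(3)[OF ab] R ab c grad_lower[of a] t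
      by (auto simp: box_def)
  qed
qed

lemma foot_point:
  assumes "dist a p + \<bar>\<rho> a\<bar> / c \<le> r"
  shows "\<exists>h. \<bar>h\<bar> \<le> \<bar>\<rho> a\<bar> / c \<and> \<rho> (a + (\<sigma> * h) *\<^sub>R axis i 1) = 0 \<and>
    (\<rho> a \<le> 0 \<longrightarrow> 0 \<le> h) \<and> (\<rho> a < 0 \<longrightarrow> 0 < h)"
  using foot_point_exists[OF smooth_\<rho> ball_V c transversal \<sigma> assms] .

lemma norm_foot: "norm ((\<sigma> * h) *\<^sub>R (axis i 1 :: real^2)) = \<bar>h\<bar>"
  using \<sigma> by (simp add: abs_mult)

text \<open>At a small time s the state is neither on the boundary nor tangential, but moving
  \<open>ap s\<close> to the boundary and then \<open>am s\<close> until the rate vanishes costs a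
  multiple of \<open>\<bar>g1 s\<bar> + \<bar>g s\<bar>\<close>. The failing differential inequality
  provides an s at which the acceleration exceeds the resulting Lipschitz loss.\<close>

lemma good_point:
  assumes sol: "dipole_solution Q p q J ap am" and init: "\<rho> p = 0" "normal_rate \<rho> Q (p, q) = 0"
    and d: "0 < d" "\<And>s. 0 < s \<Longrightarrow> s \<le> d \<Longrightarrow> s \<in> J \<and> ap s \<notin> closure \<Omega>"
    and \<eta>: "0 < \<eta>" "\<eta> \<le> r"
  shows "\<exists>x y. dist x p < \<eta> \<and> dist y q < \<eta> \<and> \<rho> x = 0 \<and> normal_rate \<rho> Q (x, y) = 0 \<and>
    0 < normal_accel \<rho> Q (x, y)"
proof -
  obtain L1 L2 where "L1-lipschitz_on box (normal_rate \<rho> Q)" "L2-lipschitz_on box (normal_accel \<rho> Q)"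
    using lipschitz_normal[OF smooth_Q smooth_\<rho> box] by auto
  then obtain L where L: "L-lipschitz_on box (normal_rate \<rho> Q)" "L-lipschitz_on box (normal_accel \<rho> Q)"
    using lipschitz_on_mono[of L1 box _ box "max L1 L2"] lipschitz_on_mono[of L2 box _ box "max L1 L2"] by auto
  have L0: "L \<ge> 0" using lipschitz_on_nonneg[OF L(1)] .
  obtain K e where K: "K > 0" "e > 0" and adj: "\<And>a b t. (a, b) \<in> box \<Longrightarrow> \<bar>t - normal_rate \<rho> Q (a, b)\<bar> \<le> e \<Longrightarrow>
      \<exists>b'. normal_rate \<rho> Q (a, b') = t \<and> dist b' b \<le> K * \<bar>t - normal_rate \<rho> Q (a, b)\<bar>"
    using adjust_in_box by metis
  define g g1 g2 where "g = (\<lambda>s. \<rho> (ap s))" and "g1 = (\<lambda>s. normal_rate \<rho> Q (ap s, am s))"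
    and "g2 = (\<lambda>s. normal_accel \<rho> Q (ap s, am s))"
  have J0: "0 \<in> J" "ap 0 = p" "am 0 = q" using sol by (auto simp: dipole_solution_def)
  have p_V: "p \<in> V" using ball_V r by auto
  \<comment> \<open>All displacements made below, and the distance of the state from
    \<open>(p, q)\<close>, are summed into one continuous function vanishing at 0, so a single
    smallness condition controls them together.\<close>
  define m where "m = (\<lambda>s. dist (ap s) p + dist (am s) q + \<bar>g s\<bar> / c + (1 + K) * (\<bar>g1 s\<bar> + L * (\<bar>g s\<bar> / c)))"
  have "isCont ap 0" "isCont am 0" using dipole_solution_isCont[OF sol J0(1)] .
  moreover have "isCont g 0" "isCont g1 0"
    unfolding g_def g1_def
    using normal_derivatives[OF sol J0(1) _ smooth_Q smooth_\<rho>] p_V J0 DERIV_isCont by blast+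
  ultimately have "isCont m 0" unfolding m_def using c by (intro continuous_intros) auto
  moreover have m0: "m 0 = 0" using init J0 by (simp add: m_def g_def g1_def)
  moreover define \<mu> where "\<mu> = min (\<eta> / 2) e"
  ultimately obtain d1 where d1: "d1 > 0" "\<And>s. \<bar>s\<bar> < d1 \<Longrightarrow> \<bar>m s\<bar> < \<mu>"
    using \<eta> K unfolding continuous_at_eps_delta dist_real_def
    by (metis diff_zero min_less_iff_conj half_gt_zero)
  define d2 where "d2 = min d (d1 / 2)"
  have d2: "0 < d2" "d2 \<le> d" "d2 < d1" using d d1 by (auto simp: d2_def)
  have sJ: "s \<in> J" if "0 \<le> s" "s \<le> d2" for s
    using that d(2)[of s] d2 J0 by (cases "s = 0") auto
  have parts: "dist (ap s) p < \<mu>" "dist (am s) q < \<mu>" "\<bar>g s\<bar> / c < \<mu>" "dist (ap s) p + \<bar>g s\<bar> / c < \<mu>"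
      "(1 + K) * (\<bar>g1 s\<bar> + L * (\<bar>g s\<bar> / c)) < \<mu>" "dist (am s) q + (1 + K) * (\<bar>g1 s\<bar> + L * (\<bar>g s\<bar> / c)) < \<mu>"
    if "0 \<le> s" "s \<le> d2" for s
  proof -
    have "\<bar>m s\<bar> < \<mu>" using d1(2)[of s] that d2 by auto
    moreover have "0 \<le> \<bar>g s\<bar> / c" using c by simp
    moreover have "0 \<le> (1 + K) * (\<bar>g1 s\<bar> + L * (\<bar>g s\<bar> / c))" using c K L0 by simp
    moreover have "0 \<le> dist (ap s) p" "0 \<le> dist (am s) q" by auto
    ultimately show "dist (ap s) p < \<mu>" "dist (am s) q < \<mu>" "\<bar>g s\<bar> / c < \<mu>" "dist (ap s) p + \<bar>g s\<bar> / c < \<mu>"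
      "(1 + K) * (\<bar>g1 s\<bar> + L * (\<bar>g s\<bar> / c)) < \<mu>" "dist (am s) q + (1 + K) * (\<bar>g1 s\<bar> + L * (\<bar>g s\<bar> / c)) < \<mu>"
      unfolding m_def by linarith+
  qed
  have \<mu>r: "\<mu> < r" "\<mu> < \<eta>" "2 * \<mu> \<le> \<eta>" "\<mu> \<le> e" using \<eta> by (auto simp: \<mu>_def)
  have inV: "ap s \<in> V" if "0 \<le> s" "s \<le> d2" for s
    using parts(1)[OF that] \<mu>r ball_V by (auto simp: subset_iff dist_commute)
  \<comment> \<open>The total displacement is at most
    \<open>\<bar>g s\<bar> / c + K * \<Delta>\<close> with
    \<open>\<Delta> = \<bar>g1 s\<bar> + L * (\<bar>g s\<bar> / c)\<close>; C is L times a common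
    bound for its coefficients.\<close>
  define C where "C = L * (1 / c + K + K * L / c)"
  have "\<exists>s. 0 < s \<and> s \<le> d2 \<and> C * (\<bar>g1 s\<bar> + \<bar>g s\<bar>) < g2 s"
  proof (rule one_sided_second_order_ineq_fails[OF d2(1)])
    fix s assume s: "0 \<le> s" "s \<le> d2"
    show "(g has_real_derivative g1 s) (at s)" "(g1 has_real_derivative g2 s) (at s)"
      using normal_derivatives[OF sol sJ[OF s] inV[OF s] smooth_Q smooth_\<rho>]
      by (simp_all add: g_def g1_def g2_def)
  next
    show "g 0 = 0" "g1 0 = 0" using init J0 by (simp_all add: g_def g1_def)
    fix s assume s: "0 < s" "s \<le> d2"
    then have "ap s \<notin> closure \<Omega>" using d(2) d2 by auto
    then show "0 < g s" using in_closure[OF inV[of s]] s by (simp add: g_def)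
  qed
  then obtain s where s: "0 < s" "s \<le> d2" "C * (\<bar>g1 s\<bar> + \<bar>g s\<bar>) < g2 s" by blast
  note P = parts[OF less_imp_le[OF s(1)] s(2)]
  have "dist (ap s) p + \<bar>\<rho> (ap s)\<bar> / c \<le> r" using P(4) \<mu>r by (simp add: g_def)
  then obtain h where h: "\<bar>h\<bar> \<le> \<bar>g s\<bar> / c" "\<rho> (ap s + (\<sigma> * h) *\<^sub>R axis i 1) = 0"
    using foot_point[of "ap s"] by (auto simp: g_def)
  define x where "x = ap s + (\<sigma> * h) *\<^sub>R axis i 1"
  have xs: "dist x (ap s) \<le> \<bar>g s\<bar> / c" using h(1) norm_foot[of h] by (simp add: x_def dist_norm)
  have xp: "dist x p < \<mu>" using dist_triangle[of x p "ap s"] xs P(4) by linarith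
  have box1: "(ap s, am s) \<in> box" "(x, am s) \<in> box"
    using P xp \<mu>r by (auto simp: box_def dist_commute)
  have "dist (normal_rate \<rho> Q (x, am s)) (g1 s) \<le> L * dist (x, am s) (ap s, am s)"
    unfolding g1_def by (rule lipschitz_onD[OF L(1) box1(2,1)])
  also have "\<dots> \<le> L * (\<bar>g s\<bar> / c)"
    using xs L0 by (intro mult_left_mono) (auto simp: dist_Pair_Pair)
  finally have rate: "\<bar>normal_rate \<rho> Q (x, am s)\<bar> \<le> \<bar>g1 s\<bar> + L * (\<bar>g s\<bar> / c)"
    by (simp add: dist_real_def)
  define \<Delta> where "\<Delta> = \<bar>g1 s\<bar> + L * (\<bar>g s\<bar> / c)"
  have \<Delta>: "0 \<le> \<Delta>" "\<Delta> + K * \<Delta> < \<mu>" "dist (am s) q + \<Delta> + K * \<Delta> < \<mu>" "K * \<Delta> \<ge> 0"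
    using P(5,6) c L0 K unfolding \<Delta>_def[symmetric] by (auto simp: \<Delta>_def) (auto simp: distrib_right)
  obtain y where y: "normal_rate \<rho> Q (x, y) = 0" "dist y (am s) \<le> K * \<bar>normal_rate \<rho> Q (x, am s)\<bar>"
    using adj[OF box1(2), of 0] rate \<Delta> \<mu>r unfolding \<Delta>_def by fastforce
  have ys: "dist y (am s) \<le> K * \<Delta>"
    using y(2) rate K mult_left_mono[of "\<bar>normal_rate \<rho> Q (x, am s)\<bar>" \<Delta> K] unfolding \<Delta>_def by linarith
  have yq: "dist y q < \<mu>" using dist_triangle[of y q "am s"] ys \<Delta> by linarith
  have box2: "(x, y) \<in> box" using xp yq \<mu>r by (auto simp: box_def dist_commute)
  have "dist (normal_accel \<rho> Q (x, y)) (g2 s) \<le> L * dist (x, y) (ap s, am s)"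
    unfolding g2_def by (rule lipschitz_onD[OF L(2) box2 box1(1)])
  also have "\<dots> \<le> L * (\<bar>g s\<bar> / c + K * \<Delta>)"
    using xs ys L0 sqrt_sum_squares_le_sum[of "dist x (ap s)" "dist y (am s)"]
    by (intro mult_left_mono) (auto simp: dist_Pair_Pair)
  also have "\<dots> \<le> C * (\<bar>g1 s\<bar> + \<bar>g s\<bar>)"
  proof -
    have "C * (\<bar>g1 s\<bar> + \<bar>g s\<bar>) = L * (\<bar>g s\<bar> / c + K * \<Delta>) + L * (\<bar>g1 s\<bar> / c + K * L * (\<bar>g1 s\<bar> / c) + K * \<bar>g s\<bar>)"
      by (simp add: C_def \<Delta>_def algebra_simps add_divide_distrib)
    moreover have "0 \<le> L * (\<bar>g1 s\<bar> / c + K * L * (\<bar>g1 s\<bar> / c) + K * \<bar>g s\<bar>)"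
      using L0 c K by simp
    ultimately show ?thesis by linarith
  qed
  finally have "normal_accel \<rho> Q (x, y) > 0" using s(3) by (simp add: dist_real_def)
  then show ?thesis using xp yq \<mu>r y(1) h(2) unfolding x_def by (meson less_trans)
qed

text \<open>M bounds the field on the compact box. The potential is arbitrary because the bound is
  applied to both Q and Q'.\<close>

lemma solution_stays_in_box:
  assumes "smooth_on UNIV Q'"
  shows "\<exists>M>0. \<forall>x y J ap am d T. dipole_solution Q' x y J ap am \<longrightarrow> {0..T} \<subseteq> J \<longrightarrow>
    cball x d \<subseteq> cball p r \<longrightarrow> cball y d \<subseteq> cball q r \<longrightarrow> M * T < d \<longrightarrow>
    (\<forall>s\<in>{0..T}. dist (ap s, am s) (x, y) < d)"
proof -
  have "\<exists>L. L-lipschitz_on box (dipole_field Q')" by (rule lipschitz_dipole_field[OF assms box(1-3)])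
  then have "bounded (dipole_field Q' ` box)"
    using box(1) by (auto intro!: compact_imp_bounded compact_continuous_image elim: lipschitz_on_continuous_on)
  then obtain B where B: "\<And>z. z \<in> box \<Longrightarrow> norm (dipole_field Q' z) \<le> B" by (auto simp: bounded_iff)
  define M where "M = max B 1"
  have M: "M > 0" "\<And>z. z \<in> box \<Longrightarrow> norm (dipole_field Q' z) \<le> M" using B by (force simp: M_def)+
  show ?thesis
  proof (intro exI[of _ M] conjI allI impI ballI)
    fix x y J ap am d T s
    assume sol: "dipole_solution Q' x y J ap am" and T: "{0..T} \<subseteq> J" and cb: "cball x d \<subseteq> cball p r" "cball y d \<subseteq> cball q r"
      and MT: "M * T < d" and s: "s \<in> {0..T}"
    have i: "(ap 0, am 0) = (x, y)" using sol by (auto simp: dipole_solution_def)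
    have "dist (ap s, am s) (ap 0, am 0) < d"
    proof (rule solution_stays_in_ball[where Y = "\<lambda>s. (ap s, am s)", OF _ _ MT _ s])
      show "((\<lambda>s. (ap s, am s)) has_vector_derivative dipole_field Q' (ap t, am t)) (at t)" if "t \<in> {0..T}" for t
        by (rule dipole_solution_pair[OF sol]) (use that T in auto)
      fix t assume "t \<in> {0..T}" "dist (ap t, am t) (ap 0, am 0) \<le> d"
      then have "dist (ap t) x \<le> d" "dist (am t) y \<le> d"
        using dist_fst_le[of "(ap t, am t)" "(x, y)"] dist_snd_le[of "(ap t, am t)" "(x, y)"] i by auto
      then have "(ap t, am t) \<in> box" using cb by (auto simp: box_def subset_iff dist_commute)
      then show "norm (dipole_field Q' (ap t, am t)) \<le> M" by (rule M(2))
    qed (use M in auto)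
    then show "dist (ap s, am s) (x, y) < d" using i by simp
  qed (use M in auto)
qed

text \<open>The margin \<open>\<delta>\<close>, uniform in \<open>\<epsilon>\<close>, keeps \<open>a\<^sub>-\<close> in the ball around \<open>q\<close> for a time independent of \<open>\<epsilon>\<close>.\<close>

definition short_chords_at :: "real^2 \<Rightarrow> bool" where
  "short_chords_at x \<longleftrightarrow> (\<exists>\<delta>>0. \<forall>\<epsilon>>0. \<exists>y. cball y \<delta> \<subseteq> cball q r \<and>
    (\<forall>J ap am \<tau>. exit_solution Q \<Omega> x y J ap am \<tau> \<longrightarrow>
      0 < \<tau> \<and> \<tau> < \<epsilon> \<and> (\<exists>s\<in>{0..\<tau>}. ap s \<in> \<Omega>)))"

text \<open>With initial rate \<open>- \<beta>\<close> and acceleration at least \<kappa>, the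
  trajectory enters \<Omega> at once, while \<rho> along it is at least
  \<open>\<kappa> / 2 * s * s - \<beta> * s\<close>; this forces an exit after a time proportional
  to \<beta>. The acceleration bound holds on a fixed neighbourhood, so \<beta> may be as small as
  desired with the same margin for y.\<close>

lemma short_chords:
  assumes xy: "dist x0 p < r" "dist y0 q < r" "\<rho> x0 = 0" "normal_rate \<rho> Q (x0, y0) = 0"
    "0 < normal_accel \<rho> Q (x0, y0)"
  shows "\<exists>r'>0. \<forall>x. dist x x0 < r' \<longrightarrow> \<rho> x = 0 \<longrightarrow> dist x p < r \<and> short_chords_at x"
proof -
  obtain L L2 where L: "L-lipschitz_on box (normal_rate \<rho> Q)" and L2: "L2-lipschitz_on box (normal_accel \<rho> Q)"
    using lipschitz_normal[OF smooth_Q smooth_\<rho> box] by auto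
  have L0: "L \<ge> 0" "L2 \<ge> 0" using lipschitz_on_nonneg[OF L] lipschitz_on_nonneg[OF L2] by auto
  obtain K e where K: "K > 0" "e > 0" and adj: "\<And>a b t. (a, b) \<in> box \<Longrightarrow> \<bar>t - normal_rate \<rho> Q (a, b)\<bar> \<le> e \<Longrightarrow>
      \<exists>b'. normal_rate \<rho> Q (a, b') = t \<and> dist b' b \<le> K * \<bar>t - normal_rate \<rho> Q (a, b)\<bar>"
    using adjust_in_box by metis
  obtain M where M: "M > 0" and stay: "\<And>x y J ap am d T s. dipole_solution Q x y J ap am \<Longrightarrow> {0..T} \<subseteq> J \<Longrightarrow>
    cball x d \<subseteq> cball p r \<Longrightarrow> cball y d \<subseteq> cball q r \<Longrightarrow> M * T < d \<Longrightarrow> s \<in> {0..T} \<Longrightarrow>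
    dist (ap s, am s) (x, y) < d"
    using solution_stays_in_box[OF smooth_Q] by metis
  define \<kappa> where "\<kappa> = normal_accel \<rho> Q (x0, y0) / 2"
  have \<kappa>: "\<kappa> > 0" using xy by (simp add: \<kappa>_def)
  \<comment> \<open>Room \<open>4 * d\<close> remains in both balls, and moving each vortex by at
    most \<open>2 * d\<close> changes the acceleration, initially \<open>2 * \<kappa>\<close>, by at
    most \<kappa>.\<close>
  define d where "d = min (min (r - dist x0 p) (r - dist y0 q)) (\<kappa> / (L2 + 1)) / 4"
  have "\<kappa> / (L2 + 1) > 0" using \<kappa> L0 by simp
  then have d: "0 < d" "dist x0 p + 4 * d \<le> r" "dist y0 q + 4 * d \<le> r" "4 * d \<le> \<kappa> / (L2 + 1)"
    using xy by (auto simp: d_def min_def)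
  have box0: "(x0, y0) \<in> box" using xy by (auto simp: box_def dist_commute)
  have accel: "\<kappa> \<le> normal_accel \<rho> Q (a, b)" if ab: "dist a x0 \<le> 2 * d" "dist b y0 \<le> 2 * d" for a b
  proof -
    have "dist a p \<le> r" "dist b q \<le> r"
      using dist_triangle[of a p x0] dist_triangle[of b q y0] ab d by linarith+
    then have "(a, b) \<in> box" by (auto simp: box_def dist_commute)
    then have "dist (normal_accel \<rho> Q (a, b)) (normal_accel \<rho> Q (x0, y0)) \<le> L2 * dist (a, b) (x0, y0)"
      by (rule lipschitz_onD[OF L2 _ box0])
    also have "\<dots> \<le> L2 * (4 * d)"
      using ab L0 sqrt_sum_squares_le_sum[of "dist a x0" "dist b y0"]
      by (intro mult_left_mono) (auto simp: dist_Pair_Pair)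
    also have "\<dots> \<le> L2 * (\<kappa> / (L2 + 1))" using d L0 by (intro mult_left_mono) auto
    also have "\<dots> \<le> \<kappa>" using L0 \<kappa> by (simp add: field_simps)
    finally have "\<bar>normal_accel \<rho> Q (a, b) - normal_accel \<rho> Q (x0, y0)\<bar> \<le> \<kappa>"
      by (simp add: dist_real_def)
    moreover have "normal_accel \<rho> Q (x0, y0) = 2 * \<kappa>" by (simp add: \<kappa>_def)
    ultimately show ?thesis by (simp add: abs_le_iff)
  qed
  \<comment> \<open>A budget for changes of the normal rate: half is spent on moving from
    \<open>x0\<close> to x, half on lowering the rate to \<open>- \<beta>\<close>. Meeting it
    displaces \<open>y0\<close> by at most d.\<close>
  define \<mu> where "\<mu> = min e (d / K)"
  have \<mu>: "\<mu> > 0" "\<mu> \<le> e" "K * \<mu> \<le> d" using K d by (auto simp: \<mu>_def min_def field_simps)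
  define r' where "r' = min d (\<mu> / 2 / (L + 1))"
  have r': "r' > 0" "r' \<le> d" "L * r' \<le> \<mu> / 2"
  proof -
    show "r' > 0" "r' \<le> d" using d \<mu> L0 by (auto simp: r'_def)
    have "L * r' \<le> L * (\<mu> / 2 / (L + 1))" using L0 by (intro mult_left_mono) (auto simp: r'_def)
    also have "\<dots> \<le> \<mu> / 2" using L0 \<mu> by (simp add: field_simps)
    finally show "L * r' \<le> \<mu> / 2" .
  qed
  have "short_chords_at x \<and> dist x p < r" if x: "dist x x0 < r'" "\<rho> x = 0" for x
  proof
    have xp: "dist x p < r - 2 * d" using dist_triangle[of x p x0] x r' d by linarith
    then show "dist x p < r" using d by linarith
    have boxx: "(x, y0) \<in> box" using xp xy d by (auto simp: box_def dist_commute)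
    have "dist (normal_rate \<rho> Q (x, y0)) (normal_rate \<rho> Q (x0, y0)) \<le> L * dist (x, y0) (x0, y0)"
      by (rule lipschitz_onD[OF L boxx box0])
    also have "\<dots> \<le> L * r'" using x L0 by (intro mult_left_mono) (auto simp: dist_Pair_Pair)
    finally have rate: "\<bar>normal_rate \<rho> Q (x, y0)\<bar> \<le> \<mu> / 2" using xy(4) r' by (simp add: dist_real_def)
    have cx: "cball x d \<subseteq> cball p r"
    proof
      fix z assume "z \<in> cball x d"
      then have "dist z x \<le> d" by (simp add: dist_commute)
      then show "z \<in> cball p r" using dist_triangle[of z p x] xp d by (simp add: dist_commute)
    qed
    show "short_chords_at x"
      unfolding short_chords_at_def
    proof (intro exI[of _ d] conjI allI impI, fact d(1))
      fix \<epsilon> :: real assume \<epsilon>: "\<epsilon> > 0"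
      define T where "T = min (\<epsilon> / 2) (min (d / (2 * M)) (3 * (\<mu> / 2) / \<kappa>))"
      have T: "T > 0" "T < \<epsilon>" "M * T < d" "\<kappa> * T / 3 \<le> \<mu> / 2"
      proof -
        show "T > 0" using \<epsilon> d M \<mu> \<kappa> by (auto simp: T_def)
        show "T < \<epsilon>" using \<epsilon> by (auto simp: T_def)
        have "M * T \<le> M * (d / (2 * M))" using M by (intro mult_left_mono) (auto simp: T_def)
        then show "M * T < d" using M d by simp
        have "\<kappa> * T \<le> \<kappa> * (3 * (\<mu> / 2) / \<kappa>)" using \<kappa> by (intro mult_left_mono) (auto simp: T_def)
        then show "\<kappa> * T / 3 \<le> \<mu> / 2" using \<kappa> by simp
      qed
      \<comment> \<open>A factor below 1/2 makes the lower bound for \<rho> positive at time T; with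
        1/3 it equals \<open>\<kappa> * T * T / 6\<close>.\<close>
      define \<beta> where "\<beta> = \<kappa> * T / 3"
      have \<beta>: "\<beta> > 0" "\<beta> \<le> \<mu> / 2" using T \<kappa> by (auto simp: \<beta>_def)
      have le\<mu>: "\<bar>- \<beta> - normal_rate \<rho> Q (x, y0)\<bar> \<le> \<mu>" using rate \<beta> by linarith
      then obtain y where y: "normal_rate \<rho> Q (x, y) = - \<beta>"
        "dist y y0 \<le> K * \<bar>- \<beta> - normal_rate \<rho> Q (x, y0)\<bar>"
        using adj[OF boxx, of "- \<beta>"] \<mu> by fastforce
      have yy: "dist y y0 \<le> d"
        using y(2) mult_left_mono[OF le\<mu>, of K] K \<mu>(3) by linarith
      have cy: "cball y d \<subseteq> cball q r"
      proof
        fix z assume "z \<in> cball y d"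
        then have "dist z y \<le> d" by (simp add: dist_commute)
        then show "z \<in> cball q r"
          using dist_triangle[of z q y] dist_triangle[of y q y0] yy d by (simp add: dist_commute)
      qed
      show "\<exists>y. cball y d \<subseteq> cball q r \<and> (\<forall>J ap am \<tau>. exit_solution Q \<Omega> x y J ap am \<tau> \<longrightarrow>
          0 < \<tau> \<and> \<tau> < \<epsilon> \<and> (\<exists>s\<in>{0..\<tau>}. ap s \<in> \<Omega>))"
      proof (intro exI[of _ y] conjI cy allI impI)
        fix J ap am \<tau> assume ex: "exit_solution Q \<Omega> x y J ap am \<tau>"
        then have sol: "dipole_solution Q x y J ap am" and \<tau>0: "0 \<le> \<tau>" and \<tau>J: "{0..\<tau>} \<subseteq> J"
          by (auto simp: exit_solution_def)
        have J: "open J" "0 \<in> J" "ap 0 = x" "am 0 = y" using sol by (auto simp: dipole_solution_def)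
        have xV: "ap 0 \<in> V" using J ball_V xp d by (auto simp: subset_iff dist_commute)
        note der0 = normal_derivatives[OF sol J(2) xV smooth_Q smooth_\<rho>]
        have "\<exists>e>0. \<forall>h>0. h < e \<longrightarrow> \<rho> (ap (0 + h)) < \<rho> (ap 0)"
          using DERIV_neg_dec_right[OF der0(1)] y(1) \<beta> J by auto
        then obtain e1 where e1: "e1 > 0" "\<And>h. 0 < h \<Longrightarrow> h < e1 \<Longrightarrow> \<rho> (ap h) < 0"
          using J x(2) by auto
        have "isCont ap 0" using dipole_solution_isCont[OF sol J(2)] by simp
        then obtain e2 where e2: "e2 > 0" "\<And>h. \<bar>h\<bar> < e2 \<Longrightarrow> dist (ap h) x < d"
          using d(1) J(3) unfolding continuous_at_eps_delta dist_real_def by (metis diff_zero)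
        define e3 where "e3 = min e1 e2"
        have dip: "ap h \<in> \<Omega>" if "0 < h" "h < e3" for h
        proof -
          have "ap h \<in> cball x d" using e2(2)[of h] that by (simp add: e3_def dist_commute)
          then have "ap h \<in> V" using cx ball_V by blast
          then show ?thesis using e1(2)[of h] that in_\<Omega> by (auto simp: e3_def)
        qed
        have e3: "e3 > 0" using e1 e2 by (simp add: e3_def)
        have "x \<in> closure \<Omega>" using in_closure[OF xV] J x(2) by simp
        have \<tau>pos: "0 < \<tau>"
        proof (rule ccontr)
          assume "\<not> 0 < \<tau>"
          then have "\<tau> = 0" using \<tau>0 by simp
          then obtain s where "0 \<le> s" "s < e3" "ap s \<notin> closure \<Omega>"
            using ex e3 unfolding exit_solution_def by blast
          then show False using dip[of s] closure_subset[of \<Omega>] J(3) \<open>x \<in> closure \<Omega>\<close>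
            by (cases "s = 0") auto
        qed
        have "\<tau> \<le> T"
        proof (rule ccontr)
          assume "\<not> \<tau> \<le> T"
          then have T\<tau>: "T < \<tau>" by simp
          then have TJ: "{0..T} \<subseteq> J" using \<tau>J by auto
          have near: "dist (ap s) x < d" "dist (am s) y < d" if "s \<in> {0..T}" for s
            using stay[OF sol TJ cx cy T(3) that] dist_fst_le[of "(ap s, am s)" "(x, y)"]
              dist_snd_le[of "(ap s, am s)" "(x, y)"] by auto
          have sV: "ap s \<in> V" if "s \<in> {0..T}" for s
          proof -
            have "ap s \<in> cball x d" using near(1)[OF that] by (simp add: dist_commute)
            then show ?thesis using cx ball_V by blast
          qed
          have der: "((\<lambda>t. \<rho> (ap t)) has_real_derivative normal_rate \<rho> Q (ap s, am s)) (at s)"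
            "((\<lambda>t. normal_rate \<rho> Q (ap t, am t)) has_real_derivative normal_accel \<rho> Q (ap s, am s)) (at s)"
            if "s \<in> {0..T}" for s
            using normal_derivatives[OF sol _ sV[OF that] smooth_Q smooth_\<rho>] TJ that by auto
          have acc: "\<kappa> \<le> normal_accel \<rho> Q (ap s, am s)" if "s \<in> {0..T}" for s
          proof (rule accel)
            show "dist (ap s) x0 \<le> 2 * d" using near(1)[OF that] dist_triangle[of "ap s" x0 x] x r' by linarith
            show "dist (am s) y0 \<le> 2 * d" using near(2)[OF that] dist_triangle[of "am s" y0 y] yy by linarith
          qed
          have rate_ge: "- \<beta> + \<kappa> * s \<le> normal_rate \<rho> Q (ap s, am s)" if s: "s \<in> {0..T}" for s
          proof -
            have "normal_rate \<rho> Q (ap 0, am 0) - \<kappa> * 0 \<le> normal_rate \<rho> Q (ap s, am s) - \<kappa> * s"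
            proof (rule DERIV_nonneg_imp_nondecreasing[of 0 s "\<lambda>s. normal_rate \<rho> Q (ap s, am s) - \<kappa> * s"])
              fix u assume u: "0 \<le> u" "u \<le> s"
              then have uT: "u \<in> {0..T}" using s by auto
              have "((\<lambda>s. normal_rate \<rho> Q (ap s, am s) - \<kappa> * s) has_real_derivative normal_accel \<rho> Q (ap u, am u) - \<kappa>) (at u)"
                using DERIV_diff[OF der(2)[OF uT] DERIV_cmult_Id[of \<kappa>]] .
              moreover have "0 \<le> normal_accel \<rho> Q (ap u, am u) - \<kappa>" using acc[OF uT] by simp
              ultimately show "\<exists>y. ((\<lambda>s. normal_rate \<rho> Q (ap s, am s) - \<kappa> * s) has_real_derivative y) (at u) \<and> 0 \<le> y"
                by blast
            qed (use s in auto)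
            then show ?thesis using y(1) J by simp
          qed
          have "\<rho> (ap 0) + \<beta> * 0 - \<kappa> / 2 * (0 * 0) \<le> \<rho> (ap T) + \<beta> * T - \<kappa> / 2 * (T * T)"
          proof (rule DERIV_nonneg_imp_nondecreasing[of 0 T "\<lambda>s. \<rho> (ap s) + \<beta> * s - \<kappa> / 2 * (s * s)"])
            fix u assume u: "0 \<le> u" "u \<le> T"
            then have uT: "u \<in> {0..T}" by auto
            have "((\<lambda>s. \<rho> (ap s) + \<beta> * s - \<kappa> / 2 * (s * s)) has_real_derivative normal_rate \<rho> Q (ap u, am u) + \<beta> - \<kappa> * u) (at u)"
              by (rule derivative_eq_intros der(1)[OF uT] refl)+ simp
            moreover have "0 \<le> normal_rate \<rho> Q (ap u, am u) + \<beta> - \<kappa> * u" using rate_ge[OF uT] by simp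
            ultimately show "\<exists>y. ((\<lambda>s. \<rho> (ap s) + \<beta> * s - \<kappa> / 2 * (s * s)) has_real_derivative y) (at u) \<and> 0 \<le> y"
              by blast
          qed (use T in auto)
          then have "\<kappa> / 2 * (T * T) - \<beta> * T \<le> \<rho> (ap T)" using J x(2) by simp
          moreover have "\<kappa> / 2 * (T * T) - \<beta> * T = \<kappa> * T * T / 6" by (simp add: \<beta>_def)
          moreover have "\<kappa> * T * T / 6 > 0" using \<kappa> T by simp
          ultimately have "\<rho> (ap T) > 0" by linarith
          then have "ap T \<notin> closure \<Omega>" using in_closure[OF sV[of T]] T by auto
          then show False using ex T T\<tau> unfolding exit_solution_def by auto
        qed
        then show "\<tau> < \<epsilon>" using T by linarith
        show "\<exists>s\<in>{0..\<tau>}. ap s \<in> \<Omega>"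
          using dip[of "min \<tau> (e3 / 2)"] \<tau>pos e3 by (intro bexI[of _ "min \<tau> (e3 / 2)"]) auto
        show "0 < \<tau>" by fact
      qed
    qed
  qed
  then show ?thesis using r'(1) by blast
qed

end

section \<open>Comparison of two potentials\<close>

text \<open>The hypotheses on the two potentials in local form: equal velocities near q, where a_-
  stays, and equal data for starts near p and near q.\<close>

locale dipole_comparison = dipole_chart +
  fixes Q' :: "real^2 \<Rightarrow> real"
  assumes smooth_Q': "smooth_on UNIV Q'"
    and same_near_q: "\<And>b. b \<in> cball q r \<Longrightarrow> perp_grad Q' b = perp_grad Q b"
    and finite_exit: "\<And>x y. dist x p < r \<Longrightarrow> \<rho> x = 0 \<Longrightarrow> y \<in> cball q r \<Longrightarrow> exit_time Q \<Omega> x y < \<infinity>"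
    and same_data: "\<And>x y. dist x p < r \<Longrightarrow> \<rho> x = 0 \<Longrightarrow> y \<in> cball q r \<Longrightarrow>
      measurement Q' \<Omega> x y = measurement Q \<Omega> x y"
begin

abbreviation D :: "real^2 \<Rightarrow> real" where
  "D \<equiv> \<lambda>z. Q' z - Q z"

lemma smooth_D: "smooth_on UNIV D"
  by (rule smooth_on_diff[OF smooth_Q' smooth_Q])

lemma partial_D: "partial m D z = partial m Q' z - partial m Q z"
  using partial_diff[OF smooth_Q' smooth_Q] by simp

text \<open>The trajectories of the two systems agree at both ends of a short chord, while a sign of
  \<open>\<nabla> D\<close> along the chord would push them apart.\<close>

lemma gradient_not_one_sided:
  assumes x: "dist x p < r" "\<rho> x = 0" "short_chords_at x"
    and s0: "\<bar>s0\<bar> = 1" and K: "0 < K" and d: "0 < d"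
    and dom: "\<And>z m. z \<in> closure \<Omega> \<Longrightarrow> dist z x < d \<Longrightarrow> \<bar>partial m D z\<bar> \<le> K * (s0 * partial j D z)"
    and pos: "\<And>z. z \<in> \<Omega> \<Longrightarrow> dist z x < d \<Longrightarrow> 0 < s0 * partial j D z"
  shows False
proof -
  obtain \<delta> where \<delta>: "\<delta> > 0" and chords: "\<And>\<epsilon>. \<epsilon> > 0 \<Longrightarrow> \<exists>y. cball y \<delta> \<subseteq> cball q r \<and>
    (\<forall>J ap am \<tau>. exit_solution Q \<Omega> x y J ap am \<tau> \<longrightarrow>
      0 < \<tau> \<and> \<tau> < \<epsilon> \<and> (\<exists>s\<in>{0..\<tau>}. ap s \<in> \<Omega>))"
    using x(3) unfolding short_chords_at_def by metis
  obtain L where L: "L-lipschitz_on box (dipole_field Q)"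
    using lipschitz_dipole_field[OF smooth_Q box(1-3)] by auto
  have L0: "L \<ge> 0" using lipschitz_on_nonneg[OF L] .
  obtain M1 where M1: "M1 > 0"
    and stay1: "\<And>x y J ap am d T s. dipole_solution Q x y J ap am \<Longrightarrow> {0..T} \<subseteq> J \<Longrightarrow>
      cball x d \<subseteq> cball p r \<Longrightarrow> cball y d \<subseteq> cball q r \<Longrightarrow> M1 * T < d \<Longrightarrow> s \<in> {0..T} \<Longrightarrow>
      dist (ap s, am s) (x, y) < d"
    using solution_stays_in_box[OF smooth_Q] by metis
  obtain M2 where M2: "M2 > 0"
    and stay2: "\<And>x y J ap am d T s. dipole_solution Q' x y J ap am \<Longrightarrow> {0..T} \<subseteq> J \<Longrightarrow>
      cball x d \<subseteq> cball p r \<Longrightarrow> cball y d \<subseteq> cball q r \<Longrightarrow> M2 * T < d \<Longrightarrow> s \<in> {0..T} \<Longrightarrow>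
      dist (ap s, am s) (x, y) < d"
    using solution_stays_in_box[OF smooth_Q'] by metis
  note M = M1 M2
  define d' where "d' = min (min d (r - dist x p)) \<delta> / 2"
  have "0 < d'" "2 * d' \<le> d" "2 * d' \<le> r - dist x p" "2 * d' \<le> \<delta>"
    using d \<delta> x(1) by (auto simp: d'_def)
  then have d': "0 < d'" "d' < d" "dist x p + d' < r" "d' < \<delta>" by linarith+
  \<comment> \<open>The first two bounds keep both trajectories within \<open>d'\<close> of their
    starts; the third provides the smallness in \<open>forced_difference_vanishes\<close> with
    constants L and \<open>2 * K\<close>.\<close>
  define \<epsilon> where "\<epsilon> = min (min (d' / M1) (d' / M2)) (1 / (4 * (K + 1) * (L + 1)))"
  have \<epsilon>: "0 < \<epsilon>" "M1 * \<epsilon> \<le> d'" "M2 * \<epsilon> \<le> d'" "4 * (K + 1) * (L + 1) * \<epsilon> \<le> 1"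
  proof -
    have KL: "4 * (K + 1) * (L + 1) > 0" using K L0 by simp
    show "0 < \<epsilon>" using d' M KL by (simp add: \<epsilon>_def)
    have "\<epsilon> \<le> d' / M1" "\<epsilon> \<le> d' / M2" "\<epsilon> \<le> 1 / (4 * (K + 1) * (L + 1))" by (auto simp: \<epsilon>_def)
    then show "M1 * \<epsilon> \<le> d'" "M2 * \<epsilon> \<le> d'" "4 * (K + 1) * (L + 1) * \<epsilon> \<le> 1"
      using M KL by (simp_all add: pos_le_divide_eq mult.commute)
  qed
  obtain y where y: "cball y \<delta> \<subseteq> cball q r"
    and chord: "\<And>J ap am \<tau>. exit_solution Q \<Omega> x y J ap am \<tau> \<Longrightarrow>
      0 < \<tau> \<and> \<tau> < \<epsilon> \<and> (\<exists>s\<in>{0..\<tau>}. ap s \<in> \<Omega>)"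
    using chords[OF \<epsilon>(1)] by blast
  have "y \<in> cball y \<delta>" using \<delta> by simp
  then have yq: "y \<in> cball q r" using y by blast
  obtain J ap am \<tau> where ex: "exit_solution Q \<Omega> x y J ap am \<tau>" and et: "exit_time Q \<Omega> x y = ereal \<tau>"
    by (rule exit_time_solution[OF smooth_Q finite_exit[OF x(1,2) yq]])
  obtain s1 where \<tau>: "0 < \<tau>" "\<tau> < \<epsilon>" and s1: "s1 \<in> {0..\<tau>}" "ap s1 \<in> \<Omega>"
    using chord[OF ex] by blast
  have meas: "measurement Q' \<Omega> x y = measurement Q \<Omega> x y" by (rule same_data[OF x(1,2) yq])
  \<comment> \<open>Equal measurements lie in the same summand and share their first component, so
    the exit time for \<open>Q'\<close> is the same \<tau>.\<close>
  have et': "exit_time Q' \<Omega> x y = ereal \<tau>"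
    using meas et unfolding measurement_def Let_def by (auto split: if_splits)
  then have "exit_time Q' \<Omega> x y < \<infinity>" by simp
  from exit_time_solution[OF smooth_Q' this]
  obtain J' ap' am' \<tau>' where "exit_solution Q' \<Omega> x y J' ap' am' \<tau>'" "exit_time Q' \<Omega> x y = ereal \<tau>'" .
  then have ex': "exit_solution Q' \<Omega> x y J' ap' am' \<tau>" using et' by simp
  note sol = ex[unfolded exit_solution_def, THEN conjunct1]
    and sol' = ex'[unfolded exit_solution_def, THEN conjunct1]
  have J: "{0..\<tau>} \<subseteq> J" "{0..\<tau>} \<subseteq> J'" using ex ex' unfolding exit_solution_def by auto
  then have \<tau>J: "\<tau> \<in> J" "\<tau> \<in> J'" using \<tau> by auto
  have start: "ap 0 = x" "am 0 = y" "ap' 0 = x" "am' 0 = y"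
    using sol sol' by (auto simp: dipole_solution_def)
  have cx: "cball x d' \<subseteq> cball p r"
  proof
    fix z assume "z \<in> cball x d'"
    then have "dist z x \<le> d'" by (simp add: dist_commute)
    then show "z \<in> cball p r" using dist_triangle[of z p x] d' by (simp add: dist_commute)
  qed
  have cy: "cball y d' \<subseteq> cball q r" using y d' by (meson cball_subset_cball_iff dual_order.trans less_imp_le subset_cball)
  have M\<tau>: "M1 * \<tau> < d'" "M2 * \<tau> < d'"
    using \<epsilon> \<tau> M mult_strict_left_mono[of \<tau> \<epsilon> M1] mult_strict_left_mono[of \<tau> \<epsilon> M2] by linarith+
  have near: "dist (ap s) x < d'" "dist (am s) y < d'" "dist (ap' s) x < d'" "dist (am' s) y < d'"
    if "s \<in> {0..\<tau>}" for s
    using stay1[OF sol J(1) cx cy M\<tau>(1) that] stay2[OF sol' J(2) cx cy M\<tau>(2) that]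
      dist_fst_le[of "(ap s, am s)" "(x, y)"] dist_snd_le[of "(ap s, am s)" "(x, y)"]
      dist_fst_le[of "(ap' s, am' s)" "(x, y)"] dist_snd_le[of "(ap' s, am' s)" "(x, y)"] by auto
  have inbox: "(ap s, am s) \<in> box" "(ap' s, am' s) \<in> box" if "s \<in> {0..\<tau>}" for s
  proof -
    have "ap s \<in> cball x d'" "am s \<in> cball y d'" "ap' s \<in> cball x d'" "am' s \<in> cball y d'"
      using near[OF that] by (simp_all add: dist_commute)
    then show "(ap s, am s) \<in> box" "(ap' s, am' s) \<in> box"
      using cx cy unfolding box_def by blast+
  qed
  \<comment> \<open>This selects the triple in the measurement, so the data also contain the final
    position of a_-.\<close>
  have "am \<tau> \<notin> \<Omega>"
    using inbox(1)[of \<tau>] \<tau> q_away closure_subset[of \<Omega>] by (auto simp: box_def)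
  then have ends: "ap' \<tau> = ap \<tau>" "am' \<tau> = am \<tau>"
    using meas unfolding measurement_def Let_def et et' real_of_ereal.simps
      dipole_flow_eq[OF smooth_Q sol \<tau>J(1)] dipole_flow_eq[OF smooth_Q' sol' \<tau>J(2)]
    by (auto split: if_splits)
  define E where "E = (\<lambda>s. (ap' s, am' s) - (ap s, am s))"
  define e1 where "e1 = (\<lambda>s. dipole_field Q (ap' s, am' s) - dipole_field Q (ap s, am s))"
  \<comment> \<open>The a_- component of the forcing is zero because \<open>am'\<close> stays in the
    ball where the two potentials have the same \<open>perp_grad\<close>.\<close>
  define e2 where "e2 = (\<lambda>s. (perp_grad D (ap' s), 0 :: real^2))"
  define \<omega> where "\<omega> = (\<lambda>s. s0 * partial j D (ap' s))"
  \<comment> \<open>Applying \<open>perp\<close> to \<open>perp_grad D\<close> gives minus the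
    gradient, so \<open>l (e2 s)\<close> is exactly \<open>s0 * partial j D (ap' s)\<close>.\<close>
  define l where "l = (\<lambda>u :: (real^2) \<times> (real^2). s0 * (- (perp (fst u) $ j)))"
  have field: "dipole_field Q' (ap' s, am' s) - dipole_field Q (ap s, am s) = e1 s + e2 s" if "s \<in> {0..\<tau>}" for s
  proof -
    have b: "perp_grad Q' (am' s) = perp_grad Q (am' s)"
      using same_near_q inbox(2)[OF that] by (auto simp: box_def)
    have a: "perp_grad Q' (ap' s) = perp_grad Q (ap' s) + perp_grad D (ap' s)"
      by (simp add: vec_eq_iff forall_2 partial_D)
    show ?thesis
      by (simp add: e1_def e2_def dipole_field_def vel_plus_def vel_minus_def b a)
  qed
  have clos: "ap' s \<in> closure \<Omega>" if "s \<in> {0..\<tau>}" for s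
    using exit_solution_closure[OF ex' \<tau>(1) that] .
  have dom': "\<bar>partial m D (ap' s)\<bar> \<le> K * \<omega> s" if "s \<in> {0..\<tau>}" for m s
    unfolding \<omega>_def using dom[OF clos[OF that]] near(3)[OF that] d' by simp
  have main: "E s = 0" "\<omega> s = 0" if s: "s \<in> {0..\<tau>}" for s
  proof -
    have hyps: "(E has_vector_derivative (e1 t + e2 t)) (at t)"
      "norm (e1 t) \<le> L * norm (E t)" "norm (e2 t) \<le> (2 * K) * \<omega> t" "0 \<le> \<omega> t" "l (e2 t) = \<omega> t"
      if t: "t \<in> {0..\<tau>}" for t
    proof -
      show "(E has_vector_derivative (e1 t + e2 t)) (at t)"
        unfolding E_def field[OF t, symmetric]
        by (intro has_vector_derivative_diff dipole_solution_pair[OF sol] dipole_solution_pair[OF sol'])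
           (use t J in auto)
      show "norm (e1 t) \<le> L * norm (E t)"
        using lipschitz_onD[OF L inbox(2)[OF t] inbox(1)[OF t]] by (simp add: e1_def E_def dist_norm)
      have "norm (e2 t) = norm (perp_grad D (ap' t))" by (simp add: e2_def)
      also have "\<dots> \<le> \<bar>partial 2 D (ap' t)\<bar> + \<bar>partial 1 D (ap' t)\<bar>"
        using norm_le_l1_cart[of "perp_grad D (ap' t)"] by (simp add: sum_2)
      also have "\<dots> \<le> 2 * K * \<omega> t" using dom'[OF t, of 1] dom'[OF t, of 2] by linarith
      finally show "norm (e2 t) \<le> (2 * K) * \<omega> t" .
      have "0 \<le> K * \<omega> t" using dom'[OF t, of 1] by linarith
      then show "0 \<le> \<omega> t" using K by (simp add: zero_le_mult_iff)
      show "l (e2 t) = \<omega> t"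
        using exhaust_2[of j] by (auto simp: l_def e2_def \<omega>_def)
    qed
    have cont: "continuous_on {0..\<tau>} \<omega>"
    proof (rule continuous_at_imp_continuous_on, rule ballI)
      fix t assume "t \<in> {0..\<tau>}"
      then have "isCont ap' t" using dipole_solution_isCont[OF sol'] J by auto
      moreover have "isCont (partial j D) (ap' t)"
        by (rule smooth_on_isCont[OF smooth_on_partial[OF smooth_D]]) simp
      ultimately have "isCont (\<lambda>t. partial j D (ap' t)) t" by (rule isCont_o2)
      then show "isCont \<omega> t" unfolding \<omega>_def by (intro continuous_mult continuous_const)
    qed
    have "bounded_linear (\<lambda>u :: (real^2) \<times> (real^2). perp (fst u) $ j)"
      using exhaust_2[of j]
      by (auto intro!: bounded_linear_intros bounded_linear_compose[OF bounded_linear_vec_nth bounded_linear_fst]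
          bounded_linear_minus)
    then have lin: "bounded_linear l"
      unfolding l_def by (intro bounded_linear_const_mult bounded_linear_minus)
    have lle: "\<bar>l u\<bar> \<le> norm u" for u
    proof -
      have "\<bar>l u\<bar> = \<bar>perp (fst u) $ j\<bar>" using s0 by (simp add: l_def abs_mult)
      also have "\<dots> \<le> norm (fst u)"
        using exhaust_2[of j] component_le_norm_cart[of "fst u" 1] component_le_norm_cart[of "fst u" 2] by auto
      also have "\<dots> \<le> norm u" by (metis norm_fst_le prod.collapse)
      finally show ?thesis .
    qed
    have KL\<tau>: "4 * (K + 1) * (L + 1) * \<tau> < 1"
    proof -
      have "4 * (K + 1) * (L + 1) * \<tau> < 4 * (K + 1) * (L + 1) * \<epsilon>"
        using \<tau> K L0 by (intro mult_strict_left_mono) auto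
      then show ?thesis using \<epsilon> by linarith
    qed
    have expand: "4 * (K + 1) * (L + 1) * \<tau> = 4 * K * L * \<tau> + 4 * K * \<tau> + 4 * (L * \<tau>) + 4 * \<tau>"
      by (simp add: algebra_simps)
    have nn: "0 \<le> K * L * \<tau>" "0 \<le> K * \<tau>" "0 \<le> L * \<tau>" using K L0 \<tau> by simp_all
    have s1': "L * \<tau> \<le> 1/2" using KL\<tau> nn \<tau> unfolding expand by linarith
    have s2': "2 * (2 * K) * L * \<tau> < 1" using KL\<tau> nn \<tau> unfolding expand by linarith
    have K2: "0 \<le> 2 * K" using K by simp
    have E0: "E 0 = 0" "E \<tau> = 0" using start ends by (simp_all add: E_def zero_prod_def)
    show "E s = 0" "\<omega> s = 0"
      using forced_difference_vanishes[of \<tau> E e1 e2 L "2 * K" \<omega> l s, OF \<tau>(1) hyps(1-3) cont hyps(4) lin lle hyps(5) E0 L0 K2 s1' s2' s]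
      by auto
  qed
  \<comment> \<open>The point in \<Omega> is known for the trajectory of Q; the coincidence of the
    two trajectories transfers it to that of \<open>Q'\<close>, along which \<omega> is
    measured.\<close>
  have "ap' s1 = ap s1" using main(1)[OF s1(1)] by (simp add: E_def zero_prod_def)
  then have "0 < \<omega> s1"
    unfolding \<omega>_def using pos[of "ap' s1"] s1 near(3)[OF s1(1)] d' by auto
  then show False using main(2)[OF s1(1)] by simp
qed

section \<open>Jets of the difference along the boundary\<close>

text \<open>\<rho> vanishes at x and is Lipschitz, so the displacement h to the boundary is at most
  a multiple of the distance to x. Thus the foot points of z tend to x with z.\<close>

lemma foot_near:
  assumes x: "dist x p < r" "\<rho> x = 0"
  shows "\<exists>B\<ge>0. \<exists>d>0. \<forall>z. dist z x < d \<longrightarrow> (\<exists>h. \<bar>h\<bar> \<le> B * dist z x \<and>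
    \<rho> (z + (\<sigma> * h) *\<^sub>R axis i 1) = 0 \<and> (z \<in> closure \<Omega> \<longrightarrow> 0 \<le> h) \<and> (z \<in> \<Omega> \<longrightarrow> 0 < h))"
proof -
  obtain B where B: "B \<ge> 0" "\<And>a b. a \<in> cball p r \<Longrightarrow> b \<in> cball p r \<Longrightarrow> \<bar>\<rho> a - \<rho> b\<bar> \<le> B * dist a b"
    using \<rho>_lipschitz by metis
  define d where "d = (r - dist x p) / (1 + B / c)"
  have Bc: "B / c \<ge> 0" using B c by simp
  have "d > 0" using x Bc by (auto simp: d_def intro!: divide_pos_pos)
  moreover have "(1 + B / c) * d = r - dist x p" using Bc by (simp add: d_def)
  ultimately have d: "d > 0" "d + B / c * d \<le> r - dist x p" by (simp_all add: distrib_right)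
  show ?thesis
  proof (rule exI[of _ "B / c"], intro conjI Bc, rule exI[of _ d], intro conjI d(1) allI impI)
    fix z assume z: "dist z x < d"
    have xr: "x \<in> cball p r" using x by (simp add: dist_commute)
    have Bcd: "B / c * dist z x \<le> B / c * d" using z Bc by (intro mult_left_mono) auto
    have "0 \<le> B / c * d" by (rule mult_nonneg_nonneg[OF Bc]) (use d in simp)
    then have zp: "dist z p \<le> r" using dist_triangle[of z p x] z d(2) by linarith
    then have zr: "z \<in> cball p r" by (simp add: dist_commute)
    then have zV: "z \<in> V" using ball_V by auto
    have "\<bar>\<rho> z\<bar> \<le> B * dist z x" using B(2)[OF zr xr] x by simp
    then have \<rho>z: "\<bar>\<rho> z\<bar> / c \<le> B / c * dist z x" using c by (simp add: divide_right_mono)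
    then have "dist z p + \<bar>\<rho> z\<bar> / c \<le> r"
      using dist_triangle[of z p x] z d(2) Bcd by linarith
    from foot_point[OF this] \<rho>z
    show "\<exists>h. \<bar>h\<bar> \<le> B / c * dist z x \<and> \<rho> (z + (\<sigma> * h) *\<^sub>R axis i 1) = 0 \<and>
        (z \<in> closure \<Omega> \<longrightarrow> 0 \<le> h) \<and> (z \<in> \<Omega> \<longrightarrow> 0 < h)"
      using in_closure[OF zV] in_\<Omega>[OF zV] by (meson order_trans)
  qed
qed

text \<open>At the least non-vanishing order n, Taylor expansion at the foot of z shows that each
  first partial of D at z is \<open>h ^ n\<close> times a nearly constant factor. Since h is
  nonnegative on the closure and positive in \<Omega>, the largest component has a sign and
  dominates the other, which \<open>gradient_not_one_sided\<close> excludes.\<close>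

lemma normal_jets_vanish:
  assumes near: "\<And>x. dist x x0 < r' \<Longrightarrow> \<rho> x = 0 \<Longrightarrow> dist x p < r \<and> short_chords_at x"
    and x: "dist x x0 < r'" "\<rho> x = 0"
  shows "(partial i ^^ k) (partial j D) x = 0"
proof (rule ccontr)
  assume "\<not> ?thesis"
  \<comment> \<open>Minimality is taken over all boundary points of the disc, not at one point,
    because the lower derivatives must vanish at the feet of nearby points. The point x obtained
    below is one where order n is attained and replaces the given one.\<close>
  then have "\<exists>k. \<exists>j x. dist x x0 < r' \<and> \<rho> x = 0 \<and> (partial i ^^ k) (partial j D) x \<noteq> 0"
    using x by blast
  then obtain n where n: "\<exists>j x. dist x x0 < r' \<and> \<rho> x = 0 \<and> (partial i ^^ n) (partial j D) x \<noteq> 0"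
    and least: "\<And>k. k < n \<Longrightarrow> \<not> (\<exists>j x. dist x x0 < r' \<and> \<rho> x = 0 \<and> (partial i ^^ k) (partial j D) x \<noteq> 0)"
    using exists_least_iff[of "\<lambda>k. \<exists>j x. dist x x0 < r' \<and> \<rho> x = 0 \<and> (partial i ^^ k) (partial j D) x \<noteq> 0"]
    by blast
  obtain j1 x where x: "dist x x0 < r'" "\<rho> x = 0" "(partial i ^^ n) (partial j1 D) x \<noteq> 0"
    using n by blast
  define F where "F = (\<lambda>m. (partial i ^^ n) (partial m D))"
  have contF: "isCont (F m) x" for m
    unfolding F_def
    by (intro smooth_on_isCont[of UNIV] smooth_on_partial_funpow smooth_on_partial smooth_D) auto
  \<comment> \<open>The component with the larger n-th derivative at x dominates the
    gradient.\<close>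
  have "\<exists>j. \<forall>m. \<bar>F m x\<bar> \<le> \<bar>F j x\<bar>"
    by (rule exI[of _ "if \<bar>F 1 x\<bar> \<le> \<bar>F 2 x\<bar> then 2 else 1"]) (auto simp: forall_2)
  then obtain j where j: "\<And>m. \<bar>F m x\<bar> \<le> \<bar>F j x\<bar>" by blast
  define A where "A = \<bar>F j x\<bar>"
  have A: "A > 0" using j[of j1] x(3) by (simp add: A_def F_def)
  have "\<exists>d>0. \<forall>z. dist z x < d \<longrightarrow> \<bar>F m z - F m x\<bar> < A / 2" for m
    using contF[of m] A unfolding continuous_at_eps_delta dist_real_def by (meson half_gt_zero)
  then obtain dm where dm: "\<And>m. dm m > 0" "\<And>m z. dist z x < dm m \<Longrightarrow> \<bar>F m z - F m x\<bar> < A / 2"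
    by metis
  define d1 where "d1 = min (dm 1) (dm 2)"
  have d1: "d1 > 0" "\<And>m z. dist z x < d1 \<Longrightarrow> \<bar>F m z - F m x\<bar> < A / 2"
  proof -
    show "d1 > 0" using dm(1) by (simp add: d1_def)
    show "\<bar>F m z - F m x\<bar> < A / 2" if "dist z x < d1" for m z
      using exhaust_2[of m] dm(2)[of z m] that by (auto simp: d1_def)
  qed
  have xp: "dist x p < r" and chords: "short_chords_at x" using near[OF x(1,2)] by auto
  obtain B d2 where B: "B \<ge> 0" "d2 > 0" and foot: "\<And>z. dist z x < d2 \<Longrightarrow> \<exists>h. \<bar>h\<bar> \<le> B * dist z x \<and>
      \<rho> (z + (\<sigma> * h) *\<^sub>R axis i 1) = 0 \<and> (z \<in> closure \<Omega> \<longrightarrow> 0 \<le> h) \<and> (z \<in> \<Omega> \<longrightarrow> 0 < h)"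
    using foot_near[OF xp x(2)] by metis
  \<comment> \<open>The foot lies within \<open>(1 + B) * d3\<close> of x and the intermediate
    Taylor point within \<open>(1 + 2 * B) * d3\<close>; the former must stay in the disc around
    \<open>x0\<close>, the latter where F is within \<open>A / 2\<close> of its value at x.\<close>
  define d3 where "d3 = min d2 (min d1 (r' - dist x x0) / (1 + 2 * B))"
  have mn: "min d1 (r' - dist x x0) > 0" using d1 x by simp
  have d3: "d3 > 0" "d3 \<le> d2" "(1 + 2 * B) * d3 \<le> d1" "(1 + 2 * B) * d3 \<le> r' - dist x x0"
  proof -
    have "min d1 (r' - dist x x0) / (1 + 2 * B) > 0" using mn B by (intro divide_pos_pos) auto
    then show "d3 > 0" using B by (simp add: d3_def)
    show "d3 \<le> d2" by (simp add: d3_def)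
    have "(1 + 2 * B) * d3 \<le> (1 + 2 * B) * (min d1 (r' - dist x x0) / (1 + 2 * B))"
      using B by (intro mult_left_mono) (auto simp: d3_def)
    also have "\<dots> = min d1 (r' - dist x x0)" using B by simp
    finally show "(1 + 2 * B) * d3 \<le> d1" "(1 + 2 * B) * d3 \<le> r' - dist x x0" by auto
  qed
  have local: "\<exists>h. (z \<in> closure \<Omega> \<longrightarrow> 0 \<le> h) \<and> (z \<in> \<Omega> \<longrightarrow> 0 < h) \<and>
      (\<forall>m. \<exists>\<zeta>. \<bar>\<zeta> - F m x\<bar> < A / 2 \<and> partial m D z = \<zeta> / fact n * ((- \<sigma>) ^ n * h ^ n))"
    if z: "dist z x < d3" for z
  proof -
    obtain h where h: "\<bar>h\<bar> \<le> B * dist z x" "\<rho> (z + (\<sigma> * h) *\<^sub>R axis i 1) = 0"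
      "z \<in> closure \<Omega> \<longrightarrow> 0 \<le> h" "z \<in> \<Omega> \<longrightarrow> 0 < h"
      using foot[of z] z d3 by auto
    define b where "b = z + (\<sigma> * h) *\<^sub>R axis i 1"
    have "B * dist z x \<le> B * d3" using z B by (intro mult_left_mono) auto
    then have hB: "\<bar>h\<bar> \<le> B * d3" using h(1) by linarith
    have bz: "dist b z = \<bar>h\<bar>" using norm_foot[of h] by (simp add: b_def dist_norm)
    have "dist b x < d3 + B * d3" using dist_triangle[of b x z] bz hB z by linarith
    moreover have Bd: "0 \<le> B * d3" using B d3 by simp
    ultimately have "dist b x0 < r'"
      using dist_triangle[of b x0 x] d3(4) by (simp add: algebra_simps)
    then have vanish: "(partial i ^^ k) (partial m D) b = 0" if "k < n" for k m
      using least[OF that] h(2) unfolding b_def by blast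
    have zb: "z = b + (- (\<sigma> * h)) *\<^sub>R axis i 1" by (simp add: b_def)
    have "\<exists>\<zeta>. \<bar>\<zeta> - F m x\<bar> < A / 2 \<and> partial m D z = \<zeta> / fact n * ((- \<sigma>) ^ n * h ^ n)" for m
    proof -
      obtain t where t: "\<bar>t\<bar> \<le> \<bar>- (\<sigma> * h)\<bar>"
        "partial m D (b + (- (\<sigma> * h)) *\<^sub>R axis i 1) = (partial i ^^ n) (partial m D) (b + t *\<^sub>R axis i 1) / fact n * (- (\<sigma> * h)) ^ n"
        using partial_taylor[OF smooth_on_partial[OF smooth_D], of n i m b "- (\<sigma> * h)"] vanish by blast
      have "dist (b + t *\<^sub>R axis i 1) x \<le> dist b x + \<bar>t\<bar>"
        using dist_triangle[of "b + t *\<^sub>R axis i 1" x b] by (simp add: dist_norm norm_axis_1)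
      also have "\<bar>t\<bar> \<le> \<bar>h\<bar>" using t(1) \<sigma> by (simp add: abs_mult)
      finally have "dist (b + t *\<^sub>R axis i 1) x < d1"
        using \<open>dist b x < d3 + B * d3\<close> hB d3(3) by (simp add: algebra_simps)
      from d1(2)[OF this, of m] t(2) show ?thesis
        unfolding zb[symmetric] F_def
        by (intro exI[of _ "(partial i ^^ n) (partial m D) (b + t *\<^sub>R axis i 1)"])
           (simp add: power_mult_distrib[symmetric])
    qed
    then show ?thesis using h(3,4) by blast
  qed
  \<comment> \<open>The power cancels the factor \<open>(- \<sigma>) ^ n\<close> produced by
    expanding from the foot inwards, and the sign makes the remaining coefficient positive.\<close>
  define s0 where "s0 = sgn (F j x) * (- \<sigma>) ^ n"
  have s\<sigma>: "(- \<sigma>) ^ n * (- \<sigma>) ^ n = 1"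
  proof -
    have "(- \<sigma>) * (- \<sigma>) = 1" using \<sigma> by (metis abs_mult_self_eq minus_mult_minus mult_1)
    then show ?thesis by (metis power_mult_distrib power_one)
  qed
  have sgn: "sgn (F j x) * F j x = A" "\<bar>sgn (F j x)\<bar> = 1"
    using A by (auto simp: A_def sgn_if)
  have s0: "\<bar>s0\<bar> = 1" using sgn \<sigma> by (simp add: s0_def abs_mult power_abs)
  \<comment> \<open>The constant 3 is the ratio of the bounds \<open>3 / 2 * A\<close> above and
    \<open>A / 2\<close> below for the Taylor coefficients.\<close>
  have dom: "\<bar>partial m D z\<bar> \<le> 3 * (s0 * partial j D z) \<and> (z \<in> \<Omega> \<longrightarrow> 0 < s0 * partial j D z)"
    if z: "z \<in> closure \<Omega>" "dist z x < d3" for z m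
  proof -
    obtain h where h: "0 \<le> h" "z \<in> \<Omega> \<longrightarrow> 0 < h"
      and ex: "\<forall>m. \<exists>\<zeta>. \<bar>\<zeta> - F m x\<bar> < A / 2 \<and> partial m D z = \<zeta> / fact n * ((- \<sigma>) ^ n * h ^ n)"
      using local[OF z(2)] z(1) by blast
    obtain \<zeta> where \<zeta>: "\<bar>\<zeta> - F m x\<bar> < A / 2" "partial m D z = \<zeta> / fact n * ((- \<sigma>) ^ n * h ^ n)"
      using ex by blast
    obtain \<xi> where \<xi>: "\<bar>\<xi> - F j x\<bar> < A / 2" "partial j D z = \<xi> / fact n * ((- \<sigma>) ^ n * h ^ n)"
      using ex by blast
    define H where "H = h ^ n / fact n"
    have H: "0 \<le> H" "z \<in> \<Omega> \<longrightarrow> 0 < H" using h by (auto simp: H_def)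
    have "\<bar>partial m D z\<bar> = \<bar>\<zeta>\<bar> * H"
      using \<sigma> h(1) by (simp add: \<zeta>(2) H_def abs_mult power_abs)
    also have "\<dots> \<le> (3 / 2 * A) * H"
    proof (rule mult_right_mono[OF _ H(1)])
      have "\<bar>\<zeta>\<bar> \<le> \<bar>F m x\<bar> + \<bar>\<zeta> - F m x\<bar>" by linarith
      then show "\<bar>\<zeta>\<bar> \<le> 3 / 2 * A" using \<zeta>(1) j[of m] unfolding A_def[symmetric] by linarith
    qed
    finally have 1: "\<bar>partial m D z\<bar> \<le> (3 / 2 * A) * H" .
    have "s0 * partial j D z = (sgn (F j x) * \<xi>) * H * ((- \<sigma>) ^ n * (- \<sigma>) ^ n)"
      by (simp add: s0_def \<xi>(2) H_def)
    then have 2: "s0 * partial j D z = (sgn (F j x) * \<xi>) * H" unfolding s\<sigma> by simp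
    have "\<bar>sgn (F j x) * (\<xi> - F j x)\<bar> < A / 2" using \<xi>(1) sgn(2) by (simp add: abs_mult)
    moreover have "sgn (F j x) * (\<xi> - F j x) = sgn (F j x) * \<xi> - A" using sgn(1) by (simp add: algebra_simps)
    ultimately have 3: "A / 2 < sgn (F j x) * \<xi>" by linarith
    then have "(A / 2) * H \<le> s0 * partial j D z"
      unfolding 2 using H by (intro mult_right_mono) auto
    moreover have "0 < s0 * partial j D z" if "z \<in> \<Omega>"
    proof -
      have "0 < sgn (F j x) * \<xi>" using 3 A by linarith
      then show ?thesis unfolding 2 using H(2) that by (intro mult_pos_pos[of "sgn (F j x) * \<xi>"]) auto
    qed
    ultimately show ?thesis using 1 by auto
  qed
  show False
  proof (rule gradient_not_one_sided[OF xp x(2) chords s0 _ d3(1)])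
    show "0 < (3::real)" by simp
    show "\<bar>partial m D z\<bar> \<le> 3 * (s0 * partial j D z)" if "z \<in> closure \<Omega>" "dist z x < d3" for z m
      using dom[OF that] by blast
    show "0 < s0 * partial j D z" if "z \<in> \<Omega>" "dist z x < d3" for z
      using dom[of z 1] that closure_subset by blast
  qed
qed

text \<open>A function all of whose derivatives in the transversal direction vanish along the boundary
  is \<open>o(\<bar>z - x\<bar>)\<close> at each boundary point, so the other first partial vanishes as well.\<close>

lemma flat_partial:
  assumes f: "smooth_on UNIV f" and near: "\<And>x. dist x x0 < r' \<Longrightarrow> \<rho> x = 0 \<Longrightarrow> dist x p < r"
    and flat: "\<And>k x. dist x x0 < r' \<Longrightarrow> \<rho> x = 0 \<Longrightarrow> (partial i ^^ k) f x = 0"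
    and x: "dist x x0 < r'" "\<rho> x = 0"
  shows "(partial i ^^ k) (partial m f) x = 0"
proof -
  define g where "g = (partial i ^^ k) f"
  have g: "smooth_on UNIV g" unfolding g_def by (rule smooth_on_partial_funpow[OF f])
  have g0: "g z = 0" "partial i g z = 0" if "dist z x0 < r'" "\<rho> z = 0" for z
    using flat[OF that, of k] flat[OF that, of "Suc k"] by (simp_all add: g_def)
  obtain B d2 where B: "B \<ge> 0" "d2 > 0" and foot: "\<And>z. dist z x < d2 \<Longrightarrow> \<exists>h. \<bar>h\<bar> \<le> B * dist z x \<and>
      \<rho> (z + (\<sigma> * h) *\<^sub>R axis i 1) = 0"
    using foot_near[OF near[OF x] x(2)] by metis
  have "(g has_derivative (\<lambda>h. 0)) (at x)"
    unfolding has_derivative_at_alt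
  proof (intro conjI allI impI)
    fix e :: real assume e: "e > 0"
    have "isCont (partial i g) x" by (rule smooth_on_isCont[OF smooth_on_partial[OF g]]) simp
    moreover have "e / (B + 1) > 0" using e B by simp
    ultimately obtain d1 where d1: "d1 > 0" "\<And>z. dist z x < d1 \<Longrightarrow> \<bar>partial i g z\<bar> < e / (B + 1)"
      using g0(2)[OF x] unfolding continuous_at_eps_delta dist_real_def by (metis diff_zero)
    define d3 where "d3 = min d2 (min d1 (r' - dist x x0) / (1 + 2 * B))"
    have mn: "min d1 (r' - dist x x0) > 0" using d1 x by simp
    have d3: "d3 > 0" "d3 \<le> d2" "(1 + 2 * B) * d3 \<le> d1" "(1 + 2 * B) * d3 \<le> r' - dist x x0"
    proof -
      have "min d1 (r' - dist x x0) / (1 + 2 * B) > 0" using mn B by (intro divide_pos_pos) auto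
      then show "d3 > 0" using B by (simp add: d3_def)
      show "d3 \<le> d2" by (simp add: d3_def)
      have "(1 + 2 * B) * d3 \<le> (1 + 2 * B) * (min d1 (r' - dist x x0) / (1 + 2 * B))"
        using B by (intro mult_left_mono) (auto simp: d3_def)
      also have "\<dots> = min d1 (r' - dist x x0)" using B by simp
      finally show "(1 + 2 * B) * d3 \<le> d1" "(1 + 2 * B) * d3 \<le> r' - dist x x0" by auto
    qed
    have "norm (g z - g x - 0) \<le> e * norm (z - x)" if z: "norm (z - x) < d3" for z
    proof -
      have zx: "dist z x < d3" using z by (simp add: dist_norm)
      obtain h where h: "\<bar>h\<bar> \<le> B * dist z x" "\<rho> (z + (\<sigma> * h) *\<^sub>R axis i 1) = 0"
        using foot[of z] zx d3 by auto
      define b where "b = z + (\<sigma> * h) *\<^sub>R axis i 1"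
      have "B * dist z x \<le> B * d3" using zx B by (intro mult_left_mono) auto
      then have hB: "\<bar>h\<bar> \<le> B * d3" using h(1) by linarith
      have bz: "dist b z = \<bar>h\<bar>" using norm_foot[of h] by (simp add: b_def dist_norm)
      have bx: "dist b x < d3 + B * d3" using dist_triangle[of b x z] bz hB zx by linarith
      moreover have Bd: "0 \<le> B * d3" using B d3 by simp
      ultimately have b0: "dist b x0 < r'"
        using dist_triangle[of b x0 x] d3(4) by (simp add: algebra_simps)
      \<comment> \<open>First-order expansion from the foot b, where g vanishes: \<open>g z\<close>
        is h times a value of \<open>partial i g\<close> near x, which is small since
        \<open>partial i g\<close> is continuous and zero at x.\<close>
      obtain t where t: "\<bar>t\<bar> \<le> \<bar>- (\<sigma> * h)\<bar>"
        "g (b + (- (\<sigma> * h)) *\<^sub>R axis i 1) = (partial i ^^ 1) g (b + t *\<^sub>R axis i 1) / fact 1 * (- (\<sigma> * h)) ^ 1"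
        using partial_taylor[OF g, of 1 i b "- (\<sigma> * h)"] g0(1)[OF b0] h(2) by (auto simp: b_def)
      have th: "\<bar>t\<bar> \<le> \<bar>h\<bar>" using t(1) \<sigma> by (simp add: abs_mult)
      have "dist (b + t *\<^sub>R axis i 1) x \<le> dist b x + \<bar>t\<bar>"
        using dist_triangle[of "b + t *\<^sub>R axis i 1" x b] by (simp add: dist_norm norm_axis_1)
      then have "dist (b + t *\<^sub>R axis i 1) x < d1"
        using bx hB d3(3) th by (simp add: algebra_simps)
      then have le: "\<bar>partial i g (b + t *\<^sub>R axis i 1)\<bar> \<le> e / (B + 1)" using d1(2) less_imp_le by blast
      have "g z = partial i g (b + t *\<^sub>R axis i 1) * (- (\<sigma> * h))"
        using t(2) by (simp add: b_def)
      then have "\<bar>g z\<bar> = \<bar>partial i g (b + t *\<^sub>R axis i 1)\<bar> * \<bar>h\<bar>"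
        using \<sigma> by (simp add: abs_mult)
      also have "\<dots> \<le> e / (B + 1) * (B * dist z x)"
        using le h(1) e B by (intro mult_mono) auto
      also have "\<dots> = e * dist z x * (B / (B + 1))" by simp
      also have "\<dots> \<le> e * dist z x * 1" using B e by (intro mult_left_mono) auto
      finally show ?thesis using g0(1)[OF x] by (simp add: dist_norm)
    qed
    then show "\<exists>d>0. \<forall>y. norm (y - x) < d \<longrightarrow> norm (g y - g x - 0) \<le> e * norm (y - x)"
      using d3(1) by blast
  qed simp
  then have "partial m g x = 0"
    unfolding dir_deriv_def by (metis frechet_derivative_at)
  then show ?thesis
    unfolding g_def using partial_funpow_commute[OF f] by metis
qed

text \<open>Vanishing of all i-derivatives along the boundary is inherited by every partial
  derivative, by \<open>flat_partial\<close>, so induction over the list applies. The first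
  derivative must be split off since only the gradient of D is controlled, not D itself; hence the
  nonempty list.\<close>

lemma all_partials_vanish:
  assumes near: "\<And>x. dist x x0 < r' \<Longrightarrow> \<rho> x = 0 \<Longrightarrow> dist x p < r \<and> short_chords_at x"
    and x0: "0 < r'" "\<rho> x0 = 0" and bs: "bs \<noteq> []" "set bs \<subseteq> Basis"
  shows "fold dir_deriv bs D x0 = 0"
proof -
  have nearp: "dist x p < r" if "dist x x0 < r'" "\<rho> x = 0" for x using near[OF that] by blast
  have gen: "fold dir_deriv bs f x0 = 0"
    if "set bs \<subseteq> Basis" "smooth_on UNIV f" "\<And>k x. dist x x0 < r' \<Longrightarrow> \<rho> x = 0 \<Longrightarrow> (partial i ^^ k) f x = 0"
    for bs f
    using that
  proof (induction bs arbitrary: f)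
    case Nil
    then show ?case using Nil.prems(3)[of x0 0] x0 by simp
  next
    case (Cons b bs)
    then obtain m where b: "b = axis m 1" by (auto simp: Basis_real2)
    have "(partial i ^^ k) (partial m f) x = 0" if "dist x x0 < r'" "\<rho> x = 0" for k x
      by (rule flat_partial[OF Cons.prems(2) nearp Cons.prems(3) that])
    then have "fold dir_deriv bs (partial m f) x0 = 0"
      using Cons.IH[of "partial m f"] Cons.prems smooth_on_partial by auto
    then show ?case by (simp add: b)
  qed
  obtain b bs' where bb: "bs = b # bs'" using bs by (cases bs) auto
  then obtain m where b: "b = axis m 1" using bs by (auto simp: Basis_real2)
  have "fold dir_deriv bs' (partial m D) x0 = 0"
  proof (rule gen)
    show "set bs' \<subseteq> Basis" using bs bb by auto
    show "smooth_on UNIV (partial m D)" by (rule smooth_on_partial[OF smooth_D])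
    show "(partial i ^^ k) (partial m D) x = 0" if "dist x x0 < r'" "\<rho> x = 0" for k x
      by (rule normal_jets_vanish[OF near that])
  qed
  then show ?thesis by (simp add: bb b)
qed

end

section \<open>Boundary determination\<close>

text \<open>\<open>fold\<close> applies the head of the list first, so the inner derivatives in the
  second coordinate come first.\<close>

lemma multi_partial_fold:
  "multi_partial \<alpha> f = fold dir_deriv (replicate (\<alpha> $ 2) (axis 2 1) @ replicate (\<alpha> $ 1) (axis 1 1)) f"
proof -
  have "fold dir_deriv (replicate n b) g = (dir_deriv b ^^ n) g" for n b and g :: "real^2 \<Rightarrow> real"
    by (induction n arbitrary: g) (simp_all add: funpow_swap1)
  then show ?thesis by (simp add: multi_partial_def)
qed

theorem theorem1p1:
  fixes Q :: "real^2 \<Rightarrow> real" and \<Omega> U :: "(real^2) set" and p :: "real^2"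
  assumes "smooth_on UNIV Q"
    and "open \<Omega>" and "bounded \<Omega>" and "convex \<Omega>" and "smooth_boundary \<Omega>"
    and "open U" and "closure \<Omega> \<subseteq> U" and "tubular_neighborhood \<Omega> (U - \<Omega>)"
    and "admissible_potential \<Omega> U Q"
    and "p \<in> frontier \<Omega>" and "strictly_convex_at \<Omega> Q p"
  shows "\<exists>\<Omega>' W. open \<Omega>' \<and> closure \<Omega> \<subseteq> \<Omega>' \<and> open W \<and> p \<in> W \<and> W \<subseteq> U \<and> W - closure \<Omega>' \<noteq> {} \<and>
    (\<forall>Q' :: real^2 \<Rightarrow> real.
      smooth_on UNIV Q' \<and> admissible_potential \<Omega> U Q' \<and> strictly_convex_at \<Omega> Q' p \<and>
      (\<forall>x. x \<notin> \<Omega>' \<longrightarrow> Q' x = Q x) \<and>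
      (\<forall>x\<in>W \<inter> frontier \<Omega>. \<forall>y\<in>W - \<Omega>. x \<noteq> y \<longrightarrow> measurement Q' \<Omega> x y = measurement Q \<Omega> x y)
      \<longrightarrow> (\<forall>\<alpha>. multi_order \<alpha> \<ge> 1 \<longrightarrow> multi_partial \<alpha> Q' p = multi_partial \<alpha> Q p))"
proof -
  note Q = assms(1)
  have p_cl: "p \<in> closure \<Omega>" using assms(10) by (simp add: frontier_def)
  then have p_U: "p \<in> U" using assms(7) by blast
  obtain V \<rho> where def: "defining_function \<Omega> p V \<rho>"
    using assms(5,10) unfolding smooth_boundary_def by blast
  then have V: "open V" "p \<in> V" "smooth_on V \<rho>" "grad \<rho> p \<noteq> 0"
    and \<Omega>V: "\<And>z. z \<in> V \<Longrightarrow> z \<in> \<Omega> \<longleftrightarrow> \<rho> z < 0"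
    unfolding defining_function_def by blast+
  have \<rho>p: "\<rho> p = 0" using defining_function_frontier[OF def V(2) assms(2)] assms(10) by simp
  obtain C where C: "open C" "p \<in> C" and convex: "\<And>q. q \<in> C - \<Omega> \<Longrightarrow> q \<noteq> p \<Longrightarrow>
      tangent_to_boundary \<Omega> p (vector_derivative (\<lambda>s. a_plus Q s p q) (at 0)) \<Longrightarrow>
      \<exists>\<delta>>0. \<forall>s\<in>{-\<delta><..<\<delta>} - {0}. s \<in> dipole_domain Q p q \<and> a_plus Q s p q \<notin> closure \<Omega>"
    using assms(11) unfolding strictly_convex_at_def by blast
  have "open (C \<inter> U)" "p \<in> C \<inter> U" using C assms(6) p_U by auto
  then obtain \<eta> where \<eta>: "\<eta> > 0" "ball p \<eta> \<subseteq> C \<inter> U" by (meson openE)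
  obtain q where q: "dist q p < \<eta>" "q \<noteq> p" "q \<in> V" "0 < \<rho> q" "normal_rate \<rho> Q (p, q) = 0"
    using tangent_start_exists[OF V(3,1,2) \<rho>p V(4) \<eta>(1)] by blast
  have q_out: "q \<notin> closure \<Omega>" using defining_function_closure[OF def q(3)] q(4) by simp
  then have q_\<Omega>: "q \<notin> \<Omega>" using closure_subset by blast
  have qCU: "q \<in> C" "q \<in> U" using \<eta>(2) q(1) by (auto simp: dist_commute subset_iff)

  have fin: "exit_time Q \<Omega> x y < \<infinity>" if "x \<in> frontier \<Omega>" "y \<in> U - \<Omega>" "x \<noteq> y" for x y
    using assms(9) that unfolding admissible_potential_def by blast
  \<comment> \<open>Existence of a solution from \<open>(p, q)\<close> is extracted from the finite
    exit time.\<close>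
  obtain J ap am \<tau> where "exit_solution Q \<Omega> p q J ap am \<tau>"
    by (rule exit_time_solution[OF Q fin[OF assms(10), of q]]) (use qCU q q_\<Omega> in auto)
  then have sol: "dipole_solution Q p q J ap am" by (simp add: exit_solution_def)
  have J: "open J" "0 \<in> J" "ap 0 = p" "am 0 = q" using sol by (auto simp: dipole_solution_def)
  have "(ap has_vector_derivative vel_plus Q p q) (at 0)"
    using sol J unfolding dipole_solution_def vel_plus_def by metis
  then have "((\<lambda>s. a_plus Q s p q) has_vector_derivative vel_plus Q p q) (at 0)"
    by (rule has_vector_derivative_transform_within_open[OF _ J(1,2)])
       (simp add: dipole_flow_eq[OF Q sol])
  then have "vector_derivative (\<lambda>s. a_plus Q s p q) (at 0) = vel_plus Q p q"
    by (rule vector_derivative_at)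
  \<comment> \<open>This starts the trajectory to which strict convexity at p applies.\<close>
  moreover have "tangent_to_boundary \<Omega> p (vel_plus Q p q)"
    using def q(5) unfolding tangent_to_boundary_def normal_rate_eq by blast
  ultimately obtain \<delta> where \<delta>: "\<delta> > 0"
    "\<And>s. s \<in> {-\<delta><..<\<delta>} - {0} \<Longrightarrow> a_plus Q s p q \<notin> closure \<Omega>"
    using convex[of q] qCU q q_\<Omega> by fastforce
  obtain \<delta>' where \<delta>': "\<delta>' > 0" "ball 0 \<delta>' \<subseteq> J" using J(1,2) by (meson openE)
  define d where "d = min \<delta> \<delta>' / 2"
  have d: "0 < d" using \<delta>(1) \<delta>'(1) by (simp add: d_def)
  have outside: "s \<in> J \<and> ap s \<notin> closure \<Omega>" if "0 < s" "s \<le> d" for s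
  proof -
    have s: "s < \<delta>" "s < \<delta>'" using that \<delta>(1) \<delta>'(1) by (auto simp: d_def)
    then have "s \<in> J" using \<delta>'(2) that by (auto simp: subset_iff)
    moreover have "a_plus Q s p q \<notin> closure \<Omega>" using \<delta>(2)[of s] s that by simp
    ultimately show ?thesis using dipole_flow_eq(1)[OF Q sol] by metis
  qed

  have "open (U \<inter> - closure \<Omega>)" "q \<in> U \<inter> - closure \<Omega>" using assms(6) qCU q_out by auto
  then obtain b where b: "b > 0" "cball q b \<subseteq> U \<inter> - closure \<Omega>" by (meson open_contains_cball)

  obtain i where i: "partial i \<rho> p \<noteq> 0"
    using V(4) by (auto simp: vec_eq_iff forall_2)
  define \<sigma> c where "\<sigma> = sgn (partial i \<rho> p)" and "c = \<bar>partial i \<rho> p\<bar> / 2"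
  have \<sigma>: "\<bar>\<sigma>\<bar> = 1" "\<sigma> * partial i \<rho> p = 2 * c" using i by (auto simp: \<sigma>_def c_def sgn_if)
  have c: "c > 0" using i by (simp add: c_def)
  have "isCont (partial i \<rho>) p" by (rule smooth_on_isCont[OF smooth_on_partial[OF V(3)] V(2)])
  then obtain r1 where r1: "r1 > 0" "\<And>x. dist x p < r1 \<Longrightarrow> \<bar>partial i \<rho> x - partial i \<rho> p\<bar> < c"
    using c unfolding continuous_at_eps_delta dist_real_def by metis
  obtain r2 where r2: "r2 > 0" "ball p r2 \<subseteq> V" using V(1,2) by (meson openE)
  \<comment> \<open>The final halving makes all bounds strict: the ball at p stays in V and in the
    region of transversality, the ball at q inside the open ball of radius b, and the two balls are
    disjoint.\<close>
  define r where "r = min (min r1 r2) (min b (dist p q / 2)) / 2"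
  have pq: "dist p q > 0" using q(2) by simp
  have "0 < r" "r \<le> r1 / 2" "r \<le> r2 / 2" "r \<le> b / 2" "r \<le> dist p q / 2 / 2"
    using pq r1(1) r2(1) b(1) by (auto simp: r_def)
  then have r: "0 < r" "r < r1" "r < r2" "r < b" "2 * r < dist p q"
    using pq by linarith+
  have cV: "cball p r \<subseteq> V" using r2(2) r(3) by (auto simp: subset_iff)
  have cb: "cball q r \<subseteq> ball q b" using r(4) by (auto simp: subset_iff)
  have disj: "cball p r \<inter> cball q r = {}"
  proof -
    have False if "dist p z \<le> r" "dist q z \<le> r" for z
      using dist_triangle2[of p q z] that r(5) by linarith
    then show ?thesis by auto
  qed
  have trans: "c \<le> \<sigma> * partial i \<rho> x" if "x \<in> cball p r" for x
  proof -
    have "\<bar>partial i \<rho> x - partial i \<rho> p\<bar> < c" using r1(2)[of x] that r by (simp add: dist_commute)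
    then have "\<bar>\<sigma> * (partial i \<rho> x - partial i \<rho> p)\<bar> < c" using \<sigma>(1) by (simp add: abs_mult)
    moreover have "\<sigma> * (partial i \<rho> x - partial i \<rho> p) = \<sigma> * partial i \<rho> x - 2 * c"
      using \<sigma>(2) by (simp add: right_diff_distrib)
    ultimately show ?thesis by linarith
  qed
  have chart: "dipole_chart Q \<rho> \<Omega> V p q r c \<sigma> i"
  proof
    show "z \<in> closure \<Omega> \<longleftrightarrow> \<rho> z \<le> 0" if "z \<in> V" for z
      by (rule defining_function_closure[OF def that])
    show "cball q r \<inter> closure \<Omega> = {}" using cb b(2) ball_subset_cball by blast
  qed (fact Q V(3) r(1) cV disj c \<sigma>(1) trans \<Omega>V)+

  txt \<open>Only the values of \<open>Q\<close> near \<open>q\<close> are used, so \<open>\<Omega>'\<close> can be the complement of a disc.\<close>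

  define \<Omega>' where "\<Omega>' = - cball q b"
  have conclusion: "multi_partial \<alpha> Q' p = multi_partial \<alpha> Q p"
    if Q': "smooth_on UNIV Q'" and eq: "\<forall>x. x \<notin> \<Omega>' \<longrightarrow> Q' x = Q x"
      and data: "\<forall>x\<in>U \<inter> frontier \<Omega>. \<forall>y\<in>U - \<Omega>. x \<noteq> y \<longrightarrow> measurement Q' \<Omega> x y = measurement Q \<Omega> x y"
      and \<alpha>: "multi_order \<alpha> \<ge> 1" for Q' \<alpha>
  proof -
    have points: "x \<in> frontier \<Omega> \<and> x \<in> U \<and> y \<in> U - \<Omega> \<and> x \<noteq> y"
      if "dist x p < r" "\<rho> x = 0" "y \<in> cball q r" for x y
    proof -
      have xp: "x \<in> cball p r" using that(1) by (simp add: dist_commute)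
      then have "x \<in> frontier \<Omega>"
        using defining_function_frontier[OF def _ assms(2)] cV that(2) by blast
      moreover have "x \<in> U" using calculation assms(7) by (auto simp: frontier_def)
      moreover have "y \<in> U \<inter> - closure \<Omega>" using that(3) cb b(2) ball_subset_cball by blast
      moreover have "x \<noteq> y" using disj xp that(3) by blast
      ultimately show ?thesis using closure_subset[of \<Omega>] by blast
    qed
    have comparison: "dipole_comparison Q \<rho> \<Omega> V p q r c \<sigma> i Q'"
    proof (rule dipole_comparison.intro[OF chart], unfold_locales)
      show "smooth_on UNIV Q'" by fact
      show "perp_grad Q' z = perp_grad Q z" if "z \<in> cball q r" for z
      proof -
        \<comment> \<open>Equal values on the open ball of radius b give equal derivatives on the
          smaller closed ball.\<close>
        have "frechet_derivative Q' (at z) = frechet_derivative Q (at z)"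
          by (rule frechet_derivative_transform_within_open[of _ _ "ball q b"])
             (use smooth_on_differentiable[OF Q'] that cb eq in \<open>auto simp: \<Omega>'_def\<close>)
        then show ?thesis by (simp add: perp_grad_def dir_deriv_def)
      qed
      show "exit_time Q \<Omega> x y < \<infinity>" if "dist x p < r" "\<rho> x = 0" "y \<in> cball q r" for x y
        using points[OF that] fin by blast
      show "measurement Q' \<Omega> x y = measurement Q \<Omega> x y" if "dist x p < r" "\<rho> x = 0" "y \<in> cball q r" for x y
        using points[OF that] data by blast
    qed
    define bs :: "(real^2) list" where "bs = replicate (\<alpha> $ 2) (axis 2 1) @ replicate (\<alpha> $ 1) (axis 1 1)"
    have bs: "bs \<noteq> []" "set bs \<subseteq> Basis" using \<alpha> by (auto simp: bs_def multi_order_def)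
    define f where "f = fold dir_deriv bs (\<lambda>z. Q' z - Q z)"
    have "smooth_on UNIV (\<lambda>z. Q' z - Q z)" by (rule smooth_on_diff[OF Q' Q])
    then have "f differentiable at p" using bs(2) unfolding f_def smooth_on_def by blast
    then have cont: "isCont f p" by (rule differentiable_imp_continuous_within)
    \<comment> \<open>If f were nonzero at p it would be nonzero on a disc around p; but good points
      lie arbitrarily close to p, and f vanishes at each of them.\<close>
    have "f p = 0"
    proof (rule ccontr)
      assume "f p \<noteq> 0"
      then obtain e where e: "e > 0" "\<And>x. dist p x < e \<Longrightarrow> f x \<noteq> 0"
        using continuous_at_avoid[OF cont] by blast
      define \<eta> where "\<eta> = min e r"
      have \<eta>: "0 < \<eta>" "\<eta> \<le> r" "\<eta> \<le> e" using e(1) r(1) by (auto simp: \<eta>_def)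
      obtain x y where xy: "dist x p < \<eta>" "dist y q < \<eta>" "\<rho> x = 0" "normal_rate \<rho> Q (x, y) = 0"
        "0 < normal_accel \<rho> Q (x, y)"
        using dipole_chart.good_point[OF chart sol \<rho>p q(5) d outside \<eta>(1,2)] by blast
      obtain r' where r': "r' > 0" "\<And>z. dist z x < r' \<Longrightarrow> \<rho> z = 0 \<Longrightarrow>
          dist z p < r \<and> dipole_chart.short_chords_at Q \<Omega> q r z"
        using dipole_chart.short_chords[OF chart _ _ xy(3-5)] xy(1,2) \<eta>(2) by (meson less_le_trans)
      have "f x = 0"
        unfolding f_def
        by (rule dipole_comparison.all_partials_vanish[OF comparison r'(2) r'(1) xy(3) bs])
      then show False using e(2)[of x] xy(1) \<eta>(3) by (simp add: dist_commute)
    qed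
    then show ?thesis
      using fold_dir_deriv_diff[OF Q' Q bs(2)] by (simp add: f_def multi_partial_fold bs_def)
  qed
  \<comment> \<open>W is U itself. The point q witnesses that W leaves the closure of
    \<open>\<Omega>'\<close>, which is the complement of an open ball centred at q.\<close>
  show ?thesis
  proof (rule exI[of _ \<Omega>'], rule exI[of _ U], intro conjI)
    show "open \<Omega>'" by (simp add: \<Omega>'_def open_Compl)
    show "closure \<Omega> \<subseteq> \<Omega>'" using b(2) by (auto simp: \<Omega>'_def)
    have "closure \<Omega>' = - ball q b" by (simp add: \<Omega>'_def closure_complement interior_cball)
    then have "q \<in> U - closure \<Omega>'" using qCU b(1) by simp
    then show "U - closure \<Omega>' \<noteq> {}" by blast
  qed (use assms(6) p_U conclusion in \<open>auto simp only:\<close>)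
qed

end
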